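(* For any symmetric monoidal categories $\mathcal A,\mathcal B,\mathcal C$, the following equality of 1-cells $(\mathcal A\otimes\mathcal B)\otimes\mathcal C\to\mathcal B\otimes(\mathcal A\otimes\mathcal C)$ holds in $\mathrm{SMC}$: $$A'_{\mathcal B,\mathcal A,\mathcal C}\circ(S_{\mathcal A,\mathcal B}\otimes1_{\mathcal C})=(1_{\mathcal B}\otimes S_{\mathcal C,\mathcal A})\circ A'_{\mathcal B,\mathcal C,\mathcal A}\circ S_{\mathcal A,\mathcal B\otimes\mathcal C}\circ A'_{\mathcal A,\mathcal B,\mathcal C}.$$
   Context: **Basics.** All symmetric monoidal categories are small, with tensor $\otimes$, unit $I$ and natural isomorphisms $ass_{a,b,c}:a\otimes(b\otimes c)\to(a\otimes b)\otimes c$, $r_a:a\otimes I\to a$, $l_a:I\otimes a\to a$, $s_{a,b}:a\otimes b\to b\otimes a$ satisfying the usual coherence axioms. A symmetric monoidal functor $F:\mathcal A\to\mathcal B$ is a lax one: a functor with an arrow $F^0:I\to F(I)$ and a natural family $F^2_{x,y}:Fx\otimes Fy\to F(x\otimes y)$ satisfying the usual associativity, unit and symmetry axioms; it is strict if $F^0$ and all $F^2_{x,y}$ are identities. $\mathrm{SMC}$ is the 2-category of symmetric monoidal categories, symmetric monoidal functors and monoidal natural transformations. **Internal hom.** $[\mathcal A,\mathcal B]$ is the category $\mathrm{SMC}(\mathcal A,\mathcal B)$ with the pointwise symmetric monoidal structure: $(F\Box G)(a)=Fa\otimes Ga$, $(F\Box G)^0$ is $I\cong I\otimes I\xrightarrow{F^0\otimes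 G^0}F(I)\otimes G(I)$, $(F\Box G)^2_{a,b}$ is the canonical interchange $(Fa\otimes Ga)\otimes(Fb\otimes Gb)\cong(Fa\otimes Fb)\otimes(Ga\otimes Gb)$ followed by $F^2_{a,b}\otimes G^2_{a,b}$; $(\sigma\Box\tau)_a=\sigma_a\otimes\tau_a$; the unit is the constant functor at $I_{\mathcal B}$ (with $I\to I$ the identity and $I\otimes I\to I$ the canonical arrow); $ass,r,l,s$ are pointwise. For $F:\mathcal B\to\mathcal C$, $[\mathcal A,F]:[\mathcal A,\mathcal B]\to[\mathcal A,\mathcal C]$ is $H\mapsto F\circ H$, $\theta\mapsto F*\theta$, with $[\mathcal A,F]^0$ having all components $F^0$ and $[\mathcal A,F]^2_{H,K}$ having component $F^2_{Ha,Ka}$ at $a$; for a 2-cell $\sigma$, $[\mathcal A,\sigma]_H=\sigma*H$. For $F:\mathcal C\to\mathcal A$, $[F,1]:[\mathcal A,\mathcal B]\to[\mathcal C,\mathcal B]$ is precomposition with $F$, which is strict. **Duality.** For $F:\mathcal A\to[\mathcal B,\mathcal C]$ in $\mathrm{SMC}$, its dual $F^*:\mathcal B\to[\mathcal A,\mathcal C]$ is given by $F^*(b)(a)=F(a)(b)$, $F^*(b)(f)=F(f)_b$, $(F^*b)^0=(F^0)_b$, $(F^*b)^2_{a,a'}=(F^2_{a,a'})_b$, $F^*(g)_a=F(a)(g)$, $((F^* )^0)_a=(Fa)^0$, $((F^* )^2_{b,b'})_a=(Fa)^2_{b,b'}$. **Tensor.** $\mathcal A\otimes\mathcal B$ is the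 following symmetric monoidal category. Its objects are the formal words freely generated from a constant $I$ and symbols $a\otimes b$ ($a$ in $\mathcal A$, $b$ in $\mathcal B$) under a formal binary operation $X\otimes Y$. Its arrows are freely generated, under composition and the operations $p\mapsto X\otimes p$, $p\mapsto p\otimes X$ for objects $X$, by formal arrows $ass,r,l$ (with formal inverses) and $s$ for all objects, and by arrows $\alpha_b:I\to I_{\mathcal A}\otimes b$; $\beta_a:I\to a\otimes I_{\mathcal B}$; $\gamma_{a,a',b}:(a\otimes b)\otimes(a'\otimes b)\to(a\otimes a')\otimes b$; $\delta_{a,b,b'}:(a\otimes b)\otimes(a\otimes b')\to a\otimes(b\otimes b')$; $a\otimes g:a\otimes b\to a\otimes b'$ for $g:b\to b'$ in $\mathcal B$; $f\otimes b:a\otimes b\to a'\otimes b$ for $f:a\to a'$ in $\mathcal A$; modulo the smallest congruence, compatible with all $X\otimes-$ and $-\otimes X$, such that: (i) $\otimes$ is a bifunctor and $\otimes,I,ass,r,l,s$ form a symmetric monoidal structure; (ii) for each $a$, $b\mapsto a\otimes b$, $g\mapsto a\otimes g$ with structure $\beta_a$, $\delta_{a,-,-}$ is a symmetric monoidal functor $\eta(a):\mathcal B\to\mathcal A\otimes\mathcal B$; (iii) for each $b$, $a\mapsto a\otimes b$, $f\mapsto f\otimes b$ with structure $\alpha_b$, $\gamma_{-,-,b}$ is a symmetric monoidal functor $\mathcal A\to\mathcal A\otimes\mathcal B$; (iv) for each $f:a\to a'$ the family $(f\otimes b)_b$, and for each $g:b\to b'$ the family $(a\otimes g)_a$, is a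 monoidal natural transformation between the corresponding functors of (ii), resp. (iii); (v) with $c:I\otimes I\to I$ canonical, $\alpha_{b\otimes b'}\circ c=\delta_{I_{\mathcal A},b,b'}\circ(\alpha_b\otimes\alpha_{b'})$, $\beta_{a\otimes a'}\circ c=\gamma_{a,a',I_{\mathcal B}}\circ(\beta_a\otimes\beta_{a'})$, and $\beta_{I_{\mathcal A}}=\alpha_{I_{\mathcal B}}$; (vi) $\gamma_{a,a',b\otimes b'}\circ(\delta_{a,b,b'}\otimes\delta_{a',b,b'})=\delta_{a\otimes a',b,b'}\circ(\gamma_{a,a',b}\otimes\gamma_{a,a',b'})\circ m$, where $m$ is the canonical isomorphism exchanging the two middle factors $a\otimes b'$ and $a'\otimes b$. The symmetric monoidal functor $\eta:\mathcal A\to[\mathcal B,\mathcal A\otimes\mathcal B]$ is $a\mapsto\eta(a)$, $\eta(f)_b=f\otimes b$, $(\eta^0)_b=\alpha_b$, $(\eta^2_{a,a'})_b=\gamma_{a,a',b}$. **$En$ and $Rn$.** For $F:\mathcal A\to[\mathcal B,\mathcal C]$, $En(F):\mathcal A\otimes\mathcal B\to\mathcal C$ is the strict symmetric monoidal functor with $a\otimes b\mapsto F(a)(b)$, $\alpha_b\mapsto(F^0)_b$, $\beta_a\mapsto(Fa)^0$, $\gamma_{a,a',b}\mapsto(F^2_{a,a'})_b$, $\delta_{a,b,b'}\mapsto(Fa)^2_{b,b'}$, $f\otimes b\mapsto F(f)_b$, $a\otimes g\mapsto F(a)(g)$. $Rn:[\mathcal A\otimes\mathcal B,\mathcal C]\to[\mathcal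 A,[\mathcal B,\mathcal C]]$ is the strict symmetric monoidal functor $F\mapsto[\mathcal B,F]\circ\eta$, $\sigma\mapsto[\mathcal B,\sigma]*\eta$. **Tensor on 1-cells.** For $F:\mathcal A\to\mathcal C$, $F\otimes1_{\mathcal B}=En(\eta\circ F):\mathcal A\otimes\mathcal B\to\mathcal C\otimes\mathcal B$ with $\eta:\mathcal C\to[\mathcal B,\mathcal C\otimes\mathcal B]$; for $G:\mathcal B\to\mathcal D$, $1_{\mathcal A}\otimes G=En([G,1]\circ\eta):\mathcal A\otimes\mathcal B\to\mathcal A\otimes\mathcal D$ with $\eta:\mathcal A\to[\mathcal D,\mathcal A\otimes\mathcal D]$. **Canonical arrows.** $S_{\mathcal A,\mathcal B}=En(\eta^* ):\mathcal A\otimes\mathcal B\to\mathcal B\otimes\mathcal A$, where $\eta^*:\mathcal A\to[\mathcal B,\mathcal B\otimes\mathcal A]$ is the dual of $\eta:\mathcal B\to[\mathcal A,\mathcal B\otimes\mathcal A]$. $A'_{\mathcal A,\mathcal B,\mathcal C}:(\mathcal A\otimes\mathcal B)\otimes\mathcal C\to\mathcal A\otimes(\mathcal B\otimes\mathcal C)$ is $En(En(K))$ where $K$ is the composite $\mathcal A\xrightarrow{\eta}[\mathcal B\otimes\mathcal C,\mathcal A\otimes(\mathcal B\otimes\mathcal C)]\xrightarrow{Rn}[\mathcal B,[\mathcal C,\mathcal A\otimes(\mathcal B\otimes\mathcal C)]]$. *)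

theory Defs
  imports "HOL-Library.FuncSet"
begin

section \<open>Small symmetric monoidal categories\<close>

text \<open>
  The operations are total HOL functions, and only their values on the carriers \<open>Ob\<close> and \<open>Ar\<close>
  matter. The associator goes from \<open>a (b c)\<close> to \<open>(a b) c\<close>.
\<close>

record ('o, 'm) smcat =
  Ob :: "'o set"
  Ar :: "'m set"
  Dom :: "'m \<Rightarrow> 'o"
  Cod :: "'m \<Rightarrow> 'o"
  Ide :: "'o \<Rightarrow> 'm"
  Cmp :: "'m \<Rightarrow> 'm \<Rightarrow> 'm"  (infixl "\<cdot>\<index>" 55)
  Ten :: "'o \<Rightarrow> 'o \<Rightarrow> 'o"  (infixl "\<otimes>\<index>" 70)
  TenA :: "'m \<Rightarrow> 'm \<Rightarrow> 'm"  (infixl "\<boxtimes>\<index>" 70)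
  Unit :: "'o"  ("\<one>\<index>")
  Ass :: "'o \<Rightarrow> 'o \<Rightarrow> 'o \<Rightarrow> 'm"
  Rho :: "'o \<Rightarrow> 'm"
  Lam :: "'o \<Rightarrow> 'm"
  Sym :: "'o \<Rightarrow> 'o \<Rightarrow> 'm"

definition arrows :: "('o, 'm) smcat \<Rightarrow> 'o \<Rightarrow> 'o \<Rightarrow> 'm set" where
  "arrows A x y = {f \<in> Ar A. Dom A f = x \<and> Cod A f = y}"

definition inverse_arrows :: "('o, 'm) smcat \<Rightarrow> 'm \<Rightarrow> 'm \<Rightarrow> bool" where
  "inverse_arrows A f g \<longleftrightarrow>
     f \<in> arrows A (Cod A g) (Dom A g) \<and> g \<in> arrows A (Cod A f) (Dom A f) \<and>
     g \<cdot>\<^bsub>A\<^esub> f = Ide A (Dom A f) \<and> f \<cdot>\<^bsub>A\<^esub> g = Ide A (Cod A f)"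

definition isos :: "('o, 'm) smcat \<Rightarrow> 'o \<Rightarrow> 'o \<Rightarrow> 'm set" where
  "isos A x y = {f \<in> arrows A x y. \<exists>g. inverse_arrows A f g}"

definition inv_arrow :: "('o, 'm) smcat \<Rightarrow> 'm \<Rightarrow> 'm" where
  "inv_arrow A f = (THE g. inverse_arrows A f g)"

locale symmetric_monoidal_category =
  fixes A :: "('o, 'm) smcat" (structure)
  assumes Dom_closed: "f \<in> Ar A \<Longrightarrow> Dom A f \<in> Ob A"
    and Cod_closed: "f \<in> Ar A \<Longrightarrow> Cod A f \<in> Ob A"
    and Ide_closed: "x \<in> Ob A \<Longrightarrow> Ide A x \<in> arrows A x x"
    and Cmp_closed: "g \<in> arrows A y z \<Longrightarrow> f \<in> arrows A x y \<Longrightarrow> g \<cdot> f \<in> arrows A x z"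
    and Ide_left: "f \<in> arrows A x y \<Longrightarrow> Ide A y \<cdot> f = f"
    and Ide_right: "f \<in> arrows A x y \<Longrightarrow> f \<cdot> Ide A x = f"
    and Cmp_assoc: "h \<in> arrows A z w \<Longrightarrow> g \<in> arrows A y z \<Longrightarrow> f \<in> arrows A x y \<Longrightarrow>
          (h \<cdot> g) \<cdot> f = h \<cdot> (g \<cdot> f)"
    and Unit_closed: "\<one> \<in> Ob A"
    and Ten_closed: "x \<in> Ob A \<Longrightarrow> y \<in> Ob A \<Longrightarrow> x \<otimes> y \<in> Ob A"
    and TenA_closed: "f \<in> arrows A x x' \<Longrightarrow> g \<in> arrows A y y' \<Longrightarrow>
          f \<boxtimes> g \<in> arrows A (x \<otimes> y) (x' \<otimes> y')"
    and TenA_Ide: "x \<in> Ob A \<Longrightarrow> y \<in> Ob A \<Longrightarrow> Ide A x \<boxtimes> Ide A y = Ide A (x \<otimes> y)"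
    and TenA_Cmp: "f' \<in> arrows A x' x'' \<Longrightarrow> f \<in> arrows A x x' \<Longrightarrow>
          g' \<in> arrows A y' y'' \<Longrightarrow> g \<in> arrows A y y' \<Longrightarrow>
          (f' \<cdot> f) \<boxtimes> (g' \<cdot> g) = (f' \<boxtimes> g') \<cdot> (f \<boxtimes> g)"
    and Ass_iso: "x \<in> Ob A \<Longrightarrow> y \<in> Ob A \<Longrightarrow> z \<in> Ob A \<Longrightarrow>
          Ass A x y z \<in> isos A (x \<otimes> (y \<otimes> z)) ((x \<otimes> y) \<otimes> z)"
    and Rho_iso: "x \<in> Ob A \<Longrightarrow> Rho A x \<in> isos A (x \<otimes> \<one>) x"
    and Lam_iso: "x \<in> Ob A \<Longrightarrow> Lam A x \<in> isos A (\<one> \<otimes> x) x"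
    and Sym_iso: "x \<in> Ob A \<Longrightarrow> y \<in> Ob A \<Longrightarrow> Sym A x y \<in> isos A (x \<otimes> y) (y \<otimes> x)"
    and Ass_natural: "f \<in> arrows A x x' \<Longrightarrow> g \<in> arrows A y y' \<Longrightarrow> h \<in> arrows A z z' \<Longrightarrow>
          Ass A x' y' z' \<cdot> (f \<boxtimes> (g \<boxtimes> h)) = ((f \<boxtimes> g) \<boxtimes> h) \<cdot> Ass A x y z"
    and Rho_natural: "f \<in> arrows A x x' \<Longrightarrow> Rho A x' \<cdot> (f \<boxtimes> Ide A \<one>) = f \<cdot> Rho A x"
    and Lam_natural: "f \<in> arrows A x x' \<Longrightarrow> Lam A x' \<cdot> (Ide A \<one> \<boxtimes> f) = f \<cdot> Lam A x"
    and Sym_natural: "f \<in> arrows A x x' \<Longrightarrow> g \<in> arrows A y y' \<Longrightarrow>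
          Sym A x' y' \<cdot> (f \<boxtimes> g) = (g \<boxtimes> f) \<cdot> Sym A x y"
    and pentagon: "x \<in> Ob A \<Longrightarrow> y \<in> Ob A \<Longrightarrow> z \<in> Ob A \<Longrightarrow> w \<in> Ob A \<Longrightarrow>
          Ass A (x \<otimes> y) z w \<cdot> Ass A x y (z \<otimes> w) =
          (Ass A x y z \<boxtimes> Ide A w) \<cdot> Ass A x (y \<otimes> z) w \<cdot> (Ide A x \<boxtimes> Ass A y z w)"
    and triangle: "x \<in> Ob A \<Longrightarrow> y \<in> Ob A \<Longrightarrow>
          (Rho A x \<boxtimes> Ide A y) \<cdot> Ass A x \<one> y = Ide A x \<boxtimes> Lam A y"
    and hexagon: "x \<in> Ob A \<Longrightarrow> y \<in> Ob A \<Longrightarrow> z \<in> Ob A \<Longrightarrow>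
          Ass A z x y \<cdot> Sym A (x \<otimes> y) z \<cdot> Ass A x y z =
          (Sym A x z \<boxtimes> Ide A y) \<cdot> Ass A x z y \<cdot> (Ide A x \<boxtimes> Sym A y z)"
    and Sym_Sym: "x \<in> Ob A \<Longrightarrow> y \<in> Ob A \<Longrightarrow> Sym A y x \<cdot> Sym A x y = Ide A (x \<otimes> y)"
    and Lam_Sym: "x \<in> Ob A \<Longrightarrow> Lam A x \<cdot> Sym A x \<one> = Rho A x"

text \<open>The canonical isomorphism \<open>(p q) (r s) \<rightarrow> (p r) (q s)\<close>.\<close>

definition interchange :: "('o, 'm) smcat \<Rightarrow> 'o \<Rightarrow> 'o \<Rightarrow> 'o \<Rightarrow> 'o \<Rightarrow> 'm" where
  "interchange A p q r s =
     Ass A p r (q \<otimes>\<^bsub>A\<^esub> s) \<cdot>\<^bsub>A\<^esub>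
     (Ide A p \<boxtimes>\<^bsub>A\<^esub>
        (inv_arrow A (Ass A r q s) \<cdot>\<^bsub>A\<^esub> (Sym A q r \<boxtimes>\<^bsub>A\<^esub> Ide A s) \<cdot>\<^bsub>A\<^esub> Ass A q r s)) \<cdot>\<^bsub>A\<^esub>
     inv_arrow A (Ass A p q (r \<otimes>\<^bsub>A\<^esub> s))"

section \<open>The 2-category SMC\<close>

text \<open>
  The maps making up 1-cells and 2-cells are extensional (\<open>undefined\<close> off the carriers), so that
  HOL equality of these records is equality of functors and of transformations.
\<close>

record ('o, 'm, 'p, 'n) smfun =
  Src :: "('o, 'm) smcat"
  Tgt :: "('p, 'n) smcat"
  onO :: "'o \<Rightarrow> 'p"
  onA :: "'m \<Rightarrow> 'n"
  lax0 :: "'n"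
  lax2 :: "'o \<Rightarrow> 'o \<Rightarrow> 'n"

locale symmetric_monoidal_functor =
  A: symmetric_monoidal_category A + B: symmetric_monoidal_category B
  for A :: "('o, 'm) smcat" and B :: "('p, 'n) smcat" +
  fixes F :: "('o, 'm, 'p, 'n) smfun"
  assumes Src: "Src F = A"
    and Tgt: "Tgt F = B"
    and onO_closed: "onO F \<in> Ob A \<rightarrow>\<^sub>E Ob B"
    and onA_extensional: "onA F \<in> extensional (Ar A)"
    and onA_closed: "f \<in> arrows A x y \<Longrightarrow> onA F f \<in> arrows B (onO F x) (onO F y)"
    and onA_Ide: "x \<in> Ob A \<Longrightarrow> onA F (Ide A x) = Ide B (onO F x)"
    and onA_Cmp: "g \<in> arrows A y z \<Longrightarrow> f \<in> arrows A x y \<Longrightarrow>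
          onA F (g \<cdot>\<^bsub>A\<^esub> f) = onA F g \<cdot>\<^bsub>B\<^esub> onA F f"
    and lax0_closed: "lax0 F \<in> arrows B \<one>\<^bsub>B\<^esub> (onO F \<one>\<^bsub>A\<^esub>)"
    and lax2_extensional: "lax2 F \<in> Ob A \<rightarrow>\<^sub>E (Ob A \<rightarrow>\<^sub>E Ar B)"
    and lax2_closed: "x \<in> Ob A \<Longrightarrow> y \<in> Ob A \<Longrightarrow>
          lax2 F x y \<in> arrows B (onO F x \<otimes>\<^bsub>B\<^esub> onO F y) (onO F (x \<otimes>\<^bsub>A\<^esub> y))"
    and lax2_natural: "f \<in> arrows A x x' \<Longrightarrow> g \<in> arrows A y y' \<Longrightarrow>
          lax2 F x' y' \<cdot>\<^bsub>B\<^esub> (onA F f \<boxtimes>\<^bsub>B\<^esub> onA F g) = onA F (f \<boxtimes>\<^bsub>A\<^esub> g) \<cdot>\<^bsub>B\<^esub> lax2 F x y"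
    and lax_assoc: "x \<in> Ob A \<Longrightarrow> y \<in> Ob A \<Longrightarrow> z \<in> Ob A \<Longrightarrow>
          lax2 F (x \<otimes>\<^bsub>A\<^esub> y) z \<cdot>\<^bsub>B\<^esub> (lax2 F x y \<boxtimes>\<^bsub>B\<^esub> Ide B (onO F z)) \<cdot>\<^bsub>B\<^esub>
            Ass B (onO F x) (onO F y) (onO F z) =
          onA F (Ass A x y z) \<cdot>\<^bsub>B\<^esub> lax2 F x (y \<otimes>\<^bsub>A\<^esub> z) \<cdot>\<^bsub>B\<^esub> (Ide B (onO F x) \<boxtimes>\<^bsub>B\<^esub> lax2 F y z)"
    and lax_Rho: "x \<in> Ob A \<Longrightarrow>
          onA F (Rho A x) \<cdot>\<^bsub>B\<^esub> lax2 F x \<one>\<^bsub>A\<^esub> \<cdot>\<^bsub>B\<^esub> (Ide B (onO F x) \<boxtimes>\<^bsub>B\<^esub> lax0 F) = Rho B (onO F x)"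
    and lax_Lam: "x \<in> Ob A \<Longrightarrow>
          onA F (Lam A x) \<cdot>\<^bsub>B\<^esub> lax2 F \<one>\<^bsub>A\<^esub> x \<cdot>\<^bsub>B\<^esub> (lax0 F \<boxtimes>\<^bsub>B\<^esub> Ide B (onO F x)) = Lam B (onO F x)"
    and lax_Sym: "x \<in> Ob A \<Longrightarrow> y \<in> Ob A \<Longrightarrow>
          onA F (Sym A x y) \<cdot>\<^bsub>B\<^esub> lax2 F x y = lax2 F y x \<cdot>\<^bsub>B\<^esub> Sym B (onO F x) (onO F y)"

definition smf_comp ::
  "('p, 'n, 'q, 'k) smfun \<Rightarrow> ('o, 'm, 'p, 'n) smfun \<Rightarrow> ('o, 'm, 'q, 'k) smfun"
  (infixl "\<circ>\<^sub>1" 55) where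
  "G \<circ>\<^sub>1 F = \<lparr>Src = Src F, Tgt = Tgt G,
     onO = (\<lambda>x\<in>Ob (Src F). onO G (onO F x)),
     onA = (\<lambda>f\<in>Ar (Src F). onA G (onA F f)),
     lax0 = onA G (lax0 F) \<cdot>\<^bsub>Tgt G\<^esub> lax0 G,
     lax2 = (\<lambda>x\<in>Ob (Src F). \<lambda>y\<in>Ob (Src F).
       onA G (lax2 F x y) \<cdot>\<^bsub>Tgt G\<^esub> lax2 G (onO F x) (onO F y))\<rparr>"

definition strict_smf ::
  "('o, 'm) smcat \<Rightarrow> ('p, 'n) smcat \<Rightarrow> ('o \<Rightarrow> 'p) \<Rightarrow> ('m \<Rightarrow> 'n) \<Rightarrow> ('o, 'm, 'p, 'n) smfun" where
  "strict_smf A B fO fA = \<lparr>Src = A, Tgt = B,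
     onO = (\<lambda>x\<in>Ob A. fO x),
     onA = (\<lambda>f\<in>Ar A. fA f),
     lax0 = Ide B \<one>\<^bsub>B\<^esub>,
     lax2 = (\<lambda>x\<in>Ob A. \<lambda>y\<in>Ob A. Ide B (fO x \<otimes>\<^bsub>B\<^esub> fO y))\<rparr>"

record ('o, 'm, 'p, 'n) mtrans =
  NDom :: "('o, 'm, 'p, 'n) smfun"
  NCod :: "('o, 'm, 'p, 'n) smfun"
  at :: "'o \<Rightarrow> 'n"

locale monoidal_transformation =
  F: symmetric_monoidal_functor A B "NDom \<sigma>" + G: symmetric_monoidal_functor A B "NCod \<sigma>"
  for A :: "('o, 'm) smcat" and B :: "('p, 'n) smcat" and \<sigma> :: "('o, 'm, 'p, 'n) mtrans" +
  assumes at_extensional: "at \<sigma> \<in> extensional (Ob A)"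
    and at_closed: "x \<in> Ob A \<Longrightarrow> at \<sigma> x \<in> arrows B (onO (NDom \<sigma>) x) (onO (NCod \<sigma>) x)"
    and at_natural: "f \<in> arrows A x y \<Longrightarrow>
          at \<sigma> y \<cdot>\<^bsub>B\<^esub> onA (NDom \<sigma>) f = onA (NCod \<sigma>) f \<cdot>\<^bsub>B\<^esub> at \<sigma> x"
    and at_lax0: "at \<sigma> \<one>\<^bsub>A\<^esub> \<cdot>\<^bsub>B\<^esub> lax0 (NDom \<sigma>) = lax0 (NCod \<sigma>)"
    and at_lax2: "x \<in> Ob A \<Longrightarrow> y \<in> Ob A \<Longrightarrow>
          at \<sigma> (x \<otimes>\<^bsub>A\<^esub> y) \<cdot>\<^bsub>B\<^esub> lax2 (NDom \<sigma>) x y = lax2 (NCod \<sigma>) x y \<cdot>\<^bsub>B\<^esub> (at \<sigma> x \<boxtimes>\<^bsub>B\<^esub> at \<sigma> y)"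

text \<open>The whiskerings \<open>F * \<theta>\<close> and \<open>\<sigma> * H\<close>.\<close>

definition whisker_left ::
  "('p, 'n, 'q, 'k) smfun \<Rightarrow> ('o, 'm, 'p, 'n) mtrans \<Rightarrow> ('o, 'm, 'q, 'k) mtrans" where
  "whisker_left F \<theta> = \<lparr>NDom = F \<circ>\<^sub>1 NDom \<theta>, NCod = F \<circ>\<^sub>1 NCod \<theta>,
     at = (\<lambda>x\<in>Ob (Src (NDom \<theta>)). onA F (at \<theta> x))\<rparr>"

definition whisker_right ::
  "('p, 'n, 'q, 'k) mtrans \<Rightarrow> ('o, 'm, 'p, 'n) smfun \<Rightarrow> ('o, 'm, 'q, 'k) mtrans" where
  "whisker_right \<sigma> H = \<lparr>NDom = NDom \<sigma> \<circ>\<^sub>1 H, NCod = NCod \<sigma> \<circ>\<^sub>1 H,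
     at = (\<lambda>x\<in>Ob (Src H). at \<sigma> (onO H x))\<rparr>"

section \<open>The internal hom\<close>

definition const_smf :: "('o, 'm) smcat \<Rightarrow> ('p, 'n) smcat \<Rightarrow> ('o, 'm, 'p, 'n) smfun" where
  "const_smf A B = \<lparr>Src = A, Tgt = B,
     onO = (\<lambda>x\<in>Ob A. \<one>\<^bsub>B\<^esub>),
     onA = (\<lambda>f\<in>Ar A. Ide B \<one>\<^bsub>B\<^esub>),
     lax0 = Ide B \<one>\<^bsub>B\<^esub>,
     lax2 = (\<lambda>x\<in>Ob A. \<lambda>y\<in>Ob A. Rho B \<one>\<^bsub>B\<^esub>)\<rparr>"

definition box_smf ::
  "('o, 'm) smcat \<Rightarrow> ('p, 'n) smcat \<Rightarrow>
   ('o, 'm, 'p, 'n) smfun \<Rightarrow> ('o, 'm, 'p, 'n) smfun \<Rightarrow> ('o, 'm, 'p, 'n) smfun" where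
  "box_smf A B F G = \<lparr>Src = A, Tgt = B,
     onO = (\<lambda>x\<in>Ob A. onO F x \<otimes>\<^bsub>B\<^esub> onO G x),
     onA = (\<lambda>f\<in>Ar A. onA F f \<boxtimes>\<^bsub>B\<^esub> onA G f),
     lax0 = (lax0 F \<boxtimes>\<^bsub>B\<^esub> lax0 G) \<cdot>\<^bsub>B\<^esub> inv_arrow B (Rho B \<one>\<^bsub>B\<^esub>),
     lax2 = (\<lambda>x\<in>Ob A. \<lambda>y\<in>Ob A.
       (lax2 F x y \<boxtimes>\<^bsub>B\<^esub> lax2 G x y) \<cdot>\<^bsub>B\<^esub>
       interchange B (onO F x) (onO G x) (onO F y) (onO G y))\<rparr>"

definition ihom ::
  "('o, 'm) smcat \<Rightarrow> ('p, 'n) smcat \<Rightarrow> (('o, 'm, 'p, 'n) smfun, ('o, 'm, 'p, 'n) mtrans) smcat" where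
  "ihom A B = \<lparr>
     Ob = {F. symmetric_monoidal_functor A B F},
     Ar = {\<sigma>. monoidal_transformation A B \<sigma>},
     Dom = NDom,
     Cod = NCod,
     Ide = (\<lambda>F. \<lparr>NDom = F, NCod = F, at = (\<lambda>x\<in>Ob A. Ide B (onO F x))\<rparr>),
     Cmp = (\<lambda>\<tau> \<sigma>. \<lparr>NDom = NDom \<sigma>, NCod = NCod \<tau>, at = (\<lambda>x\<in>Ob A. at \<tau> x \<cdot>\<^bsub>B\<^esub> at \<sigma> x)\<rparr>),
     Ten = box_smf A B,
     TenA = (\<lambda>\<sigma> \<tau>. \<lparr>NDom = box_smf A B (NDom \<sigma>) (NDom \<tau>), NCod = box_smf A B (NCod \<sigma>) (NCod \<tau>),
       at = (\<lambda>x\<in>Ob A. at \<sigma> x \<boxtimes>\<^bsub>B\<^esub> at \<tau> x)\<rparr>),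
     Unit = const_smf A B,
     Ass = (\<lambda>F G H. \<lparr>NDom = box_smf A B F (box_smf A B G H), NCod = box_smf A B (box_smf A B F G) H,
       at = (\<lambda>x\<in>Ob A. Ass B (onO F x) (onO G x) (onO H x))\<rparr>),
     Rho = (\<lambda>F. \<lparr>NDom = box_smf A B F (const_smf A B), NCod = F,
       at = (\<lambda>x\<in>Ob A. Rho B (onO F x))\<rparr>),
     Lam = (\<lambda>F. \<lparr>NDom = box_smf A B (const_smf A B) F, NCod = F,
       at = (\<lambda>x\<in>Ob A. Lam B (onO F x))\<rparr>),
     Sym = (\<lambda>F G. \<lparr>NDom = box_smf A B F G, NCod = box_smf A B G F,
       at = (\<lambda>x\<in>Ob A. Sym B (onO F x) (onO G x))\<rparr>)\<rparr>"

text \<open>The functors \<open>[A, F]\<close>, the transformations \<open>[A, \<sigma>]\<close> and the functors \<open>[F, 1]\<close>.\<close>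

definition ihom_post ::
  "('o, 'm) smcat \<Rightarrow> ('p, 'n, 'q, 'k) smfun \<Rightarrow>
   (('o, 'm, 'p, 'n) smfun, ('o, 'm, 'p, 'n) mtrans,
    ('o, 'm, 'q, 'k) smfun, ('o, 'm, 'q, 'k) mtrans) smfun" where
  "ihom_post A F = (let X = ihom A (Src F); Y = ihom A (Tgt F) in
     \<lparr>Src = X, Tgt = Y,
      onO = (\<lambda>H\<in>Ob X. F \<circ>\<^sub>1 H),
      onA = (\<lambda>\<theta>\<in>Ar X. whisker_left F \<theta>),
      lax0 = \<lparr>NDom = \<one>\<^bsub>Y\<^esub>, NCod = F \<circ>\<^sub>1 \<one>\<^bsub>X\<^esub>, at = (\<lambda>x\<in>Ob A. lax0 F)\<rparr>,
      lax2 = (\<lambda>H\<in>Ob X. \<lambda>K\<in>Ob X.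
        \<lparr>NDom = (F \<circ>\<^sub>1 H) \<otimes>\<^bsub>Y\<^esub> (F \<circ>\<^sub>1 K), NCod = F \<circ>\<^sub>1 (H \<otimes>\<^bsub>X\<^esub> K),
         at = (\<lambda>x\<in>Ob A. lax2 F (onO H x) (onO K x))\<rparr>)\<rparr>)"

definition ihom_post_trans ::
  "('o, 'm) smcat \<Rightarrow> ('p, 'n, 'q, 'k) mtrans \<Rightarrow>
   (('o, 'm, 'p, 'n) smfun, ('o, 'm, 'p, 'n) mtrans,
    ('o, 'm, 'q, 'k) smfun, ('o, 'm, 'q, 'k) mtrans) mtrans" where
  "ihom_post_trans A \<sigma> = \<lparr>NDom = ihom_post A (NDom \<sigma>), NCod = ihom_post A (NCod \<sigma>),
     at = (\<lambda>H\<in>Ob (ihom A (Src (NDom \<sigma>))). whisker_right \<sigma> H)\<rparr>"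

definition ihom_pre ::
  "('o, 'm, 'p, 'n) smfun \<Rightarrow> ('q, 'k) smcat \<Rightarrow>
   (('p, 'n, 'q, 'k) smfun, ('p, 'n, 'q, 'k) mtrans,
    ('o, 'm, 'q, 'k) smfun, ('o, 'm, 'q, 'k) mtrans) smfun" where
  "ihom_pre F B = strict_smf (ihom (Tgt F) B) (ihom (Src F) B) (\<lambda>H. H \<circ>\<^sub>1 F) (\<lambda>\<theta>. whisker_right \<theta> F)"

text \<open>The dual of \<open>F : A \<rightarrow> [B, C]\<close>.\<close>

definition dual ::
  "('o, 'm) smcat \<Rightarrow> ('p, 'n) smcat \<Rightarrow> ('q, 'k) smcat \<Rightarrow>
   ('o, 'm, ('p, 'n, 'q, 'k) smfun, ('p, 'n, 'q, 'k) mtrans) smfun \<Rightarrow>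
   ('p, 'n, ('o, 'm, 'q, 'k) smfun, ('o, 'm, 'q, 'k) mtrans) smfun" where
  "dual A B C F =
    (let ob = (\<lambda>b. \<lparr>Src = A, Tgt = C,
           onO = (\<lambda>a\<in>Ob A. onO (onO F a) b),
           onA = (\<lambda>f\<in>Ar A. at (onA F f) b),
           lax0 = at (lax0 F) b,
           lax2 = (\<lambda>a\<in>Ob A. \<lambda>a'\<in>Ob A. at (lax2 F a a') b)\<rparr>)
     in \<lparr>Src = B, Tgt = ihom A C,
         onO = (\<lambda>b\<in>Ob B. ob b),
         onA = (\<lambda>g\<in>Ar B. \<lparr>NDom = ob (Dom B g), NCod = ob (Cod B g),
           at = (\<lambda>a\<in>Ob A. onA (onO F a) g)\<rparr>),
         lax0 = \<lparr>NDom = const_smf A C, NCod = ob \<one>\<^bsub>B\<^esub>, at = (\<lambda>a\<in>Ob A. lax0 (onO F a))\<rparr>,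
         lax2 = (\<lambda>b\<in>Ob B. \<lambda>b'\<in>Ob B.
           \<lparr>NDom = box_smf A C (ob b) (ob b'), NCod = ob (b \<otimes>\<^bsub>B\<^esub> b'),
            at = (\<lambda>a\<in>Ob A. lax2 (onO F a) b b')\<rparr>)\<rparr>)"

section \<open>The tensor product of symmetric monoidal categories\<close>

datatype ('a, 'b) tword =
    WUnit
  | WGen 'a 'b
  | WTen "('a, 'b) tword" "('a, 'b) tword"

primrec word_over :: "('a, 'f) smcat \<Rightarrow> ('b, 'g) smcat \<Rightarrow> ('a, 'b) tword \<Rightarrow> bool" where
  "word_over A B WUnit \<longleftrightarrow> True"
| "word_over A B (WGen a b) \<longleftrightarrow> a \<in> Ob A \<and> b \<in> Ob B"
| "word_over A B (WTen X Y) \<longleftrightarrow> word_over A B X \<and> word_over A B Y"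

text \<open>
  Formal arrows: \<open>TLeft X p\<close> is \<open>X \<otimes> p\<close>, \<open>TRight p X\<close> is \<open>p \<otimes> X\<close>, \<open>TArrA f b\<close> is \<open>f \<otimes> b\<close> and
  \<open>TArrB a g\<close> is \<open>a \<otimes> g\<close>.
\<close>

datatype ('a, 'f, 'b, 'g) tterm =
    TId "('a, 'b) tword"
  | TComp "('a, 'f, 'b, 'g) tterm" "('a, 'f, 'b, 'g) tterm"
  | TLeft "('a, 'b) tword" "('a, 'f, 'b, 'g) tterm"
  | TRight "('a, 'f, 'b, 'g) tterm" "('a, 'b) tword"
  | TAss "('a, 'b) tword" "('a, 'b) tword" "('a, 'b) tword"
  | TAssInv "('a, 'b) tword" "('a, 'b) tword" "('a, 'b) tword"
  | TRho "('a, 'b) tword"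
  | TRhoInv "('a, 'b) tword"
  | TLam "('a, 'b) tword"
  | TLamInv "('a, 'b) tword"
  | TSym "('a, 'b) tword" "('a, 'b) tword"
  | TAlpha 'b
  | TBeta 'a
  | TGamma 'a 'a 'b
  | TDelta 'a 'b 'b
  | TArrA 'f 'b
  | TArrB 'a 'g

primrec tdom :: "('a, 'f) smcat \<Rightarrow> ('b, 'g) smcat \<Rightarrow> ('a, 'f, 'b, 'g) tterm \<Rightarrow> ('a, 'b) tword" where
  "tdom A B (TId X) = X"
| "tdom A B (TComp t u) = tdom A B u"
| "tdom A B (TLeft X p) = WTen X (tdom A B p)"
| "tdom A B (TRight p X) = WTen (tdom A B p) X"
| "tdom A B (TAss X Y Z) = WTen X (WTen Y Z)"
| "tdom A B (TAssInv X Y Z) = WTen (WTen X Y) Z"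
| "tdom A B (TRho X) = WTen X WUnit"
| "tdom A B (TRhoInv X) = X"
| "tdom A B (TLam X) = WTen WUnit X"
| "tdom A B (TLamInv X) = X"
| "tdom A B (TSym X Y) = WTen X Y"
| "tdom A B (TAlpha b) = WUnit"
| "tdom A B (TBeta a) = WUnit"
| "tdom A B (TGamma a a' b) = WTen (WGen a b) (WGen a' b)"
| "tdom A B (TDelta a b b') = WTen (WGen a b) (WGen a b')"
| "tdom A B (TArrA f b) = WGen (Dom A f) b"
| "tdom A B (TArrB a g) = WGen a (Dom B g)"

primrec tcod :: "('a, 'f) smcat \<Rightarrow> ('b, 'g) smcat \<Rightarrow> ('a, 'f, 'b, 'g) tterm \<Rightarrow> ('a, 'b) tword" where
  "tcod A B (TId X) = X"
| "tcod A B (TComp t u) = tcod A B t"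
| "tcod A B (TLeft X p) = WTen X (tcod A B p)"
| "tcod A B (TRight p X) = WTen (tcod A B p) X"
| "tcod A B (TAss X Y Z) = WTen (WTen X Y) Z"
| "tcod A B (TAssInv X Y Z) = WTen X (WTen Y Z)"
| "tcod A B (TRho X) = X"
| "tcod A B (TRhoInv X) = WTen X WUnit"
| "tcod A B (TLam X) = X"
| "tcod A B (TLamInv X) = WTen WUnit X"
| "tcod A B (TSym X Y) = WTen Y X"
| "tcod A B (TAlpha b) = WGen \<one>\<^bsub>A\<^esub> b"
| "tcod A B (TBeta a) = WGen a \<one>\<^bsub>B\<^esub>"
| "tcod A B (TGamma a a' b) = WGen (a \<otimes>\<^bsub>A\<^esub> a') b"
| "tcod A B (TDelta a b b') = WGen a (b \<otimes>\<^bsub>B\<^esub> b')"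
| "tcod A B (TArrA f b) = WGen (Cod A f) b"
| "tcod A B (TArrB a g) = WGen a (Cod B g)"

primrec term_over :: "('a, 'f) smcat \<Rightarrow> ('b, 'g) smcat \<Rightarrow> ('a, 'f, 'b, 'g) tterm \<Rightarrow> bool" where
  "term_over A B (TId X) \<longleftrightarrow> word_over A B X"
| "term_over A B (TComp t u) \<longleftrightarrow> term_over A B t \<and> term_over A B u \<and> tdom A B t = tcod A B u"
| "term_over A B (TLeft X p) \<longleftrightarrow> word_over A B X \<and> term_over A B p"
| "term_over A B (TRight p X) \<longleftrightarrow> term_over A B p \<and> word_over A B X"
| "term_over A B (TAss X Y Z) \<longleftrightarrow> word_over A B X \<and> word_over A B Y \<and> word_over A B Z"
| "term_over A B (TAssInv X Y Z) \<longleftrightarrow> word_over A B X \<and> word_over A B Y \<and> word_over A B Z"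
| "term_over A B (TRho X) \<longleftrightarrow> word_over A B X"
| "term_over A B (TRhoInv X) \<longleftrightarrow> word_over A B X"
| "term_over A B (TLam X) \<longleftrightarrow> word_over A B X"
| "term_over A B (TLamInv X) \<longleftrightarrow> word_over A B X"
| "term_over A B (TSym X Y) \<longleftrightarrow> word_over A B X \<and> word_over A B Y"
| "term_over A B (TAlpha b) \<longleftrightarrow> b \<in> Ob B"
| "term_over A B (TBeta a) \<longleftrightarrow> a \<in> Ob A"
| "term_over A B (TGamma a a' b) \<longleftrightarrow> a \<in> Ob A \<and> a' \<in> Ob A \<and> b \<in> Ob B"
| "term_over A B (TDelta a b b') \<longleftrightarrow> a \<in> Ob A \<and> b \<in> Ob B \<and> b' \<in> Ob B"
| "term_over A B (TArrA f b) \<longleftrightarrow> f \<in> Ar A \<and> b \<in> Ob B"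
| "term_over A B (TArrB a g) \<longleftrightarrow> a \<in> Ob A \<and> g \<in> Ar B"

definition tten ::
  "('a, 'f) smcat \<Rightarrow> ('b, 'g) smcat \<Rightarrow>
   ('a, 'f, 'b, 'g) tterm \<Rightarrow> ('a, 'f, 'b, 'g) tterm \<Rightarrow> ('a, 'f, 'b, 'g) tterm" where
  "tten A B p q = TComp (TRight p (tcod A B q)) (TLeft (tdom A B p) q)"

definition tinterchange ::
  "('a, 'b) tword \<Rightarrow> ('a, 'b) tword \<Rightarrow> ('a, 'b) tword \<Rightarrow> ('a, 'b) tword \<Rightarrow>
   ('a, 'f, 'b, 'g) tterm" where
  "tinterchange P Q R S =
     TComp (TAss P R (WTen Q S))
      (TComp (TLeft P (TComp (TAssInv R Q S) (TComp (TRight (TSym Q R) S) (TAss Q R S))))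
        (TAssInv P Q (WTen R S)))"

text \<open>
  The generating relations, as an untyped relation on formal arrows. Only its instances between
  parallel well-formed formal arrows enter the congruence \<open>tcong\<close> below; this is what constrains
  the parameters of the rules to be objects, arrows and composable pairs as appropriate.
\<close>

inductive trel ::
  "('a, 'f) smcat \<Rightarrow> ('b, 'g) smcat \<Rightarrow>
   ('a, 'f, 'b, 'g) tterm \<Rightarrow> ('a, 'f, 'b, 'g) tterm \<Rightarrow> bool"
  for A :: "('a, 'f) smcat" and B :: "('b, 'g) smcat" where
  \<comment> \<open>category, bifunctor, symmetric monoidal structure\<close>
  Id_left: "trel A B (TComp (TId (tcod A B p)) p) p"
| Id_right: "trel A B (TComp p (TId (tdom A B p))) p"
| Comp_assoc: "trel A B (TComp (TComp p q) t) (TComp p (TComp q t))"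
| Left_Id: "trel A B (TLeft X (TId Y)) (TId (WTen X Y))"
| Right_Id: "trel A B (TRight (TId X) Y) (TId (WTen X Y))"
| Left_Comp: "trel A B (TLeft X (TComp p q)) (TComp (TLeft X p) (TLeft X q))"
| Right_Comp: "trel A B (TRight (TComp p q) X) (TComp (TRight p X) (TRight q X))"
| bifunctor: "trel A B
    (TComp (TRight p (tcod A B q)) (TLeft (tdom A B p) q))
    (TComp (TLeft (tcod A B p) q) (TRight p (tdom A B q)))"
| Ass_AssInv: "trel A B (TComp (TAss X Y Z) (TAssInv X Y Z)) (TId (WTen (WTen X Y) Z))"
| AssInv_Ass: "trel A B (TComp (TAssInv X Y Z) (TAss X Y Z)) (TId (WTen X (WTen Y Z)))"
| Rho_RhoInv: "trel A B (TComp (TRho X) (TRhoInv X)) (TId X)"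
| RhoInv_Rho: "trel A B (TComp (TRhoInv X) (TRho X)) (TId (WTen X WUnit))"
| Lam_LamInv: "trel A B (TComp (TLam X) (TLamInv X)) (TId X)"
| LamInv_Lam: "trel A B (TComp (TLamInv X) (TLam X)) (TId (WTen WUnit X))"
| Ass_natural: "trel A B
    (TComp (TAss (tcod A B p) (tcod A B q) (tcod A B t)) (tten A B p (tten A B q t)))
    (TComp (tten A B (tten A B p q) t) (TAss (tdom A B p) (tdom A B q) (tdom A B t)))"
| Rho_natural: "trel A B
    (TComp (TRho (tcod A B p)) (TRight p WUnit)) (TComp p (TRho (tdom A B p)))"
| Lam_natural: "trel A B
    (TComp (TLam (tcod A B p)) (TLeft WUnit p)) (TComp p (TLam (tdom A B p)))"
| Sym_natural: "trel A B
    (TComp (TSym (tcod A B p) (tcod A B q)) (tten A B p q))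
    (TComp (tten A B q p) (TSym (tdom A B p) (tdom A B q)))"
| pentagon: "trel A B
    (TComp (TAss (WTen X Y) Z W) (TAss X Y (WTen Z W)))
    (TComp (TRight (TAss X Y Z) W) (TComp (TAss X (WTen Y Z) W) (TLeft X (TAss Y Z W))))"
| triangle: "trel A B (TComp (TRight (TRho X) Y) (TAss X WUnit Y)) (TLeft X (TLam Y))"
| hexagon: "trel A B
    (TComp (TAss Z X Y) (TComp (TSym (WTen X Y) Z) (TAss X Y Z)))
    (TComp (TRight (TSym X Z) Y) (TComp (TAss X Z Y) (TLeft X (TSym Y Z))))"
| Sym_Sym: "trel A B (TComp (TSym Y X) (TSym X Y)) (TId (WTen X Y))"
| Lam_Sym: "trel A B (TComp (TLam X) (TSym X WUnit)) (TRho X)"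
  \<comment> \<open>\<open>a \<otimes> -\<close> is a symmetric monoidal functor\<close>
| ArrB_Id: "trel A B (TArrB a (Ide B b)) (TId (WGen a b))"
| ArrB_Comp: "trel A B (TArrB a (g' \<cdot>\<^bsub>B\<^esub> g)) (TComp (TArrB a g') (TArrB a g))"
| Delta_natural: "trel A B
    (TComp (TDelta a (Cod B g) (Cod B g')) (tten A B (TArrB a g) (TArrB a g')))
    (TComp (TArrB a (g \<boxtimes>\<^bsub>B\<^esub> g')) (TDelta a (Dom B g) (Dom B g')))"
| Delta_Ass: "trel A B
    (TComp (TDelta a (b \<otimes>\<^bsub>B\<^esub> b') b'')
      (TComp (TRight (TDelta a b b') (WGen a b'')) (TAss (WGen a b) (WGen a b') (WGen a b''))))
    (TComp (TArrB a (Ass B b b' b''))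
      (TComp (TDelta a b (b' \<otimes>\<^bsub>B\<^esub> b'')) (TLeft (WGen a b) (TDelta a b' b''))))"
| Delta_Rho: "trel A B
    (TComp (TArrB a (Rho B b)) (TComp (TDelta a b \<one>\<^bsub>B\<^esub>) (TLeft (WGen a b) (TBeta a))))
    (TRho (WGen a b))"
| Delta_Lam: "trel A B
    (TComp (TArrB a (Lam B b)) (TComp (TDelta a \<one>\<^bsub>B\<^esub> b) (TRight (TBeta a) (WGen a b))))
    (TLam (WGen a b))"
| Delta_Sym: "trel A B
    (TComp (TArrB a (Sym B b b')) (TDelta a b b'))
    (TComp (TDelta a b' b) (TSym (WGen a b) (WGen a b')))"
  \<comment> \<open>\<open>- \<otimes> b\<close> is a symmetric monoidal functor\<close>
| ArrA_Id: "trel A B (TArrA (Ide A a) b) (TId (WGen a b))"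
| ArrA_Comp: "trel A B (TArrA (f' \<cdot>\<^bsub>A\<^esub> f) b) (TComp (TArrA f' b) (TArrA f b))"
| Gamma_natural: "trel A B
    (TComp (TGamma (Cod A f) (Cod A f') b) (tten A B (TArrA f b) (TArrA f' b)))
    (TComp (TArrA (f \<boxtimes>\<^bsub>A\<^esub> f') b) (TGamma (Dom A f) (Dom A f') b))"
| Gamma_Ass: "trel A B
    (TComp (TGamma (a \<otimes>\<^bsub>A\<^esub> a') a'' b)
      (TComp (TRight (TGamma a a' b) (WGen a'' b)) (TAss (WGen a b) (WGen a' b) (WGen a'' b))))
    (TComp (TArrA (Ass A a a' a'') b)
      (TComp (TGamma a (a' \<otimes>\<^bsub>A\<^esub> a'') b) (TLeft (WGen a b) (TGamma a' a'' b))))"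
| Gamma_Rho: "trel A B
    (TComp (TArrA (Rho A a) b) (TComp (TGamma a \<one>\<^bsub>A\<^esub> b) (TLeft (WGen a b) (TAlpha b))))
    (TRho (WGen a b))"
| Gamma_Lam: "trel A B
    (TComp (TArrA (Lam A a) b) (TComp (TGamma \<one>\<^bsub>A\<^esub> a b) (TRight (TAlpha b) (WGen a b))))
    (TLam (WGen a b))"
| Gamma_Sym: "trel A B
    (TComp (TArrA (Sym A a a') b) (TGamma a a' b))
    (TComp (TGamma a' a b) (TSym (WGen a b) (WGen a' b)))"
  \<comment> \<open>\<open>f \<otimes> -\<close> and \<open>- \<otimes> g\<close> are monoidal natural transformations; naturality is the same
      equation for both\<close>
| ArrA_ArrB: "trel A B
    (TComp (TArrA f (Cod B g)) (TArrB (Dom A f) g))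
    (TComp (TArrB (Cod A f) g) (TArrA f (Dom B g)))"
| ArrA_Beta: "trel A B (TComp (TArrA f \<one>\<^bsub>B\<^esub>) (TBeta (Dom A f))) (TBeta (Cod A f))"
| ArrA_Delta: "trel A B
    (TComp (TArrA f (b \<otimes>\<^bsub>B\<^esub> b')) (TDelta (Dom A f) b b'))
    (TComp (TDelta (Cod A f) b b') (tten A B (TArrA f b) (TArrA f b')))"
| ArrB_Alpha: "trel A B (TComp (TArrB \<one>\<^bsub>A\<^esub> g) (TAlpha (Dom B g))) (TAlpha (Cod B g))"
| ArrB_Gamma: "trel A B
    (TComp (TArrB (a \<otimes>\<^bsub>A\<^esub> a') g) (TGamma a a' (Dom B g)))
    (TComp (TGamma a a' (Cod B g)) (tten A B (TArrB a g) (TArrB a' g)))"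
  \<comment> \<open>the families \<open>\<alpha>\<close> and \<open>\<gamma>\<close> (with \<open>a\<close>, \<open>a'\<close> fixed), and \<open>\<beta>\<close>, respect the monoidal structures;
      \<open>TRho WUnit\<close> is the canonical arrow \<open>I \<otimes> I \<rightarrow> I\<close>\<close>
| Alpha_Delta: "trel A B
    (TComp (TAlpha (b \<otimes>\<^bsub>B\<^esub> b')) (TRho WUnit))
    (TComp (TDelta \<one>\<^bsub>A\<^esub> b b') (tten A B (TAlpha b) (TAlpha b')))"
| Beta_Gamma: "trel A B
    (TComp (TBeta (a \<otimes>\<^bsub>A\<^esub> a')) (TRho WUnit))
    (TComp (TGamma a a' \<one>\<^bsub>B\<^esub>) (tten A B (TBeta a) (TBeta a')))"
| Beta_Alpha: "trel A B (TBeta \<one>\<^bsub>A\<^esub>) (TAlpha \<one>\<^bsub>B\<^esub>)"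
| Gamma_Delta: "trel A B
    (TComp (TGamma a a' (b \<otimes>\<^bsub>B\<^esub> b')) (tten A B (TDelta a b b') (TDelta a' b b')))
    (TComp (TDelta (a \<otimes>\<^bsub>A\<^esub> a') b b')
      (TComp (tten A B (TGamma a a' b) (TGamma a a' b'))
        (tinterchange (WGen a b) (WGen a b') (WGen a' b) (WGen a' b'))))"

inductive tcong ::
  "('a, 'f) smcat \<Rightarrow> ('b, 'g) smcat \<Rightarrow>
   ('a, 'f, 'b, 'g) tterm \<Rightarrow> ('a, 'f, 'b, 'g) tterm \<Rightarrow> bool"
  for A :: "('a, 'f) smcat" and B :: "('b, 'g) smcat" where
  rel: "trel A B t u \<Longrightarrow> term_over A B t \<Longrightarrow> term_over A B u \<Longrightarrow>
    tdom A B t = tdom A B u \<Longrightarrow> tcod A B t = tcod A B u \<Longrightarrow> tcong A B t u"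
| refl: "term_over A B t \<Longrightarrow> tcong A B t t"
| sym: "tcong A B t u \<Longrightarrow> tcong A B u t"
| trans: "tcong A B t u \<Longrightarrow> tcong A B u v \<Longrightarrow> tcong A B t v"
| Comp: "tcong A B t t' \<Longrightarrow> tcong A B u u' \<Longrightarrow> tdom A B t = tcod A B u \<Longrightarrow>
    tcong A B (TComp t u) (TComp t' u')"
| Left: "word_over A B X \<Longrightarrow> tcong A B t t' \<Longrightarrow> tcong A B (TLeft X t) (TLeft X t')"
| Right: "tcong A B t t' \<Longrightarrow> word_over A B X \<Longrightarrow> tcong A B (TRight t X) (TRight t' X)"

definition tclass ::
  "('a, 'f) smcat \<Rightarrow> ('b, 'g) smcat \<Rightarrow> ('a, 'f, 'b, 'g) tterm \<Rightarrow> ('a, 'f, 'b, 'g) tterm set" where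
  "tclass A B t = {u. tcong A B t u}"

definition rep :: "('a, 'f, 'b, 'g) tterm set \<Rightarrow> ('a, 'f, 'b, 'g) tterm" where
  "rep c = (SOME t. t \<in> c)"

definition tensor ::
  "('a, 'f) smcat \<Rightarrow> ('b, 'g) smcat \<Rightarrow> (('a, 'b) tword, ('a, 'f, 'b, 'g) tterm set) smcat"
  (infixl "\<Otimes>" 70) where
  "A \<Otimes> B = \<lparr>
     Ob = {X. word_over A B X},
     Ar = tclass A B ` {t. term_over A B t},
     Dom = (\<lambda>c. tdom A B (rep c)),
     Cod = (\<lambda>c. tcod A B (rep c)),
     Ide = (\<lambda>X. tclass A B (TId X)),
     Cmp = (\<lambda>c d. tclass A B (TComp (rep c) (rep d))),
     Ten = WTen,
     TenA = (\<lambda>c d. tclass A B (tten A B (rep c) (rep d))),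
     Unit = WUnit,
     Ass = (\<lambda>X Y Z. tclass A B (TAss X Y Z)),
     Rho = (\<lambda>X. tclass A B (TRho X)),
     Lam = (\<lambda>X. tclass A B (TLam X)),
     Sym = (\<lambda>X Y. tclass A B (TSym X Y))\<rparr>"

text \<open>The functor \<open>\<eta> : A \<rightarrow> [B, A \<Otimes> B]\<close>, with the functors \<open>\<eta>(a)\<close> as its values.\<close>

definition eta_ob ::
  "('a, 'f) smcat \<Rightarrow> ('b, 'g) smcat \<Rightarrow> 'a \<Rightarrow>
   ('b, 'g, ('a, 'b) tword, ('a, 'f, 'b, 'g) tterm set) smfun" where
  "eta_ob A B a = \<lparr>Src = B, Tgt = A \<Otimes> B,
     onO = (\<lambda>b\<in>Ob B. WGen a b),
     onA = (\<lambda>g\<in>Ar B. tclass A B (TArrB a g)),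
     lax0 = tclass A B (TBeta a),
     lax2 = (\<lambda>b\<in>Ob B. \<lambda>b'\<in>Ob B. tclass A B (TDelta a b b'))\<rparr>"

definition eta ::
  "('a, 'f) smcat \<Rightarrow> ('b, 'g) smcat \<Rightarrow>
   ('a, 'f, ('b, 'g, ('a, 'b) tword, ('a, 'f, 'b, 'g) tterm set) smfun,
            ('b, 'g, ('a, 'b) tword, ('a, 'f, 'b, 'g) tterm set) mtrans) smfun" where
  "eta A B = \<lparr>Src = A, Tgt = ihom B (A \<Otimes> B),
     onO = (\<lambda>a\<in>Ob A. eta_ob A B a),
     onA = (\<lambda>f\<in>Ar A. \<lparr>NDom = eta_ob A B (Dom A f), NCod = eta_ob A B (Cod A f),
       at = (\<lambda>b\<in>Ob B. tclass A B (TArrA f b))\<rparr>),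
     lax0 = \<lparr>NDom = const_smf B (A \<Otimes> B), NCod = eta_ob A B \<one>\<^bsub>A\<^esub>,
       at = (\<lambda>b\<in>Ob B. tclass A B (TAlpha b))\<rparr>,
     lax2 = (\<lambda>a\<in>Ob A. \<lambda>a'\<in>Ob A.
       \<lparr>NDom = box_smf B (A \<Otimes> B) (eta_ob A B a) (eta_ob A B a'), NCod = eta_ob A B (a \<otimes>\<^bsub>A\<^esub> a'),
        at = (\<lambda>b\<in>Ob B. tclass A B (TGamma a a' b))\<rparr>)\<rparr>"

section \<open>The functors En and Rn\<close>

primrec En_word ::
  "('q, 'k) smcat \<Rightarrow> ('a, 'f, ('b, 'g, 'q, 'k) smfun, ('b, 'g, 'q, 'k) mtrans) smfun \<Rightarrow>
   ('a, 'b) tword \<Rightarrow> 'q" where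
  "En_word C F WUnit = \<one>\<^bsub>C\<^esub>"
| "En_word C F (WGen a b) = onO (onO F a) b"
| "En_word C F (WTen X Y) = En_word C F X \<otimes>\<^bsub>C\<^esub> En_word C F Y"

primrec En_term ::
  "('q, 'k) smcat \<Rightarrow> ('a, 'f, ('b, 'g, 'q, 'k) smfun, ('b, 'g, 'q, 'k) mtrans) smfun \<Rightarrow>
   ('a, 'f, 'b, 'g) tterm \<Rightarrow> 'k" where
  "En_term C F (TId X) = Ide C (En_word C F X)"
| "En_term C F (TComp t u) = En_term C F t \<cdot>\<^bsub>C\<^esub> En_term C F u"
| "En_term C F (TLeft X t) = Ide C (En_word C F X) \<boxtimes>\<^bsub>C\<^esub> En_term C F t"
| "En_term C F (TRight t X) = En_term C F t \<boxtimes>\<^bsub>C\<^esub> Ide C (En_word C F X)"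
| "En_term C F (TAss X Y Z) = Ass C (En_word C F X) (En_word C F Y) (En_word C F Z)"
| "En_term C F (TAssInv X Y Z) =
     inv_arrow C (Ass C (En_word C F X) (En_word C F Y) (En_word C F Z))"
| "En_term C F (TRho X) = Rho C (En_word C F X)"
| "En_term C F (TRhoInv X) = inv_arrow C (Rho C (En_word C F X))"
| "En_term C F (TLam X) = Lam C (En_word C F X)"
| "En_term C F (TLamInv X) = inv_arrow C (Lam C (En_word C F X))"
| "En_term C F (TSym X Y) = Sym C (En_word C F X) (En_word C F Y)"
| "En_term C F (TAlpha b) = at (lax0 F) b"
| "En_term C F (TBeta a) = lax0 (onO F a)"
| "En_term C F (TGamma a a' b) = at (lax2 F a a') b"
| "En_term C F (TDelta a b b') = lax2 (onO F a) b b'"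
| "En_term C F (TArrA f b) = at (onA F f) b"
| "En_term C F (TArrB a g) = onA (onO F a) g"

text \<open>For \<open>F : A \<rightarrow> [B, C]\<close>; the value on a class of formal arrows is computed on a representative.\<close>

definition En ::
  "('a, 'f) smcat \<Rightarrow> ('b, 'g) smcat \<Rightarrow> ('q, 'k) smcat \<Rightarrow>
   ('a, 'f, ('b, 'g, 'q, 'k) smfun, ('b, 'g, 'q, 'k) mtrans) smfun \<Rightarrow>
   (('a, 'b) tword, ('a, 'f, 'b, 'g) tterm set, 'q, 'k) smfun" where
  "En A B C F = strict_smf (A \<Otimes> B) C (En_word C F) (\<lambda>c. En_term C F (rep c))"

definition Rn ::
  "('a, 'f) smcat \<Rightarrow> ('b, 'g) smcat \<Rightarrow> ('q, 'k) smcat \<Rightarrow>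
   ((('a, 'b) tword, ('a, 'f, 'b, 'g) tterm set, 'q, 'k) smfun,
    (('a, 'b) tword, ('a, 'f, 'b, 'g) tterm set, 'q, 'k) mtrans,
    ('a, 'f, ('b, 'g, 'q, 'k) smfun, ('b, 'g, 'q, 'k) mtrans) smfun,
    ('a, 'f, ('b, 'g, 'q, 'k) smfun, ('b, 'g, 'q, 'k) mtrans) mtrans) smfun" where
  "Rn A B C = strict_smf (ihom (A \<Otimes> B) C) (ihom A (ihom B C))
     (\<lambda>F. ihom_post B F \<circ>\<^sub>1 eta A B)
     (\<lambda>\<sigma>. whisker_right (ihom_post_trans B \<sigma>) (eta A B))"

section \<open>Tensor on 1-cells and canonical arrows\<close>

text \<open>\<open>tensor_right F B\<close> is \<open>F \<otimes> 1\<^sub>B\<close> and \<open>tensor_left A G\<close> is \<open>1\<^sub>A \<otimes> G\<close>.\<close>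

definition tensor_right ::
  "('a, 'f, 'q, 'k) smfun \<Rightarrow> ('b, 'g) smcat \<Rightarrow>
   (('a, 'b) tword, ('a, 'f, 'b, 'g) tterm set, ('q, 'b) tword, ('q, 'k, 'b, 'g) tterm set) smfun"
  where
  "tensor_right F B = En (Src F) B (Tgt F \<Otimes> B) (eta (Tgt F) B \<circ>\<^sub>1 F)"

definition tensor_left ::
  "('a, 'f) smcat \<Rightarrow> ('b, 'g, 'q, 'k) smfun \<Rightarrow>
   (('a, 'b) tword, ('a, 'f, 'b, 'g) tterm set, ('a, 'q) tword, ('a, 'f, 'q, 'k) tterm set) smfun"
  where
  "tensor_left A G = En A (Src G) (A \<Otimes> Tgt G) (ihom_pre G (A \<Otimes> Tgt G) \<circ>\<^sub>1 eta A (Tgt G))"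

definition S_can ::
  "('a, 'f) smcat \<Rightarrow> ('b, 'g) smcat \<Rightarrow>
   (('a, 'b) tword, ('a, 'f, 'b, 'g) tterm set, ('b, 'a) tword, ('b, 'g, 'a, 'f) tterm set) smfun"
  where
  "S_can A B = En A B (B \<Otimes> A) (dual B A (B \<Otimes> A) (eta B A))"

definition A'_can where
  "A'_can A B C =
    (let D = A \<Otimes> (B \<Otimes> C)
     in En (A \<Otimes> B) C D (En A B (ihom C D) (Rn B C D \<circ>\<^sub>1 eta A (B \<Otimes> C))))"

end

theory Submission
  imports Defs
begin

text \<open>
  A strict functor out of \<open>A \<Otimes> B\<close> is determined by its curried form \<open>A \<rightarrow> [B, C]\<close>, hence by its values
  on the generators. Currying twice, two strict functors out of \<open>(A \<Otimes> B) \<Otimes> C\<close> agree as soon as both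
  send \<open>\<alpha>\<close> and \<open>\<gamma>\<close> of the outer tensor product to identities and they agree on the generators
  \<open>(a \<otimes> b) \<otimes> c\<close>, on the arrows of \<open>C\<close> and the structure arrows at objects \<open>a \<otimes> b\<close>, and on \<open>u \<otimes> c\<close> for
  \<open>u\<close> a generating arrow of \<open>A \<Otimes> B\<close>. Both composites exchange the roles of the generators in the same
  way, sending \<open>(a \<otimes> b) \<otimes> c\<close> to \<open>b \<otimes> (a \<otimes> c)\<close>. The substance is that all the constructions live in
  SMC; that \<open>[A, B]\<close> is symmetric monoidal is a coherence statement about the middle four interchange.
\<close>

section \<open>Elementary facts about symmetric monoidal categories\<close>

text \<open>Currying a strict functor gives in general only a lax one: its unit and product
  constraints are the values at \<alpha> and \<gamma>. The first condition on both composites makes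
  these identities, so that the curried functor out of \<open>A \<Otimes> B\<close> is strict and
  can in its turn be recovered from generators. Evaluation is simple for a related reason:
  \<open>En\<close> always yields strict functors, so every factor of both composites is strict and
  commutes with words and formal arrows on the nose. Equations between 2-cells of the hom are
  checked at each object. Coherence enters where functors and families must be shown to be monoidal,
  since the product of two functors has the interchange in its constraint. No general coherence
  theorem is invoked: diagrams of interchanges are reduced to right-nested products, where only
  associators and swaps of neighbours remain, and the unit conditions are derived from
  \<open>triangle\<close> and \<open>pentagon\<close>.\<close>

context symmetric_monoidal_category
begin

lemma arrows_iff: "f \<in> arrows A x y \<longleftrightarrow> f \<in> Ar A \<and> Dom A f = x \<and> Cod A f = y"
  by (auto simp: arrows_def)

lemma isos_arrows: "f \<in> isos A x y \<Longrightarrow> f \<in> arrows A x y"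
  by (simp add: isos_def)

lemma typing [simp]:
  "f \<in> Ar A \<Longrightarrow> Dom A f \<in> Ob A" "f \<in> Ar A \<Longrightarrow> Cod A f \<in> Ob A" "\<one> \<in> Ob A"
  "x \<in> Ob A \<Longrightarrow> y \<in> Ob A \<Longrightarrow> x \<otimes> y \<in> Ob A"
  "x \<in> Ob A \<Longrightarrow> Ide A x \<in> Ar A" "x \<in> Ob A \<Longrightarrow> Dom A (Ide A x) = x" "x \<in> Ob A \<Longrightarrow> Cod A (Ide A x) = x"
  using Ide_closed[of x] by (auto simp: Dom_closed Cod_closed Unit_closed Ten_closed arrows_iff)

lemma Cmp_typing [simp]:
  assumes "g \<in> Ar A" "f \<in> Ar A" "Dom A g = Cod A f"
  shows "g \<cdot> f \<in> Ar A" "Dom A (g \<cdot> f) = Dom A f" "Cod A (g \<cdot> f) = Cod A g"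
  using Cmp_closed[of g "Dom A g" "Cod A g" f "Dom A f"] assms by (auto simp: arrows_iff)

lemma TenA_typing [simp]:
  assumes "g \<in> Ar A" "f \<in> Ar A"
  shows "g \<boxtimes> f \<in> Ar A" "Dom A (g \<boxtimes> f) = Dom A g \<otimes> Dom A f" "Cod A (g \<boxtimes> f) = Cod A g \<otimes> Cod A f"
  using TenA_closed[of g "Dom A g" "Cod A g" f "Dom A f"] assms by (auto simp: arrows_iff)

lemma Ide_cancel [simp]:
  "f \<in> Ar A \<Longrightarrow> Cod A f = y \<Longrightarrow> Ide A y \<cdot> f = f"
  "f \<in> Ar A \<Longrightarrow> Dom A f = y \<Longrightarrow> f \<cdot> Ide A y = f"
  "x \<in> Ob A \<Longrightarrow> y \<in> Ob A \<Longrightarrow> Ide A x \<boxtimes> Ide A y = Ide A (x \<otimes> y)"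
  by (auto simp: arrows_iff TenA_Ide intro: Ide_left Ide_right)

lemma assoc:
  "h \<in> Ar A \<Longrightarrow> g \<in> Ar A \<Longrightarrow> f \<in> Ar A \<Longrightarrow> Dom A h = Cod A g \<Longrightarrow> Dom A g = Cod A f \<Longrightarrow>
    (h \<cdot> g) \<cdot> f = h \<cdot> (g \<cdot> f)"
  using Cmp_assoc[of h "Dom A h" "Cod A h" g "Dom A g" f "Dom A f"] by (auto simp: arrows_iff)

lemma TenA_merge:
  "f' \<in> Ar A \<Longrightarrow> f \<in> Ar A \<Longrightarrow> g' \<in> Ar A \<Longrightarrow> g \<in> Ar A \<Longrightarrow> Dom A f' = Cod A f \<Longrightarrow> Dom A g' = Cod A g \<Longrightarrow>
    (f' \<boxtimes> g') \<cdot> (f \<boxtimes> g) = (f' \<cdot> f) \<boxtimes> (g' \<cdot> g)"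
  using TenA_Cmp[of f' "Dom A f'" "Cod A f'" f "Dom A f" g' "Dom A g'" "Cod A g'" g "Dom A g"]
  by (auto simp: arrows_iff)

lemma TenA_merge_assoc:
  "f' \<in> Ar A \<Longrightarrow> f \<in> Ar A \<Longrightarrow> g' \<in> Ar A \<Longrightarrow> g \<in> Ar A \<Longrightarrow> Dom A f' = Cod A f \<Longrightarrow> Dom A g' = Cod A g \<Longrightarrow>
    h \<in> Ar A \<Longrightarrow> Cod A h = Dom A f \<otimes> Dom A g \<Longrightarrow>
    (f' \<boxtimes> g') \<cdot> ((f \<boxtimes> g) \<cdot> h) = ((f' \<cdot> f) \<boxtimes> (g' \<cdot> g)) \<cdot> h"
  by (simp add: TenA_merge flip: assoc)

lemma Ide_TenA_Cmp:
  "g \<in> Ar A \<Longrightarrow> f \<in> Ar A \<Longrightarrow> Dom A g = Cod A f \<Longrightarrow> x \<in> Ob A \<Longrightarrow>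
    Ide A x \<boxtimes> (g \<cdot> f) = (Ide A x \<boxtimes> g) \<cdot> (Ide A x \<boxtimes> f)"
  "g \<in> Ar A \<Longrightarrow> f \<in> Ar A \<Longrightarrow> Dom A g = Cod A f \<Longrightarrow> x \<in> Ob A \<Longrightarrow>
    (g \<cdot> f) \<boxtimes> Ide A x = (g \<boxtimes> Ide A x) \<cdot> (f \<boxtimes> Ide A x)"
  by (simp_all add: TenA_merge)

text \<open>Composites are kept right-nested by \<open>assoc\<close>, so an equation about a
  two-fold composite no longer matches inside a longer chain. Used as
  \<open>eq[THEN Cmp_reduce]\<close>, this gives the version of \<open>eq\<close> with a
  tail.\<close>

lemma Cmp_reduce:
  "f \<cdot> g = h \<Longrightarrow> f \<in> Ar A \<Longrightarrow> g \<in> Ar A \<Longrightarrow> Dom A f = Cod A g \<Longrightarrow> k \<in> Ar A \<Longrightarrow> Cod A k = Dom A g \<Longrightarrow>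
    f \<cdot> (g \<cdot> k) = h \<cdot> k"
  by (simp flip: assoc)

lemma inverse_arrowsD:
  assumes "inverse_arrows A f g"
  shows "f \<in> Ar A" "g \<in> Ar A" "Dom A g = Cod A f" "Cod A g = Dom A f"
    "g \<cdot> f = Ide A (Dom A f)" "f \<cdot> g = Ide A (Cod A f)"
  using assms unfolding inverse_arrows_def arrows_def by blast+

lemma inverse_arrows_unique:
  assumes "inverse_arrows A f g" "inverse_arrows A f h"
  shows "g = h"
proof -
  have *: "f \<in> Ar A" "g \<in> Ar A" "h \<in> Ar A" "Dom A g = Cod A f" "Cod A g = Dom A f"
    "Dom A h = Cod A f" "Cod A h = Dom A f" "g \<cdot> f = Ide A (Dom A f)" "f \<cdot> h = Ide A (Cod A f)"
    using inverse_arrowsD[OF assms(1)] inverse_arrowsD[OF assms(2)] by auto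
  have "g = g \<cdot> (f \<cdot> h)" using * by simp
  also have "\<dots> = (g \<cdot> f) \<cdot> h" using *(1-7) by (simp add: assoc)
  finally show ?thesis using * by simp
qed

lemma inv_arrow_eqI: "inverse_arrows A f g \<Longrightarrow> inv_arrow A f = g"
  unfolding inv_arrow_def by (blast intro: inverse_arrows_unique)

lemma inverse_arrowsI:
  "f \<in> Ar A \<Longrightarrow> g \<in> Ar A \<Longrightarrow> Dom A g = Cod A f \<Longrightarrow> Cod A g = Dom A f \<Longrightarrow>
    g \<cdot> f = Ide A (Dom A f) \<Longrightarrow> f \<cdot> g = Ide A (Cod A f) \<Longrightarrow> inverse_arrows A f g"
  by (simp add: inverse_arrows_def arrows_iff)

lemma inverse_inv_arrow:
  assumes "f \<in> isos A x y" shows "inverse_arrows A f (inv_arrow A f)"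
proof -
  obtain g where "inverse_arrows A f g" using assms by (auto simp: isos_def)
  then show ?thesis using inv_arrow_eqI by metis
qed

lemma inv_arrow_facts:
  assumes "f \<in> isos A x y"
  shows "f \<in> Ar A" "Dom A f = x" "Cod A f = y"
    "inv_arrow A f \<in> Ar A" "Dom A (inv_arrow A f) = y" "Cod A (inv_arrow A f) = x"
    "inv_arrow A f \<cdot> f = Ide A x" "f \<cdot> inv_arrow A f = Ide A y"
  using inverse_arrowsD[OF inverse_inv_arrow[OF assms]] isos_arrows[OF assms]
  by (simp_all add: arrows_iff)

lemma inv_cancel_left:
  assumes "f \<in> isos A x y" "k \<in> Ar A"
  shows "Cod A k = x \<Longrightarrow> inv_arrow A f \<cdot> (f \<cdot> k) = k" "Cod A k = y \<Longrightarrow> f \<cdot> (inv_arrow A f \<cdot> k) = k"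
  using inv_arrow_facts[OF assms(1)] assms(2) by (simp_all flip: assoc)

lemma isosI: "inverse_arrows A f g \<Longrightarrow> Dom A f = x \<Longrightarrow> Cod A f = y \<Longrightarrow> f \<in> isos A x y"
  using inverse_arrowsD[of f g] by (auto simp: isos_def arrows_iff)

lemma iso_cancel_left:
  assumes "f \<in> isos A x y" "g \<in> Ar A" "h \<in> Ar A" "Cod A g = x" "Cod A h = x" "f \<cdot> g = f \<cdot> h"
  shows "g = h"
  using inv_cancel_left[OF assms(1)] assms by metis

lemma iso_cancel_right:
  assumes f: "f \<in> isos A x y" and gh: "g \<in> Ar A" "h \<in> Ar A" "Dom A g = y" "Dom A h = y"
    and eq: "g \<cdot> f = h \<cdot> f"
  shows "g = h"
proof -
  have "(g \<cdot> f) \<cdot> inv_arrow A f = (h \<cdot> f) \<cdot> inv_arrow A f" by (simp add: eq)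
  then show ?thesis using inv_arrow_facts[OF f] gh by (simp add: assoc)
qed

lemma Cmp_iso:
  assumes g: "g \<in> isos A y z" and f: "f \<in> isos A x y"
  shows "g \<cdot> f \<in> isos A x z"
proof (rule isosI[of _ "inv_arrow A f \<cdot> inv_arrow A g"])
  show "inverse_arrows A (g \<cdot> f) (inv_arrow A f \<cdot> inv_arrow A g)"
    using inv_arrow_facts[OF g] inv_arrow_facts[OF f] inv_cancel_left[OF g] inv_cancel_left[OF f]
    by (intro inverse_arrowsI) (simp_all add: assoc)
qed (use inv_arrow_facts[OF g] inv_arrow_facts[OF f] in simp_all)

lemma TenA_inverse:
  assumes f: "f \<in> isos A x y" and g: "g \<in> isos A z w"
  shows "inverse_arrows A (f \<boxtimes> g) (inv_arrow A f \<boxtimes> inv_arrow A g)"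
    using inv_arrow_facts[OF g] inv_arrow_facts[OF f] typing(1,2)[of f] typing(1,2)[of g]
    by (intro inverse_arrowsI) (simp_all add: TenA_merge)

lemma TenA_iso:
  "f \<in> isos A x y \<Longrightarrow> g \<in> isos A z w \<Longrightarrow> f \<boxtimes> g \<in> isos A (x \<otimes> z) (y \<otimes> w)"
  by (rule isosI[OF TenA_inverse]) (auto simp: inv_arrow_facts)

lemma Ide_iso [simp]: "x \<in> Ob A \<Longrightarrow> Ide A x \<in> isos A x x"
  by (rule isosI[of _ "Ide A x"]) (simp_all add: inverse_arrowsI)

lemma structure_isos [simp]:
  "x \<in> Ob A \<Longrightarrow> y \<in> Ob A \<Longrightarrow> z \<in> Ob A \<Longrightarrow> Ass A x y z \<in> isos A (x \<otimes> (y \<otimes> z)) ((x \<otimes> y) \<otimes> z)"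
  "x \<in> Ob A \<Longrightarrow> Rho A x \<in> isos A (x \<otimes> \<one>) x"
  "x \<in> Ob A \<Longrightarrow> Lam A x \<in> isos A (\<one> \<otimes> x) x"
  "x \<in> Ob A \<Longrightarrow> y \<in> Ob A \<Longrightarrow> Sym A x y \<in> isos A (x \<otimes> y) (y \<otimes> x)"
  by (simp_all add: Ass_iso Rho_iso Lam_iso Sym_iso)

lemmas structure_facts [simp] =
  inv_arrow_facts[OF structure_isos(1)] inv_arrow_facts[OF structure_isos(2)]
  inv_arrow_facts[OF structure_isos(3)] inv_arrow_facts(1-3)[OF structure_isos(4)]

lemmas structure_cancel [simp] =
  inv_cancel_left[OF structure_isos(1)] inv_cancel_left[OF structure_isos(2)]
  inv_cancel_left[OF structure_isos(3)]

lemma Sym_cancel [simp]: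
  "x \<in> Ob A \<Longrightarrow> y \<in> Ob A \<Longrightarrow> Sym A y x \<cdot> Sym A x y = Ide A (x \<otimes> y)"
  "x \<in> Ob A \<Longrightarrow> y \<in> Ob A \<Longrightarrow> k \<in> Ar A \<Longrightarrow> Cod A k = x \<otimes> y \<Longrightarrow> Sym A y x \<cdot> (Sym A x y \<cdot> k) = k"
  by (simp_all add: Sym_Sym flip: assoc)

text \<open>The codomains are variables tied by equations, so that the rules also match where a
  codomain appears in simplified form, for instance as a product.\<close>

lemma natural:
  "f \<in> Ar A \<Longrightarrow> g \<in> Ar A \<Longrightarrow> h \<in> Ar A \<Longrightarrow> Cod A f = x \<Longrightarrow> Cod A g = y \<Longrightarrow> Cod A h = z \<Longrightarrow>
     Ass A x y z \<cdot> (f \<boxtimes> (g \<boxtimes> h)) = ((f \<boxtimes> g) \<boxtimes> h) \<cdot> Ass A (Dom A f) (Dom A g) (Dom A h)"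
  "f \<in> Ar A \<Longrightarrow> Cod A f = x \<Longrightarrow> Rho A x \<cdot> (f \<boxtimes> Ide A \<one>) = f \<cdot> Rho A (Dom A f)"
  "f \<in> Ar A \<Longrightarrow> Cod A f = x \<Longrightarrow> Lam A x \<cdot> (Ide A \<one> \<boxtimes> f) = f \<cdot> Lam A (Dom A f)"
  "f \<in> Ar A \<Longrightarrow> g \<in> Ar A \<Longrightarrow> Cod A f = x \<Longrightarrow> Cod A g = y \<Longrightarrow>
     Sym A x y \<cdot> (f \<boxtimes> g) = (g \<boxtimes> f) \<cdot> Sym A (Dom A f) (Dom A g)"
  using Ass_natural[of f "Dom A f" x g "Dom A g" y h "Dom A h" z] Rho_natural[of f "Dom A f" x]
    Lam_natural[of f "Dom A f" x] Sym_natural[of f "Dom A f" x g "Dom A g" y]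
  by (auto simp: arrows_iff)

lemma Ass_inv_natural:
  assumes "f \<in> Ar A" "g \<in> Ar A" "h \<in> Ar A" "Cod A f = x" "Cod A g = y" "Cod A h = z"
  shows "inv_arrow A (Ass A x y z) \<cdot> ((f \<boxtimes> g) \<boxtimes> h) =
     (f \<boxtimes> (g \<boxtimes> h)) \<cdot> inv_arrow A (Ass A (Dom A f) (Dom A g) (Dom A h))"
proof -
  have xyz: "x \<in> Ob A" "y \<in> Ob A" "z \<in> Ob A" using assms by auto
  have "inv_arrow A (Ass A x y z) \<cdot> (((f \<boxtimes> g) \<boxtimes> h) \<cdot> Ass A (Dom A f) (Dom A g) (Dom A h)) \<cdot>
      inv_arrow A (Ass A (Dom A f) (Dom A g) (Dom A h)) =
     (f \<boxtimes> (g \<boxtimes> h)) \<cdot> inv_arrow A (Ass A (Dom A f) (Dom A g) (Dom A h))"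
    using assms xyz by (subst natural(1)[of f g h x y z, symmetric]) (simp_all add: assoc)
  then show ?thesis using assms xyz by (simp add: assoc)
qed

lemma pentagon':
  "x \<in> Ob A \<Longrightarrow> y \<in> Ob A \<Longrightarrow> z \<in> Ob A \<Longrightarrow> w \<in> Ob A \<Longrightarrow>
     Ass A (x \<otimes> y) z w \<cdot> Ass A x y (z \<otimes> w) =
     (Ass A x y z \<boxtimes> Ide A w) \<cdot> (Ass A x (y \<otimes> z) w \<cdot> (Ide A x \<boxtimes> Ass A y z w))"
  by (simp add: pentagon assoc)

text \<open>The unitors are natural isomorphisms from tensoring with the unit to the identity
  functor, hence tensoring with the unit is faithful. The derived unit conditions below are tested
  after such a tensoring.\<close>

lemma Unit_TenA_cancel:
  assumes "f \<in> Ar A" "g \<in> Ar A" "Dom A f = Dom A g" "Cod A f = Cod A g"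
  shows "Ide A \<one> \<boxtimes> f = Ide A \<one> \<boxtimes> g \<Longrightarrow> f = g" "f \<boxtimes> Ide A \<one> = g \<boxtimes> Ide A \<one> \<Longrightarrow> f = g"
proof -
  assume "Ide A \<one> \<boxtimes> f = Ide A \<one> \<boxtimes> g"
  then have "f \<cdot> Lam A (Dom A f) = g \<cdot> Lam A (Dom A f)"
    using assms natural(3)[of f] natural(3)[of g] by simp
  then show "f = g" using iso_cancel_right[OF structure_isos(3)[of "Dom A f"]] assms by simp
next
  assume "f \<boxtimes> Ide A \<one> = g \<boxtimes> Ide A \<one>"
  then have "f \<cdot> Rho A (Dom A f) = g \<cdot> Rho A (Dom A f)"
    using assms natural(2)[of f] natural(2)[of g] by simp
  then show "f = g" using iso_cancel_right[OF structure_isos(2)[of "Dom A f"]] assms by simp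
qed

text \<open>Kelly's argument: after tensoring with the unit, the pentagon at \<one>, \<one>,
  \<open>x\<close>, \<open>y\<close> together with two instances of the triangle gives the equation
  up to an invertible associator.\<close>

lemma Lam_Ten:
  assumes [simp]: "x \<in> Ob A" "y \<in> Ob A"
  shows "(Lam A x \<boxtimes> Ide A y) \<cdot> Ass A \<one> x y = Lam A (x \<otimes> y)"
proof (rule Unit_TenA_cancel(1))
  have tri: "(Rho A \<one> \<boxtimes> Ide A z) \<cdot> Ass A \<one> \<one> z = Ide A \<one> \<boxtimes> Lam A z" if "z \<in> Ob A" for z
    using triangle[of \<one> z] that by simp
  have "Ass A \<one> x y \<cdot> (Ide A \<one> \<boxtimes> Lam A (x \<otimes> y)) =
      Ass A \<one> x y \<cdot> ((Rho A \<one> \<boxtimes> Ide A (x \<otimes> y)) \<cdot> Ass A \<one> \<one> (x \<otimes> y))"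
    by (simp add: tri)
  \<comment> \<open>The identity of \<open>x \<otimes> y\<close> is split so that naturality of the
    associator matches; \<open>Ide_cancel(3)\<close> is switched off in the next step to keep it
    split. The same device recurs below.\<close>
  also have "\<dots> = Ass A \<one> x y \<cdot> ((Rho A \<one> \<boxtimes> (Ide A x \<boxtimes> Ide A y)) \<cdot> Ass A \<one> \<one> (x \<otimes> y))"
    by simp
  also have "\<dots> = ((Rho A \<one> \<boxtimes> Ide A x) \<boxtimes> Ide A y) \<cdot> (Ass A (\<one> \<otimes> \<one>) x y \<cdot> Ass A \<one> \<one> (x \<otimes> y))"
    by (simp add: natural(1)[THEN Cmp_reduce] assoc del: Ide_cancel(3))
  also have "\<dots> = (((Rho A \<one> \<boxtimes> Ide A x) \<cdot> Ass A \<one> \<one> x) \<boxtimes> Ide A y) \<cdot>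
      (Ass A \<one> (\<one> \<otimes> x) y \<cdot> (Ide A \<one> \<boxtimes> Ass A \<one> x y))"
    by (simp add: pentagon' TenA_merge_assoc)
  also have "\<dots> = Ass A \<one> x y \<cdot> (Ide A \<one> \<boxtimes> ((Lam A x \<boxtimes> Ide A y) \<cdot> Ass A \<one> x y))"
    by (simp add: tri natural(1)[THEN Cmp_reduce] assoc Ide_TenA_Cmp)
  finally show "Ide A \<one> \<boxtimes> ((Lam A x \<boxtimes> Ide A y) \<cdot> Ass A \<one> x y) = Ide A \<one> \<boxtimes> Lam A (x \<otimes> y)"
    using iso_cancel_left[OF structure_isos(1)[of "\<one>" x y]] by simp
qed simp_all

text \<open>Naturality of \<open>Lam\<close> at its own component identifies
  \<open>Ide A \<one> \<boxtimes> Lam A \<one>\<close> with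
  \<open>Lam A (\<one> \<otimes> \<one>)\<close>. Then \<open>triangle\<close> and
  \<open>Lam_Ten\<close> express the same arrow with \<open>Rho A \<one>\<close> and with
  \<open>Lam A \<one>\<close>.\<close>

lemma Rho_Unit: "Rho A \<one> = Lam A \<one>"
proof (rule Unit_TenA_cancel(2))
  have "Lam A \<one> \<cdot> (Ide A \<one> \<boxtimes> Lam A \<one>) = Lam A \<one> \<cdot> Lam A (\<one> \<otimes> \<one>)"
    by (simp add: natural(3))
  then have "Ide A \<one> \<boxtimes> Lam A \<one> = Lam A (\<one> \<otimes> \<one>)"
    using iso_cancel_left[OF structure_isos(3)[of "\<one>"]] by simp
  then have "(Rho A \<one> \<boxtimes> Ide A \<one>) \<cdot> Ass A \<one> \<one> \<one> = (Lam A \<one> \<boxtimes> Ide A \<one>) \<cdot> Ass A \<one> \<one> \<one>"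
    by (simp add: Lam_Ten triangle)
  then show "Rho A \<one> \<boxtimes> Ide A \<one> = Lam A \<one> \<boxtimes> Ide A \<one>"
    using iso_cancel_right[OF structure_isos(1)[of "\<one>" "\<one>" "\<one>"]] by simp
qed simp_all

lemma Sym_Unit: "Sym A \<one> \<one> = Ide A (\<one> \<otimes> \<one>)"
proof -
  have "Lam A \<one> \<cdot> Sym A \<one> \<one> = Lam A \<one> \<cdot> Ide A (\<one> \<otimes> \<one>)"
    using Lam_Sym[of \<one>] by (simp add: Rho_Unit)
  then show ?thesis using iso_cancel_left[OF structure_isos(3)[of "\<one>"]] by simp
qed

text \<open>The mirror image of \<open>Lam_Ten\<close>, from the pentagon at \<open>x\<close>,
  \<open>y\<close>, \<one>, \<one>; the arrow \<open>?k\<close> is the invertible tail of that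
  pentagon and is cancelled at the end.\<close>

lemma Rho_Ten:
  assumes [simp]: "x \<in> Ob A" "y \<in> Ob A"
  shows "Rho A (x \<otimes> y) \<cdot> Ass A x y \<one> = Ide A x \<boxtimes> Rho A y"
proof (rule Unit_TenA_cancel(2))
  have tri: "(Rho A z \<boxtimes> Ide A \<one>) \<cdot> Ass A z \<one> \<one> = Ide A z \<boxtimes> Lam A \<one>" if "z \<in> Ob A" for z
    using triangle[of z \<one>] that by simp
  let ?k = "Ass A x (y \<otimes> \<one>) \<one> \<cdot> (Ide A x \<boxtimes> Ass A y \<one> \<one>)"
  have "((Rho A (x \<otimes> y) \<cdot> Ass A x y \<one>) \<boxtimes> Ide A \<one>) \<cdot> ?k =
      (Rho A (x \<otimes> y) \<boxtimes> Ide A \<one>) \<cdot> (Ass A (x \<otimes> y) \<one> \<one> \<cdot> Ass A x y (\<one> \<otimes> \<one>))"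
    by (simp add: pentagon' Ide_TenA_Cmp(2) assoc)
  also have "\<dots> = (Ide A (x \<otimes> y) \<boxtimes> Lam A \<one>) \<cdot> Ass A x y (\<one> \<otimes> \<one>)"
    by (simp add: tri flip: assoc)
  also have "\<dots> = ((Ide A x \<boxtimes> Ide A y) \<boxtimes> Lam A \<one>) \<cdot> Ass A x y (\<one> \<otimes> \<one>)" by simp
  also have "\<dots> = Ass A x y \<one> \<cdot> (Ide A x \<boxtimes> ((Rho A y \<boxtimes> Ide A \<one>) \<cdot> Ass A y \<one> \<one>))"
    by (simp add: tri natural(1) del: Ide_cancel(3))
  also have "\<dots> = ((Ide A x \<boxtimes> Rho A y) \<boxtimes> Ide A \<one>) \<cdot> ?k"
    by (simp add: natural(1)[THEN Cmp_reduce] Ide_TenA_Cmp(1) assoc)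
  finally show "(Rho A (x \<otimes> y) \<cdot> Ass A x y \<one>) \<boxtimes> Ide A \<one> = (Ide A x \<boxtimes> Rho A y) \<boxtimes> Ide A \<one>"
    using iso_cancel_right[OF Cmp_iso[OF structure_isos(1)[of x "y \<otimes> \<one>" "\<one>"]
        TenA_iso[OF Ide_iso[of x] structure_isos(1)[of y "\<one>" "\<one>"]]]] by simp
qed simp_all

end

section \<open>Coherence of the middle four interchange\<close>

text \<open>The canonical isomorphism \<open>q (r z) \<rightarrow> r (q z)\<close>. Reading iterated right-nested products as
  words of left multiplications, it is a braiding of \<open>q \<otimes> -\<close> past \<open>r \<otimes> -\<close> for which no associators
  interfere; the coherence of \<open>interchange\<close> reduces to its hexagons.\<close>

definition swap_left :: "('o, 'm) smcat \<Rightarrow> 'o \<Rightarrow> 'o \<Rightarrow> 'o \<Rightarrow> 'm" where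
  "swap_left A q r z = inv_arrow A (Ass A r q z) \<cdot>\<^bsub>A\<^esub> (Sym A q r \<boxtimes>\<^bsub>A\<^esub> Ide A z) \<cdot>\<^bsub>A\<^esub> Ass A q r z"

context symmetric_monoidal_category
begin

lemma swap_left_typing [simp]:
  assumes "q \<in> Ob A" "r \<in> Ob A" "z \<in> Ob A"
  shows "swap_left A q r z \<in> Ar A" "Dom A (swap_left A q r z) = q \<otimes> (r \<otimes> z)"
    "Cod A (swap_left A q r z) = r \<otimes> (q \<otimes> z)"
  using assms by (simp_all add: swap_left_def)

lemma interchange_eq:
  "p \<in> Ob A \<Longrightarrow> q \<in> Ob A \<Longrightarrow> r \<in> Ob A \<Longrightarrow> s \<in> Ob A \<Longrightarrow>
    interchange A p q r s = Ass A p r (q \<otimes> s) \<cdot> ((Ide A p \<boxtimes> swap_left A q r s) \<cdot>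
      inv_arrow A (Ass A p q (r \<otimes> s)))"
  by (simp add: interchange_def swap_left_def assoc)

lemma interchange_typing [simp]:
  assumes "p \<in> Ob A" "q \<in> Ob A" "r \<in> Ob A" "s \<in> Ob A"
  shows "interchange A p q r s \<in> Ar A"
    "Dom A (interchange A p q r s) = (p \<otimes> q) \<otimes> (r \<otimes> s)"
    "Cod A (interchange A p q r s) = (p \<otimes> r) \<otimes> (q \<otimes> s)"
  using assms by (simp_all add: interchange_eq)

text \<open>Precomposition with an associator removes the inverse associator from
  \<open>interchange\<close>. The coherence laws below are proved in this form, and the associator
  is cancelled last.\<close>

lemma interchange_Ass:
  "p \<in> Ob A \<Longrightarrow> q \<in> Ob A \<Longrightarrow> r \<in> Ob A \<Longrightarrow> s \<in> Ob A \<Longrightarrow>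
    interchange A p q r s \<cdot> Ass A p q (r \<otimes> s) = Ass A p r (q \<otimes> s) \<cdot> (Ide A p \<boxtimes> swap_left A q r s)"
  by (simp add: interchange_eq assoc)

lemma Ass_swap_left:
  "q \<in> Ob A \<Longrightarrow> r \<in> Ob A \<Longrightarrow> z \<in> Ob A \<Longrightarrow>
    Ass A r q z \<cdot> swap_left A q r z = (Sym A q r \<boxtimes> Ide A z) \<cdot> Ass A q r z"
  by (simp add: swap_left_def assoc)

lemma swap_left_natural:
  assumes "f \<in> Ar A" "g \<in> Ar A" "h \<in> Ar A" "Cod A f = x" "Cod A g = y" "Cod A h = z"
  shows "swap_left A x y z \<cdot> (f \<boxtimes> (g \<boxtimes> h)) =
     (g \<boxtimes> (f \<boxtimes> h)) \<cdot> swap_left A (Dom A f) (Dom A g) (Dom A h)"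
proof -
  have xyz [simp]: "x \<in> Ob A" "y \<in> Ob A" "z \<in> Ob A" using assms by auto
  have "(Sym A x y \<boxtimes> Ide A z) \<cdot> ((f \<boxtimes> g) \<boxtimes> h) =
      ((g \<boxtimes> f) \<boxtimes> h) \<cdot> (Sym A (Dom A f) (Dom A g) \<boxtimes> Ide A (Dom A h))"
    using assms by (simp add: TenA_merge natural(4))
  then show ?thesis
    using assms by (simp add: swap_left_def assoc natural(1) Cmp_reduce[of "Sym A x y \<boxtimes> Ide A z"]
      Ass_inv_natural[THEN Cmp_reduce])
qed

lemma swap_left_inverse [simp]:
  assumes "q \<in> Ob A" "r \<in> Ob A" "z \<in> Ob A"
  shows "swap_left A r q z \<cdot> swap_left A q r z = Ide A (q \<otimes> (r \<otimes> z))"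
    "k \<in> Ar A \<Longrightarrow> Cod A k = q \<otimes> (r \<otimes> z) \<Longrightarrow> swap_left A r q z \<cdot> (swap_left A q r z \<cdot> k) = k"
proof -
  show *: "swap_left A r q z \<cdot> swap_left A q r z = Ide A (q \<otimes> (r \<otimes> z))"
    using assms by (simp add: swap_left_def assoc TenA_merge_assoc)
  show "k \<in> Ar A \<Longrightarrow> Cod A k = q \<otimes> (r \<otimes> z) \<Longrightarrow> swap_left A r q z \<cdot> (swap_left A q r z \<cdot> k) = k"
    using assms by (simp add: *[THEN Cmp_reduce])
qed

text \<open>Two pentagons with naturality of the associator along \<open>Sym A q r\<close> between
  them. This makes the swap independent of how the tail behind \<open>r\<close> is
  bracketed.\<close>

lemma swap_left_TenA:
  assumes [simp]: "q \<in> Ob A" "r \<in> Ob A" "s \<in> Ob A" "z \<in> Ob A"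
  shows "(swap_left A q r s \<boxtimes> Ide A z) \<cdot> (Ass A q (r \<otimes> s) z \<cdot> (Ide A q \<boxtimes> Ass A r s z)) =
    Ass A r (q \<otimes> s) z \<cdot> ((Ide A r \<boxtimes> Ass A q s z) \<cdot> swap_left A q r (s \<otimes> z))"
proof -
  have "(Ass A r q s \<boxtimes> Ide A z) \<cdot>
        ((swap_left A q r s \<boxtimes> Ide A z) \<cdot> (Ass A q (r \<otimes> s) z \<cdot> (Ide A q \<boxtimes> Ass A r s z))) =
      ((Ass A r q s \<cdot> swap_left A q r s) \<boxtimes> Ide A z) \<cdot> (Ass A q (r \<otimes> s) z \<cdot> (Ide A q \<boxtimes> Ass A r s z))"
    by (simp add: TenA_merge_assoc)
  also have "\<dots> = ((Sym A q r \<boxtimes> Ide A s) \<boxtimes> Ide A z) \<cdot>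
      ((Ass A q r s \<boxtimes> Ide A z) \<cdot> (Ass A q (r \<otimes> s) z \<cdot> (Ide A q \<boxtimes> Ass A r s z)))"
    by (simp add: Ass_swap_left TenA_merge_assoc)
  also have "\<dots> = ((Sym A q r \<boxtimes> Ide A s) \<boxtimes> Ide A z) \<cdot> (Ass A (q \<otimes> r) s z \<cdot> Ass A q r (s \<otimes> z))"
    by (simp add: pentagon')
  also have "\<dots> = Ass A (r \<otimes> q) s z \<cdot> ((Sym A q r \<boxtimes> (Ide A s \<boxtimes> Ide A z)) \<cdot> Ass A q r (s \<otimes> z))"
    by (simp add: natural(1)[THEN Cmp_reduce] assoc del: Ide_cancel(3))
  also have "\<dots> = (Ass A (r \<otimes> q) s z \<cdot> Ass A r q (s \<otimes> z)) \<cdot> swap_left A q r (s \<otimes> z)"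
    by (simp add: Ass_swap_left assoc)
  also have "\<dots> = (Ass A r q s \<boxtimes> Ide A z) \<cdot>
      (Ass A r (q \<otimes> s) z \<cdot> ((Ide A r \<boxtimes> Ass A q s z) \<cdot> swap_left A q r (s \<otimes> z)))"
    by (simp add: pentagon' assoc)
  finally show ?thesis
    using iso_cancel_left[OF TenA_iso[OF structure_isos(1)[of r q s] Ide_iso[of z]]] by simp
qed

text \<open>This is the hexagon with its leading associator moved to the other side, where it
  completes the pattern of \<open>swap_left\<close>.\<close>

lemma Sym_Ten_left:
  assumes [simp]: "x \<in> Ob A" "y \<in> Ob A" "z \<in> Ob A"
  shows "Sym A (x \<otimes> y) z \<cdot> Ass A x y z = swap_left A x z y \<cdot> (Ide A x \<boxtimes> Sym A y z)"
proof -
  have "inv_arrow A (Ass A z x y) \<cdot> (Ass A z x y \<cdot> Sym A (x \<otimes> y) z \<cdot> Ass A x y z) =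
      swap_left A x z y \<cdot> (Ide A x \<boxtimes> Sym A y z)"
    by (subst hexagon) (simp_all add: swap_left_def assoc)
  then show ?thesis by (simp add: assoc)
qed

lemma Sym_Ten_right:
  assumes [simp]: "x \<in> Ob A" "y \<in> Ob A" "z \<in> Ob A"
  shows "Sym A x (y \<otimes> z) = Ass A y z x \<cdot> ((Ide A y \<boxtimes> Sym A x z) \<cdot> swap_left A x y z)"
proof -
  \<comment> \<open>The first hexagon for \<open>y\<close>, \<open>z\<close>, \<open>x\<close>,
    composed on both sides with arrows that cancel: on the left side
    \<open>Sym A (y \<otimes> z) x\<close> disappears, on the right side both swaps do. The outcome
    is the second hexagon.\<close>
  have "Sym A x (y \<otimes> z) \<cdot> (Sym A (y \<otimes> z) x \<cdot> Ass A y z x) \<cdot> ((Ide A y \<boxtimes> Sym A x z) \<cdot> swap_left A x y z) =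
    Sym A x (y \<otimes> z) \<cdot> (swap_left A y x z \<cdot> (Ide A y \<boxtimes> Sym A z x)) \<cdot> ((Ide A y \<boxtimes> Sym A x z) \<cdot> swap_left A x y z)"
    by (simp only: Sym_Ten_left assms)
  then show ?thesis by (simp add: assoc TenA_merge_assoc)
qed

text \<open>The hexagon \<open>Sym_Ten_left\<close> tensored with \<open>z\<close>; pentagons and
  \<open>swap_left_TenA\<close> bring the result back to right-nested form.\<close>

lemma swap_left_Ten_left:
  assumes [simp]: "p \<in> Ob A" "q \<in> Ob A" "r \<in> Ob A" "z \<in> Ob A"
  shows "swap_left A (p \<otimes> q) r z \<cdot> Ass A p q (r \<otimes> z) =
    (Ide A r \<boxtimes> Ass A p q z) \<cdot> (swap_left A p r (q \<otimes> z) \<cdot> (Ide A p \<boxtimes> swap_left A q r z))"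
proof -
  have "Ass A r (p \<otimes> q) z \<cdot> (swap_left A (p \<otimes> q) r z \<cdot> Ass A p q (r \<otimes> z)) =
    (Sym A (p \<otimes> q) r \<boxtimes> Ide A z) \<cdot> (Ass A (p \<otimes> q) r z \<cdot> Ass A p q (r \<otimes> z))"
    by (simp add: Ass_swap_left[THEN Cmp_reduce] assoc)
  also have "\<dots> = ((Sym A (p \<otimes> q) r \<cdot> Ass A p q r) \<boxtimes> Ide A z) \<cdot>
      (Ass A p (q \<otimes> r) z \<cdot> (Ide A p \<boxtimes> Ass A q r z))"
    by (simp add: pentagon' TenA_merge_assoc)
  also have "\<dots> = (swap_left A p r q \<boxtimes> Ide A z) \<cdot> (((Ide A p \<boxtimes> Sym A q r) \<boxtimes> Ide A z) \<cdot>
      (Ass A p (q \<otimes> r) z \<cdot> (Ide A p \<boxtimes> Ass A q r z)))"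
    by (simp add: Sym_Ten_left TenA_merge_assoc)
  also have "\<dots> = (swap_left A p r q \<boxtimes> Ide A z) \<cdot> (Ass A p (r \<otimes> q) z \<cdot>
      (Ide A p \<boxtimes> ((Sym A q r \<boxtimes> Ide A z) \<cdot> Ass A q r z)))"
    by (simp add: natural(1)[THEN Cmp_reduce] assoc Ide_TenA_Cmp)
  also have "\<dots> = (swap_left A p r q \<boxtimes> Ide A z) \<cdot> (Ass A p (r \<otimes> q) z \<cdot>
      ((Ide A p \<boxtimes> Ass A r q z) \<cdot> (Ide A p \<boxtimes> swap_left A q r z)))"
    by (simp add: TenA_merge Ass_swap_left)
  also have "\<dots> = ((swap_left A p r q \<boxtimes> Ide A z) \<cdot> (Ass A p (r \<otimes> q) z \<cdot> (Ide A p \<boxtimes> Ass A r q z))) \<cdot>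
      (Ide A p \<boxtimes> swap_left A q r z)"
    by (simp add: assoc)
  also have "\<dots> = Ass A r (p \<otimes> q) z \<cdot>
     ((Ide A r \<boxtimes> Ass A p q z) \<cdot> (swap_left A p r (q \<otimes> z) \<cdot> (Ide A p \<boxtimes> swap_left A q r z)))"
    by (simp add: swap_left_TenA assoc)
  finally show ?thesis using iso_cancel_left[OF structure_isos(1)[of r "p \<otimes> q" z]] by simp
qed

text \<open>Obtained by inverting \<open>swap_left_Ten_left\<close>, since the swaps in the two
  directions are inverse to each other.\<close>

lemma swap_left_Ten_right:
  assumes [simp]: "q \<in> Ob A" "r \<in> Ob A" "t \<in> Ob A" "z \<in> Ob A"
  shows "swap_left A q (r \<otimes> t) z \<cdot> (Ide A q \<boxtimes> Ass A r t z) =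
    Ass A r t (q \<otimes> z) \<cdot> ((Ide A r \<boxtimes> swap_left A q t z) \<cdot> swap_left A q r (t \<otimes> z))"
proof -
  let ?k = "(Ide A r \<boxtimes> swap_left A q t z) \<cdot> swap_left A q r (t \<otimes> z)"
  have "swap_left A q (r \<otimes> t) z \<cdot> (swap_left A (r \<otimes> t) q z \<cdot> Ass A r t (q \<otimes> z)) \<cdot> ?k =
     swap_left A q (r \<otimes> t) z \<cdot> ((Ide A q \<boxtimes> Ass A r t z) \<cdot>
      (swap_left A r q (t \<otimes> z) \<cdot> (Ide A r \<boxtimes> swap_left A t q z))) \<cdot> ?k"
    by (simp only: swap_left_Ten_left assms)
  then show ?thesis by (simp add: assoc TenA_merge_assoc)
qed

lemma interchange_natural:
  assumes "e \<in> Ar A" "f \<in> Ar A" "g \<in> Ar A" "h \<in> Ar A"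
    "Cod A e = p" "Cod A f = q" "Cod A g = r" "Cod A h = s"
  shows "interchange A p q r s \<cdot> ((e \<boxtimes> f) \<boxtimes> (g \<boxtimes> h)) =
     ((e \<boxtimes> g) \<boxtimes> (f \<boxtimes> h)) \<cdot> interchange A (Dom A e) (Dom A f) (Dom A g) (Dom A h)"
proof -
  have [simp]: "p \<in> Ob A" "q \<in> Ob A" "r \<in> Ob A" "s \<in> Ob A" using assms by auto
  have "(Ide A p \<boxtimes> swap_left A q r s) \<cdot> (e \<boxtimes> (f \<boxtimes> (g \<boxtimes> h))) =
      (e \<boxtimes> (g \<boxtimes> (f \<boxtimes> h))) \<cdot> (Ide A (Dom A e) \<boxtimes> swap_left A (Dom A f) (Dom A g) (Dom A h))"
    using assms by (simp add: TenA_merge swap_left_natural)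
  then show ?thesis
    using assms by (simp add: interchange_eq assoc natural(1)[THEN Cmp_reduce] Ass_inv_natural
      Cmp_reduce[of "Ide A p \<boxtimes> swap_left A q r s"])
qed

lemma interchange_inverse [simp]:
  assumes [simp]: "p \<in> Ob A" "q \<in> Ob A" "r \<in> Ob A" "s \<in> Ob A"
  shows "interchange A p r q s \<cdot> interchange A p q r s = Ide A ((p \<otimes> q) \<otimes> (r \<otimes> s))"
    "k \<in> Ar A \<Longrightarrow> Cod A k = (p \<otimes> q) \<otimes> (r \<otimes> s) \<Longrightarrow>
       interchange A p r q s \<cdot> (interchange A p q r s \<cdot> k) = k"
proof -
  show *: "interchange A p r q s \<cdot> interchange A p q r s = Ide A ((p \<otimes> q) \<otimes> (r \<otimes> s))"
    by (simp add: interchange_eq assoc TenA_merge_assoc)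
  show "k \<in> Ar A \<Longrightarrow> Cod A k = (p \<otimes> q) \<otimes> (r \<otimes> s) \<Longrightarrow>
       interchange A p r q s \<cdot> (interchange A p q r s \<cdot> k) = k"
    by (simp add: *[THEN Cmp_reduce])
qed

text \<open>The analogue of \<open>swap_left_TenA\<close> for the interchange: read on the
  right-nested product, an interchange tensored with \<open>z\<close> is still only the swap of
  \<open>q\<close> and \<open>r\<close>.\<close>

lemma interchange_TenA:
  assumes [simp]: "p \<in> Ob A" "q \<in> Ob A" "r \<in> Ob A" "s \<in> Ob A" "z \<in> Ob A"
  shows "(interchange A p q r s \<boxtimes> Ide A z) \<cdot> (Ass A (p \<otimes> q) (r \<otimes> s) z \<cdot>
      (Ass A p q ((r \<otimes> s) \<otimes> z) \<cdot> (Ide A p \<boxtimes> (Ide A q \<boxtimes> Ass A r s z)))) =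
    Ass A (p \<otimes> r) (q \<otimes> s) z \<cdot> (Ass A p r ((q \<otimes> s) \<otimes> z) \<cdot>
      ((Ide A p \<boxtimes> (Ide A r \<boxtimes> Ass A q s z)) \<cdot> (Ide A p \<boxtimes> swap_left A q r (s \<otimes> z))))"
proof -
  have "(interchange A p q r s \<boxtimes> Ide A z) \<cdot> (Ass A (p \<otimes> q) (r \<otimes> s) z \<cdot>
      (Ass A p q ((r \<otimes> s) \<otimes> z) \<cdot> (Ide A p \<boxtimes> (Ide A q \<boxtimes> Ass A r s z)))) =
    ((interchange A p q r s \<cdot> Ass A p q (r \<otimes> s)) \<boxtimes> Ide A z) \<cdot> (Ass A p (q \<otimes> (r \<otimes> s)) z \<cdot>
      (Ide A p \<boxtimes> (Ass A q (r \<otimes> s) z \<cdot> (Ide A q \<boxtimes> Ass A r s z))))"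
    by (simp add: pentagon'[THEN Cmp_reduce] assoc Ide_TenA_Cmp)
  also have "\<dots> = (Ass A p r (q \<otimes> s) \<boxtimes> Ide A z) \<cdot> (((Ide A p \<boxtimes> swap_left A q r s) \<boxtimes> Ide A z) \<cdot>
      (Ass A p (q \<otimes> (r \<otimes> s)) z \<cdot> (Ide A p \<boxtimes> (Ass A q (r \<otimes> s) z \<cdot> (Ide A q \<boxtimes> Ass A r s z)))))"
    by (simp add: interchange_Ass Ide_TenA_Cmp assoc)
  also have "\<dots> = (Ass A p r (q \<otimes> s) \<boxtimes> Ide A z) \<cdot> (Ass A p (r \<otimes> (q \<otimes> s)) z \<cdot>
      (Ide A p \<boxtimes> ((swap_left A q r s \<boxtimes> Ide A z) \<cdot> (Ass A q (r \<otimes> s) z \<cdot> (Ide A q \<boxtimes> Ass A r s z)))))"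
    by (simp add: natural(1)[THEN Cmp_reduce] assoc Ide_TenA_Cmp)
  also have "\<dots> = (Ass A p r (q \<otimes> s) \<boxtimes> Ide A z) \<cdot> (Ass A p (r \<otimes> (q \<otimes> s)) z \<cdot>
      (Ide A p \<boxtimes> (Ass A r (q \<otimes> s) z \<cdot> ((Ide A r \<boxtimes> Ass A q s z) \<cdot> swap_left A q r (s \<otimes> z)))))"
    by (simp add: swap_left_TenA)
  also have "\<dots> = Ass A (p \<otimes> r) (q \<otimes> s) z \<cdot> (Ass A p r ((q \<otimes> s) \<otimes> z) \<cdot>
      ((Ide A p \<boxtimes> (Ide A r \<boxtimes> Ass A q s z)) \<cdot> (Ide A p \<boxtimes> swap_left A q r (s \<otimes> z))))"
    by (simp add: pentagon'[THEN Cmp_reduce] assoc Ide_TenA_Cmp)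
  finally show ?thesis .
qed

text \<open>On right-nested products both sides consist of the same three swaps of neighbours,
  \<open>s\<close> with \<open>t\<close>, \<open>q\<close> with \<open>r\<close> and
  \<open>q\<close> with \<open>t\<close>. They differ only in the order of the first two, which act
  on disjoint positions.\<close>

lemma interchange_assoc:
  assumes [simp]: "p \<in> Ob A" "q \<in> Ob A" "r \<in> Ob A" "s \<in> Ob A" "t \<in> Ob A" "u \<in> Ob A"
  shows "(Ass A p r t \<boxtimes> Ass A q s u) \<cdot> (interchange A p q (r \<otimes> t) (s \<otimes> u) \<cdot>
      (Ide A (p \<otimes> q) \<boxtimes> interchange A r s t u)) =
    interchange A (p \<otimes> r) (q \<otimes> s) t u \<cdot> ((interchange A p q r s \<boxtimes> Ide A (t \<otimes> u)) \<cdot>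
      Ass A (p \<otimes> q) (r \<otimes> s) (t \<otimes> u))"
proof -
  \<comment> \<open>\<open>?i\<close> leads from the right-nested product of the six objects to the
    common domain of both sides; it is invertible and is cancelled at the end.\<close>
  let ?i = "Ass A p q ((r \<otimes> s) \<otimes> (t \<otimes> u)) \<cdot> (Ide A p \<boxtimes> (Ide A q \<boxtimes> Ass A r s (t \<otimes> u)))"
  \<comment> \<open>The common normal form of both sides, up to two outer associators: three swaps
    followed by the regrouping of \<open>q\<close> with \<open>s\<close>.\<close>
  let ?j = "Ide A p \<boxtimes> ((Ide A r \<boxtimes> (Ide A t \<boxtimes> Ass A q s u)) \<cdot> ((Ide A r \<boxtimes> swap_left A q t (s \<otimes> u)) \<cdot>
      (swap_left A q r (t \<otimes> (s \<otimes> u)) \<cdot> (Ide A q \<boxtimes> (Ide A r \<boxtimes> swap_left A s t u)))))"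
  have "(Ass A p r t \<boxtimes> Ass A q s u) \<cdot> (interchange A p q (r \<otimes> t) (s \<otimes> u) \<cdot>
      (Ide A (p \<otimes> q) \<boxtimes> interchange A r s t u)) \<cdot> ?i =
    (Ass A p r t \<boxtimes> Ass A q s u) \<cdot> (interchange A p q (r \<otimes> t) (s \<otimes> u) \<cdot>
      (((Ide A p \<boxtimes> Ide A q) \<boxtimes> interchange A r s t u) \<cdot> ?i))"
    by (simp add: assoc)
  also have "\<dots> = (Ass A p r t \<boxtimes> Ass A q s u) \<cdot> (interchange A p q (r \<otimes> t) (s \<otimes> u) \<cdot>
      (Ass A p q ((r \<otimes> t) \<otimes> (s \<otimes> u)) \<cdot>
       (Ide A p \<boxtimes> (Ide A q \<boxtimes> (interchange A r s t u \<cdot> Ass A r s (t \<otimes> u))))))"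
    by (simp add: natural(1)[THEN Cmp_reduce] assoc Ide_TenA_Cmp del: Ide_cancel(3))
  also have "\<dots> = (Ass A p r t \<boxtimes> Ass A q s u) \<cdot> (Ass A p (r \<otimes> t) (q \<otimes> (s \<otimes> u)) \<cdot>
      (Ide A p \<boxtimes> (swap_left A q (r \<otimes> t) (s \<otimes> u) \<cdot>
       (Ide A q \<boxtimes> (Ass A r t (s \<otimes> u) \<cdot> (Ide A r \<boxtimes> swap_left A s t u))))))"
    by (simp add: interchange_Ass interchange_Ass[THEN Cmp_reduce] Ide_TenA_Cmp assoc)
  also have "\<dots> = (Ass A p r t \<boxtimes> Ass A q s u) \<cdot> (Ass A p (r \<otimes> t) (q \<otimes> (s \<otimes> u)) \<cdot>
      (Ide A p \<boxtimes> (Ass A r t (q \<otimes> (s \<otimes> u)) \<cdot> ((Ide A r \<boxtimes> swap_left A q t (s \<otimes> u)) \<cdot>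
       (swap_left A q r (t \<otimes> (s \<otimes> u)) \<cdot> (Ide A q \<boxtimes> (Ide A r \<boxtimes> swap_left A s t u)))))))"
    by (simp add: Ide_TenA_Cmp swap_left_Ten_right[THEN Cmp_reduce] assoc)
  also have "\<dots> = (Ide A ((p \<otimes> r) \<otimes> t) \<boxtimes> Ass A q s u) \<cdot>
      ((Ass A p r t \<boxtimes> Ide A (q \<otimes> (s \<otimes> u))) \<cdot> (Ass A p (r \<otimes> t) (q \<otimes> (s \<otimes> u)) \<cdot>
      ((Ide A p \<boxtimes> Ass A r t (q \<otimes> (s \<otimes> u))) \<cdot> (Ide A p \<boxtimes> ((Ide A r \<boxtimes> swap_left A q t (s \<otimes> u)) \<cdot>
       (swap_left A q r (t \<otimes> (s \<otimes> u)) \<cdot> (Ide A q \<boxtimes> (Ide A r \<boxtimes> swap_left A s t u))))))))"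
    by (simp add: TenA_merge_assoc TenA_merge)
  also have "\<dots> = ((Ide A (p \<otimes> r) \<boxtimes> Ide A t) \<boxtimes> Ass A q s u) \<cdot>
      (Ass A (p \<otimes> r) t (q \<otimes> (s \<otimes> u)) \<cdot> (Ass A p r (t \<otimes> (q \<otimes> (s \<otimes> u))) \<cdot>
      (Ide A p \<boxtimes> ((Ide A r \<boxtimes> swap_left A q t (s \<otimes> u)) \<cdot>
       (swap_left A q r (t \<otimes> (s \<otimes> u)) \<cdot> (Ide A q \<boxtimes> (Ide A r \<boxtimes> swap_left A s t u)))))))"
    by (simp add: pentagon'[THEN Cmp_reduce] assoc)
  also have "\<dots> = Ass A (p \<otimes> r) t ((q \<otimes> s) \<otimes> u) \<cdot>
      (((Ide A p \<boxtimes> Ide A r) \<boxtimes> (Ide A t \<boxtimes> Ass A q s u)) \<cdot> (Ass A p r (t \<otimes> (q \<otimes> (s \<otimes> u))) \<cdot>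
      (Ide A p \<boxtimes> ((Ide A r \<boxtimes> swap_left A q t (s \<otimes> u)) \<cdot>
       (swap_left A q r (t \<otimes> (s \<otimes> u)) \<cdot> (Ide A q \<boxtimes> (Ide A r \<boxtimes> swap_left A s t u)))))))"
    by (simp add: natural(1)[THEN Cmp_reduce] assoc)
  also have "\<dots> = Ass A (p \<otimes> r) t ((q \<otimes> s) \<otimes> u) \<cdot> (Ass A p r (t \<otimes> ((q \<otimes> s) \<otimes> u)) \<cdot> ?j)"
    by (simp add: natural(1)[THEN Cmp_reduce] assoc Ide_TenA_Cmp del: Ide_cancel(3))
  finally have 1: "(Ass A p r t \<boxtimes> Ass A q s u) \<cdot> (interchange A p q (r \<otimes> t) (s \<otimes> u) \<cdot>
      (Ide A (p \<otimes> q) \<boxtimes> interchange A r s t u)) \<cdot> ?i = \<dots>" .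
  have "interchange A (p \<otimes> r) (q \<otimes> s) t u \<cdot> ((interchange A p q r s \<boxtimes> Ide A (t \<otimes> u)) \<cdot>
      Ass A (p \<otimes> q) (r \<otimes> s) (t \<otimes> u)) \<cdot> ?i =
    interchange A (p \<otimes> r) (q \<otimes> s) t u \<cdot> (Ass A (p \<otimes> r) (q \<otimes> s) (t \<otimes> u) \<cdot>
      (Ass A p r ((q \<otimes> s) \<otimes> (t \<otimes> u)) \<cdot> (Ide A p \<boxtimes> ((Ide A r \<boxtimes> Ass A q s (t \<otimes> u)) \<cdot>
       swap_left A q r (s \<otimes> (t \<otimes> u))))))"
    using interchange_TenA[of p q r s "t \<otimes> u"] by (simp add: assoc Ide_TenA_Cmp)
  also have "\<dots> = Ass A (p \<otimes> r) t ((q \<otimes> s) \<otimes> u) \<cdot> (((Ide A p \<boxtimes> Ide A r) \<boxtimes> swap_left A (q \<otimes> s) t u) \<cdot>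
      (Ass A p r ((q \<otimes> s) \<otimes> (t \<otimes> u)) \<cdot> (Ide A p \<boxtimes> ((Ide A r \<boxtimes> Ass A q s (t \<otimes> u)) \<cdot>
       swap_left A q r (s \<otimes> (t \<otimes> u))))))"
    by (simp add: interchange_Ass[THEN Cmp_reduce] assoc)
  also have "\<dots> = Ass A (p \<otimes> r) t ((q \<otimes> s) \<otimes> u) \<cdot> (Ass A p r (t \<otimes> ((q \<otimes> s) \<otimes> u)) \<cdot>
      (Ide A p \<boxtimes> ((Ide A r \<boxtimes> (swap_left A (q \<otimes> s) t u \<cdot> Ass A q s (t \<otimes> u))) \<cdot>
       swap_left A q r (s \<otimes> (t \<otimes> u)))))"
    by (simp add: natural(1)[THEN Cmp_reduce] Ide_TenA_Cmp assoc del: Ide_cancel(3))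
  \<comment> \<open>On this side \<open>q\<close> was swapped with \<open>r\<close> first;
    naturality of that swap moves it behind the swap of \<open>s\<close> with
    \<open>t\<close>.\<close>
  also have "\<dots> = Ass A (p \<otimes> r) t ((q \<otimes> s) \<otimes> u) \<cdot> (Ass A p r (t \<otimes> ((q \<otimes> s) \<otimes> u)) \<cdot> ?j)"
    by (simp add: swap_left_Ten_left swap_left_natural Ide_TenA_Cmp assoc)
  finally have 2: "interchange A (p \<otimes> r) (q \<otimes> s) t u \<cdot> ((interchange A p q r s \<boxtimes> Ide A (t \<otimes> u)) \<cdot>
      Ass A (p \<otimes> q) (r \<otimes> s) (t \<otimes> u)) \<cdot> ?i = \<dots>" .
  have i: "?i \<in> isos A (p \<otimes> (q \<otimes> (r \<otimes> (s \<otimes> (t \<otimes> u))))) ((p \<otimes> q) \<otimes> ((r \<otimes> s) \<otimes> (t \<otimes> u)))"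
    by (rule Cmp_iso[OF structure_isos(1) TenA_iso[OF Ide_iso TenA_iso[OF Ide_iso structure_isos(1)]]])
      simp_all
  show ?thesis by (rule iso_cancel_right[OF i _ _ _ _ 1[folded 2]]) simp_all
qed

text \<open>The two hexagons expand the symmetry of \<open>p \<otimes> q\<close> and
  \<open>r \<otimes> s\<close> into four swaps of neighbours. The interchange on the right undoes
  the swap of \<open>p\<close> with \<open>s\<close>; the other three make up the left side.\<close>

lemma interchange_Sym:
  assumes [simp]: "p \<in> Ob A" "q \<in> Ob A" "r \<in> Ob A" "s \<in> Ob A"
  shows "(Sym A p r \<boxtimes> Sym A q s) \<cdot> interchange A p q r s =
    interchange A r s p q \<cdot> Sym A (p \<otimes> q) (r \<otimes> s)"
proof -
  have "interchange A r s p q \<cdot> Sym A (p \<otimes> q) (r \<otimes> s) \<cdot> Ass A p q (r \<otimes> s) =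
    interchange A r s p q \<cdot> (swap_left A p (r \<otimes> s) q \<cdot>
      (Ide A p \<boxtimes> (Ass A r s q \<cdot> ((Ide A r \<boxtimes> Sym A q s) \<cdot> swap_left A q r s))))"
    by (simp add: Sym_Ten_left Sym_Ten_right[of q r s] assoc)
  also have "\<dots> = interchange A r s p q \<cdot> (swap_left A p (r \<otimes> s) q \<cdot>
      ((Ide A p \<boxtimes> Ass A r s q) \<cdot> (Ide A p \<boxtimes> ((Ide A r \<boxtimes> Sym A q s) \<cdot> swap_left A q r s))))"
    by (simp add: TenA_merge)
  also have "\<dots> = Ass A r p (s \<otimes> q) \<cdot> (swap_left A p r (s \<otimes> q) \<cdot>
      (Ide A p \<boxtimes> ((Ide A r \<boxtimes> Sym A q s) \<cdot> swap_left A q r s)))"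
    by (simp add: swap_left_Ten_right[THEN Cmp_reduce] interchange_Ass[THEN Cmp_reduce] assoc
        TenA_merge_assoc)
  also have "\<dots> = (Sym A p r \<boxtimes> Ide A (s \<otimes> q)) \<cdot> (Ass A p r (s \<otimes> q) \<cdot>
      (Ide A p \<boxtimes> ((Ide A r \<boxtimes> Sym A q s) \<cdot> swap_left A q r s)))"
    by (simp add: Ass_swap_left[THEN Cmp_reduce] assoc)
  also have "\<dots> = (Sym A p r \<boxtimes> Ide A (s \<otimes> q)) \<cdot> (((Ide A p \<boxtimes> Ide A r) \<boxtimes> Sym A q s) \<cdot>
      (Ass A p r (q \<otimes> s) \<cdot> (Ide A p \<boxtimes> swap_left A q r s)))"
    by (simp add: Ide_TenA_Cmp natural(1)[THEN Cmp_reduce] assoc del: Ide_cancel(3))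
  also have "\<dots> = (Sym A p r \<boxtimes> Sym A q s) \<cdot> interchange A p q r s \<cdot> Ass A p q (r \<otimes> s)"
    by (simp add: interchange_Ass assoc TenA_merge_assoc)
  finally show ?thesis
    using iso_cancel_right[OF structure_isos(1)[of p q "r \<otimes> s"]] by simp
qed

text \<open>By \<open>Lam_Sym\<close> the symmetry with the unit is a comparison of unitors, so
  moving the unit past \<open>q\<close> leaves no trace once the unitors are applied.\<close>

lemma Lam_swap_left:
  assumes [simp]: "q \<in> Ob A" "z \<in> Ob A"
  shows "Lam A (q \<otimes> z) \<cdot> swap_left A q \<one> z = Ide A q \<boxtimes> Lam A z"
    "(Ide A q \<boxtimes> Lam A z) \<cdot> swap_left A \<one> q z = Lam A (q \<otimes> z)"
proof -
  have "Lam A (q \<otimes> z) \<cdot> swap_left A q \<one> z =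
      (Lam A q \<boxtimes> Ide A z) \<cdot> (Ass A \<one> q z \<cdot> swap_left A q \<one> z)"
    by (simp flip: Lam_Ten add: assoc)
  also have "\<dots> = ((Lam A q \<cdot> Sym A q \<one>) \<boxtimes> Ide A z) \<cdot> Ass A q \<one> z"
    by (simp add: Ass_swap_left TenA_merge_assoc)
  finally show 1: "Lam A (q \<otimes> z) \<cdot> swap_left A q \<one> z = Ide A q \<boxtimes> Lam A z"
    by (simp add: Lam_Sym triangle)
  show "(Ide A q \<boxtimes> Lam A z) \<cdot> swap_left A \<one> q z = Lam A (q \<otimes> z)"
    by (simp flip: 1 add: assoc)
qed

text \<open>With \<open>interchange_Lam\<close>, the coherence behind the unit laws of
  \<open>box_smf\<close>, whose \<open>lax0\<close> contains the inverse of \<open>Rho\<close> at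
  the unit.\<close>

lemma interchange_Rho:
  assumes [simp]: "p \<in> Ob A" "q \<in> Ob A"
  shows "(Rho A p \<boxtimes> Rho A q) \<cdot> interchange A p q \<one> \<one> = Rho A (p \<otimes> q) \<cdot> (Ide A (p \<otimes> q) \<boxtimes> Rho A \<one>)"
proof -
  have "(Rho A p \<boxtimes> Rho A q) \<cdot> interchange A p q \<one> \<one> \<cdot> Ass A p q (\<one> \<otimes> \<one>) =
     (Rho A p \<boxtimes> Ide A q) \<cdot> (((Ide A p \<boxtimes> Ide A \<one>) \<boxtimes> Rho A q) \<cdot>
       (Ass A p \<one> (q \<otimes> \<one>) \<cdot> (Ide A p \<boxtimes> swap_left A q \<one> \<one>)))"
    by (simp add: interchange_Ass assoc TenA_merge_assoc)
  also have "\<dots> = (Ide A p \<boxtimes> Lam A q) \<cdot> (Ide A p \<boxtimes> ((Ide A \<one> \<boxtimes> Rho A q) \<cdot> swap_left A q \<one> \<one>))"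
    by (simp flip: triangle add: natural(1)[THEN Cmp_reduce] Ide_TenA_Cmp assoc del: Ide_cancel(3))
  also have "\<dots> = Ide A p \<boxtimes> (Rho A q \<cdot> (Lam A (q \<otimes> \<one>) \<cdot> swap_left A q \<one> \<one>))"
    by (simp add: TenA_merge natural(3)[THEN Cmp_reduce] assoc)
  also have "\<dots> = (Ide A p \<boxtimes> Rho A q) \<cdot> (Ide A p \<boxtimes> (Ide A q \<boxtimes> Rho A \<one>))"
    by (simp add: Lam_swap_left TenA_merge Rho_Unit)
  also have "\<dots> = (Rho A (p \<otimes> q) \<cdot> Ass A p q \<one>) \<cdot> (Ide A p \<boxtimes> (Ide A q \<boxtimes> Rho A \<one>))"
    by (simp add: Rho_Ten)
  also have "\<dots> = Rho A (p \<otimes> q) \<cdot> ((Ide A p \<boxtimes> Ide A q) \<boxtimes> Rho A \<one>) \<cdot> Ass A p q (\<one> \<otimes> \<one>)"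
    by (simp add: natural(1) assoc del: Ide_cancel(3))
  finally show ?thesis
    using iso_cancel_right[OF structure_isos(1)[of p q "\<one> \<otimes> \<one>"]] by simp
qed

lemma interchange_Lam:
  assumes [simp]: "p \<in> Ob A" "q \<in> Ob A"
  shows "(Lam A p \<boxtimes> Lam A q) \<cdot> interchange A \<one> \<one> p q = Lam A (p \<otimes> q) \<cdot> (Rho A \<one> \<boxtimes> Ide A (p \<otimes> q))"
proof -
  have "(Lam A p \<boxtimes> Lam A q) \<cdot> interchange A \<one> \<one> p q \<cdot> Ass A \<one> \<one> (p \<otimes> q) =
     (Lam A p \<boxtimes> Ide A q) \<cdot> (((Ide A \<one> \<boxtimes> Ide A p) \<boxtimes> Lam A q) \<cdot>
       (Ass A \<one> p (\<one> \<otimes> q) \<cdot> (Ide A \<one> \<boxtimes> swap_left A \<one> p q)))"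
    by (simp add: interchange_Ass assoc TenA_merge_assoc)
  also have "\<dots> = Lam A (p \<otimes> q) \<cdot> (Ide A \<one> \<boxtimes> ((Ide A p \<boxtimes> Lam A q) \<cdot> swap_left A \<one> p q))"
    by (simp flip: Lam_Ten add: natural(1)[THEN Cmp_reduce] Ide_TenA_Cmp assoc del: Ide_cancel(3))
  also have "\<dots> = Lam A (p \<otimes> q) \<cdot> (Rho A \<one> \<boxtimes> Ide A (p \<otimes> q)) \<cdot> Ass A \<one> \<one> (p \<otimes> q)"
    by (simp add: Lam_swap_left triangle assoc)
  finally show ?thesis
    using iso_cancel_right[OF structure_isos(1)[of "\<one>" "\<one>" "p \<otimes> q"]] by simp
qed

end

section \<open>Functors and transformations\<close>

text \<open>Typing by \<open>Dom\<close> and \<open>Cod\<close> and right-nested composites replace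
  the form of the locale axioms, so that goals arrive in simplifier normal form. Once both
  categories are supplied, cases 13 to 17 of \<open>goal_cases\<close> are naturality,
  associativity, right unit, left unit and symmetry.\<close>

lemma symmetric_monoidal_functorI:
  fixes A :: "('o, 'm) smcat" and B :: "('p, 'n) smcat" (structure) and F :: "('o, 'm, 'p, 'n) smfun"
  assumes A: "symmetric_monoidal_category A" and B: "symmetric_monoidal_category B"
    and "Src F = A" "Tgt F = B"
    and O: "\<And>x. x \<in> Ob A \<Longrightarrow> onO F x \<in> Ob B" "onO F \<in> extensional (Ob A)"
    and ext: "onA F \<in> extensional (Ar A)"
    and arr: "\<And>f. f \<in> Ar A \<Longrightarrow> onA F f \<in> Ar B \<and> Dom B (onA F f) = onO F (Dom A f) \<and>
          Cod B (onA F f) = onO F (Cod A f)"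
    and "\<And>x. x \<in> Ob A \<Longrightarrow> onA F (Ide A x) = Ide B (onO F x)"
    and cmp: "\<And>g f. g \<in> Ar A \<Longrightarrow> f \<in> Ar A \<Longrightarrow> Dom A g = Cod A f \<Longrightarrow>
          onA F (g \<cdot>\<^bsub>A\<^esub> f) = onA F g \<cdot> onA F f"
    and lax0: "lax0 F \<in> Ar B \<and> Dom B (lax0 F) = \<one> \<and> Cod B (lax0 F) = onO F \<one>\<^bsub>A\<^esub>"
    and lax2: "lax2 F \<in> extensional (Ob A)" "\<And>x. x \<in> Ob A \<Longrightarrow> lax2 F x \<in> extensional (Ob A)"
      "\<And>x y. x \<in> Ob A \<Longrightarrow> y \<in> Ob A \<Longrightarrow> lax2 F x y \<in> Ar B \<and>
          Dom B (lax2 F x y) = onO F x \<otimes> onO F y \<and> Cod B (lax2 F x y) = onO F (x \<otimes>\<^bsub>A\<^esub> y)"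
    and nat: "\<And>f g. f \<in> Ar A \<Longrightarrow> g \<in> Ar A \<Longrightarrow>
          lax2 F (Cod A f) (Cod A g) \<cdot> (onA F f \<boxtimes> onA F g) =
          onA F (f \<boxtimes>\<^bsub>A\<^esub> g) \<cdot> lax2 F (Dom A f) (Dom A g)"
    and assoc: "\<And>x y z. x \<in> Ob A \<Longrightarrow> y \<in> Ob A \<Longrightarrow> z \<in> Ob A \<Longrightarrow>
          lax2 F (x \<otimes>\<^bsub>A\<^esub> y) z \<cdot> ((lax2 F x y \<boxtimes> Ide B (onO F z)) \<cdot>
            Ass B (onO F x) (onO F y) (onO F z)) =
          onA F (Ass A x y z) \<cdot> (lax2 F x (y \<otimes>\<^bsub>A\<^esub> z) \<cdot> (Ide B (onO F x) \<boxtimes> lax2 F y z))"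
    and rho: "\<And>x. x \<in> Ob A \<Longrightarrow>
          onA F (Rho A x) \<cdot> (lax2 F x \<one>\<^bsub>A\<^esub> \<cdot> (Ide B (onO F x) \<boxtimes> lax0 F)) = Rho B (onO F x)"
    and lam: "\<And>x. x \<in> Ob A \<Longrightarrow>
          onA F (Lam A x) \<cdot> (lax2 F \<one>\<^bsub>A\<^esub> x \<cdot> (lax0 F \<boxtimes> Ide B (onO F x))) = Lam B (onO F x)"
    and "\<And>x y. x \<in> Ob A \<Longrightarrow> y \<in> Ob A \<Longrightarrow>
          onA F (Sym A x y) \<cdot> lax2 F x y = lax2 F y x \<cdot> Sym B (onO F x) (onO F y)"
  shows "symmetric_monoidal_functor A B F"
proof -
  interpret A: symmetric_monoidal_category A by fact
  interpret B: symmetric_monoidal_category B by fact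
  show ?thesis
  proof (unfold_locales, goal_cases)
    case 3 show ?case using O by (auto simp: PiE_def)
  next
    case (5 f x y) then show ?case using arr by (auto simp: A.arrows_iff B.arrows_iff)
  next
    case (7 g y z f x) then show ?case using cmp by (auto simp: A.arrows_iff)
  next
    case 8 show ?case using lax0 by (simp add: B.arrows_iff)
  next
    case 9 show ?case using lax2 by (auto simp: PiE_def)
  next
    case (10 x y) then show ?case using lax2 by (simp add: B.arrows_iff)
  next
    case (11 f x x' g y y') then show ?case using nat by (auto simp: A.arrows_iff)
  next
    case (12 x y z) then show ?case using assoc[of x y z] lax2 O arr by (simp add: B.assoc)
  next
    case (13 x) then show ?case using rho[of x] lax0 lax2 O arr by (simp add: B.assoc)
  next
    case (14 x) then show ?case using lam[of x] lax0 lax2 O arr by (simp add: B.assoc)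
  qed (use assms in auto)
qed

context symmetric_monoidal_functor
begin

lemma onO_typing [simp]: "x \<in> Ob A \<Longrightarrow> onO F x \<in> Ob B"
  using onO_closed by auto

lemma onA_typing [simp]:
  assumes "f \<in> Ar A"
  shows "onA F f \<in> Ar B" "Dom B (onA F f) = onO F (Dom A f)" "Cod B (onA F f) = onO F (Cod A f)"
  using onA_closed[of f "Dom A f" "Cod A f"] assms by (auto simp: A.arrows_iff B.arrows_iff)

lemma lax_typing [simp]:
  "lax0 F \<in> Ar B" "Dom B (lax0 F) = \<one>\<^bsub>B\<^esub>" "Cod B (lax0 F) = onO F \<one>\<^bsub>A\<^esub>"
  "x \<in> Ob A \<Longrightarrow> y \<in> Ob A \<Longrightarrow> lax2 F x y \<in> Ar B"
  "x \<in> Ob A \<Longrightarrow> y \<in> Ob A \<Longrightarrow> Dom B (lax2 F x y) = onO F x \<otimes>\<^bsub>B\<^esub> onO F y"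
  "x \<in> Ob A \<Longrightarrow> y \<in> Ob A \<Longrightarrow> Cod B (lax2 F x y) = onO F (x \<otimes>\<^bsub>A\<^esub> y)"
  using lax0_closed lax2_closed[of x y] by (auto simp: B.arrows_iff)

lemma preserves_Ide [simp]: "x \<in> Ob A \<Longrightarrow> onA F (Ide A x) = Ide B (onO F x)"
  by (rule onA_Ide)

lemma preserves_Cmp:
  "g \<in> Ar A \<Longrightarrow> f \<in> Ar A \<Longrightarrow> Dom A g = Cod A f \<Longrightarrow> onA F (g \<cdot>\<^bsub>A\<^esub> f) = onA F g \<cdot>\<^bsub>B\<^esub> onA F f"
  using onA_Cmp[of g "Dom A g" "Cod A g" f "Dom A f"] by (auto simp: A.arrows_iff)

lemma lax2_nat:
  "f \<in> Ar A \<Longrightarrow> g \<in> Ar A \<Longrightarrow> Cod A f = x \<Longrightarrow> Cod A g = y \<Longrightarrow>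
    lax2 F x y \<cdot>\<^bsub>B\<^esub> (onA F f \<boxtimes>\<^bsub>B\<^esub> onA F g) = onA F (f \<boxtimes>\<^bsub>A\<^esub> g) \<cdot>\<^bsub>B\<^esub> lax2 F (Dom A f) (Dom A g)"
  using lax2_natural[of f "Dom A f" x g "Dom A g" y] by (auto simp: A.arrows_iff)

lemma lax_assoc':
  "x \<in> Ob A \<Longrightarrow> y \<in> Ob A \<Longrightarrow> z \<in> Ob A \<Longrightarrow>
    lax2 F (x \<otimes>\<^bsub>A\<^esub> y) z \<cdot>\<^bsub>B\<^esub> ((lax2 F x y \<boxtimes>\<^bsub>B\<^esub> Ide B (onO F z)) \<cdot>\<^bsub>B\<^esub>
      Ass B (onO F x) (onO F y) (onO F z)) =
    onA F (Ass A x y z) \<cdot>\<^bsub>B\<^esub> (lax2 F x (y \<otimes>\<^bsub>A\<^esub> z) \<cdot>\<^bsub>B\<^esub> (Ide B (onO F x) \<boxtimes>\<^bsub>B\<^esub> lax2 F y z))"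
  using lax_assoc[of x y z] by (simp add: B.assoc)

lemma lax_Rho':
  "x \<in> Ob A \<Longrightarrow>
    onA F (Rho A x) \<cdot>\<^bsub>B\<^esub> (lax2 F x \<one>\<^bsub>A\<^esub> \<cdot>\<^bsub>B\<^esub> (Ide B (onO F x) \<boxtimes>\<^bsub>B\<^esub> lax0 F)) = Rho B (onO F x)"
  using lax_Rho[of x] by (simp add: B.assoc)

lemma lax_Lam':
  "x \<in> Ob A \<Longrightarrow>
    onA F (Lam A x) \<cdot>\<^bsub>B\<^esub> (lax2 F \<one>\<^bsub>A\<^esub> x \<cdot>\<^bsub>B\<^esub> (lax0 F \<boxtimes>\<^bsub>B\<^esub> Ide B (onO F x))) = Lam B (onO F x)"
  using lax_Lam[of x] by (simp add: B.assoc)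

lemma extensionality:
  "onO F \<in> extensional (Ob A)" "onA F \<in> extensional (Ar A)" "lax2 F \<in> extensional (Ob A)"
  "x \<in> Ob A \<Longrightarrow> lax2 F x \<in> extensional (Ob A)"
  using onO_closed onA_extensional lax2_extensional by (auto simp: PiE_def)

end

lemma smf_eqI:
  assumes "symmetric_monoidal_functor A B F" "symmetric_monoidal_functor A B G"
    and "\<And>x. x \<in> Ob A \<Longrightarrow> onO F x = onO G x" "\<And>f. f \<in> Ar A \<Longrightarrow> onA F f = onA G f"
    and "lax0 F = lax0 G" "\<And>x y. x \<in> Ob A \<Longrightarrow> y \<in> Ob A \<Longrightarrow> lax2 F x y = lax2 G x y"
  shows "F = G"
proof -
  interpret F: symmetric_monoidal_functor A B F by fact
  interpret G: symmetric_monoidal_functor A B G by fact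
  have "lax2 F x = lax2 G x" if "x \<in> Ob A" for x
    by (rule extensionalityI[OF F.extensionality(4) G.extensionality(4)]) (use that assms(6) in auto)
  then show ?thesis
    using assms(3-5) F.extensionality G.extensionality
    by (intro smfun.equality) (auto simp: F.Src G.Src F.Tgt G.Tgt intro: extensionalityI)
qed

text \<open>In proofs by \<open>goal_cases\<close>, cases 5, 6 and 7 are naturality, the unit
  condition and the product condition.\<close>

lemma monoidal_transformationI:
  fixes A :: "('o, 'm) smcat" and B :: "('p, 'n) smcat" (structure) and \<sigma> :: "('o, 'm, 'p, 'n) mtrans"
  assumes F: "symmetric_monoidal_functor A B (NDom \<sigma>)" and G: "symmetric_monoidal_functor A B (NCod \<sigma>)"
    and ext: "at \<sigma> \<in> extensional (Ob A)"
    and arr: "\<And>x. x \<in> Ob A \<Longrightarrow> at \<sigma> x \<in> Ar B \<and> Dom B (at \<sigma> x) = onO (NDom \<sigma>) x \<and>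
          Cod B (at \<sigma> x) = onO (NCod \<sigma>) x"
    and nat: "\<And>f. f \<in> Ar A \<Longrightarrow>
          at \<sigma> (Cod A f) \<cdot> onA (NDom \<sigma>) f = onA (NCod \<sigma>) f \<cdot> at \<sigma> (Dom A f)"
    and lax0: "at \<sigma> \<one>\<^bsub>A\<^esub> \<cdot> lax0 (NDom \<sigma>) = lax0 (NCod \<sigma>)"
    and lax2: "\<And>x y. x \<in> Ob A \<Longrightarrow> y \<in> Ob A \<Longrightarrow>
          at \<sigma> (x \<otimes>\<^bsub>A\<^esub> y) \<cdot> lax2 (NDom \<sigma>) x y = lax2 (NCod \<sigma>) x y \<cdot> (at \<sigma> x \<boxtimes> at \<sigma> y)"
  shows "monoidal_transformation A B \<sigma>"
proof -
  interpret F: symmetric_monoidal_functor A B "NDom \<sigma>" by fact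
  interpret G: symmetric_monoidal_functor A B "NCod \<sigma>" by fact
  show ?thesis
    using assms by unfold_locales (auto simp: F.A.arrows_iff F.B.arrows_iff)
qed

context monoidal_transformation
begin

lemma at_typing [simp]:
  assumes "x \<in> Ob A"
  shows "at \<sigma> x \<in> Ar B" "Dom B (at \<sigma> x) = onO (NDom \<sigma>) x" "Cod B (at \<sigma> x) = onO (NCod \<sigma>) x"
  using at_closed[OF assms] by (auto simp: F.B.arrows_iff)

lemma at_nat:
  "f \<in> Ar A \<Longrightarrow> Cod A f = y \<Longrightarrow> at \<sigma> y \<cdot>\<^bsub>B\<^esub> onA (NDom \<sigma>) f = onA (NCod \<sigma>) f \<cdot>\<^bsub>B\<^esub> at \<sigma> (Dom A f)"
  using at_natural[of f "Dom A f" y] by (auto simp: F.A.arrows_iff)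

end

lemma mtrans_eqI:
  assumes "monoidal_transformation A B \<sigma>" "monoidal_transformation A B \<tau>"
    and "NDom \<sigma> = NDom \<tau>" "NCod \<sigma> = NCod \<tau>" "\<And>x. x \<in> Ob A \<Longrightarrow> at \<sigma> x = at \<tau> x"
  shows "\<sigma> = \<tau>"
  using assms monoidal_transformation.at_extensional[OF assms(1)]
    monoidal_transformation.at_extensional[OF assms(2)]
  by (intro mtrans.equality) (auto intro: extensionalityI)

section \<open>The internal hom is a symmetric monoidal category\<close>

context
  fixes A :: "('o, 'm) smcat" and B :: "('p, 'n) smcat" (structure)
  assumes A: "symmetric_monoidal_category A" and B: "symmetric_monoidal_category B"
begin

interpretation A: symmetric_monoidal_category A by (rule A)
interpretation B: symmetric_monoidal_category B by (rule B)

text \<open>The unit object is a commutative monoid with multiplication \<open>Rho B \<one>\<close>: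
  associativity is the triangle, since \<open>Rho_Unit\<close> identifies the two unitors there, and
  commutativity is \<open>Sym_Unit\<close>.\<close>

lemma const_smf_functor: "symmetric_monoidal_functor A B (const_smf A B)"
proof (rule symmetric_monoidal_functorI[OF A B], goal_cases)
  case (13 f g) then show ?case by (simp add: const_smf_def)
next
  case (14 x y z)
  have "(Rho B \<one> \<boxtimes> Ide B \<one>) \<cdot> Ass B \<one> \<one> \<one> = Ide B \<one> \<boxtimes> Rho B \<one>"
    using B.triangle[of "\<one>" "\<one>"] by (simp add: B.Rho_Unit)
  then show ?case using 14 by (simp add: const_smf_def)
qed (simp_all add: const_smf_def B.Sym_Unit B.Rho_Unit)

text \<open>Naturality moves the interchange past the constraints, after which the laws of
  \<open>F\<close> and \<open>G\<close> apply separately in the two tensor factors. What remains of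
  each law is the corresponding one of \<open>interchange_assoc\<close>,
  \<open>interchange_Rho\<close>, \<open>interchange_Lam\<close> and
  \<open>interchange_Sym\<close>.\<close>

lemma box_smf_functor:
  assumes F: "symmetric_monoidal_functor A B F" and G: "symmetric_monoidal_functor A B G"
  shows "symmetric_monoidal_functor A B (box_smf A B F G)"
proof (rule symmetric_monoidal_functorI[OF A B], goal_cases)
  interpret F: symmetric_monoidal_functor A B F by (rule F)
  interpret G: symmetric_monoidal_functor A B G by (rule G)
  {
    case 3 then show ?case by (simp add: box_smf_def)
  next
    case 4 then show ?case by (simp add: box_smf_def)
  next
    case 5 then show ?case by (simp add: box_smf_def)
  next
    case (6 f) then show ?case by (simp add: box_smf_def)
  next
    case (7 x) then show ?case by (simp add: box_smf_def)
  next
    case (8 g f) then show ?case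
      by (simp add: box_smf_def F.preserves_Cmp G.preserves_Cmp B.TenA_merge)
  next
    case 9 show ?case by (simp add: box_smf_def)
  next
    case (12 x y) then show ?case by (simp add: box_smf_def)
  next
    case (13 f g)
    then show ?case
      by (simp add: box_smf_def B.assoc B.interchange_natural B.TenA_merge_assoc F.lax2_nat G.lax2_nat)
  next
    case (14 x y z)
    then have [simp]: "x \<in> Ob A" "y \<in> Ob A" "z \<in> Ob A" by auto
    let ?L = "box_smf A B F G"
    let ?m = "\<lambda>x y. interchange B (onO F x) (onO G x) (onO F y) (onO G y)"
    have "lax2 ?L (x \<otimes>\<^bsub>A\<^esub> y) z \<cdot> ((lax2 ?L x y \<boxtimes> Ide B (onO ?L z)) \<cdot>
            Ass B (onO ?L x) (onO ?L y) (onO ?L z)) =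
        (lax2 F (x \<otimes>\<^bsub>A\<^esub> y) z \<boxtimes> lax2 G (x \<otimes>\<^bsub>A\<^esub> y) z) \<cdot> (?m (x \<otimes>\<^bsub>A\<^esub> y) z \<cdot>
        (((lax2 F x y \<boxtimes> lax2 G x y) \<boxtimes> (Ide B (onO F z) \<boxtimes> Ide B (onO G z))) \<cdot>
         ((?m x y \<boxtimes> Ide B (onO F z \<otimes> onO G z)) \<cdot>
          Ass B (onO F x \<otimes> onO G x) (onO F y \<otimes> onO G y) (onO F z \<otimes> onO G z))))"
      by (simp add: box_smf_def B.assoc B.TenA_merge_assoc)
    also have "\<dots> = ((lax2 F (x \<otimes>\<^bsub>A\<^esub> y) z \<cdot> (lax2 F x y \<boxtimes> Ide B (onO F z))) \<boxtimes>
        (lax2 G (x \<otimes>\<^bsub>A\<^esub> y) z \<cdot> (lax2 G x y \<boxtimes> Ide B (onO G z)))) \<cdot>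
        (interchange B (onO F x \<otimes> onO F y) (onO G x \<otimes> onO G y) (onO F z) (onO G z) \<cdot>
         ((?m x y \<boxtimes> Ide B (onO F z \<otimes> onO G z)) \<cdot>
          Ass B (onO F x \<otimes> onO G x) (onO F y \<otimes> onO G y) (onO F z \<otimes> onO G z)))"
      by (simp add: B.interchange_natural[THEN B.Cmp_reduce] B.assoc del: B.Ide_cancel(3))
        (simp add: B.TenA_merge_assoc)
    also have "\<dots> = ((lax2 F (x \<otimes>\<^bsub>A\<^esub> y) z \<cdot> (lax2 F x y \<boxtimes> Ide B (onO F z)) \<cdot>
          Ass B (onO F x) (onO F y) (onO F z)) \<boxtimes>
        (lax2 G (x \<otimes>\<^bsub>A\<^esub> y) z \<cdot> (lax2 G x y \<boxtimes> Ide B (onO G z)) \<cdot>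
          Ass B (onO G x) (onO G y) (onO G z))) \<cdot>
        (interchange B (onO F x) (onO G x) (onO F y \<otimes> onO F z) (onO G y \<otimes> onO G z) \<cdot>
         (Ide B (onO F x \<otimes> onO G x) \<boxtimes> ?m y z))"
      by (subst B.interchange_assoc[symmetric]) (simp_all add: B.TenA_merge_assoc)
    also have "\<dots> = (onA F (Ass A x y z) \<boxtimes> onA G (Ass A x y z)) \<cdot>
        ((lax2 F x (y \<otimes>\<^bsub>A\<^esub> z) \<boxtimes> lax2 G x (y \<otimes>\<^bsub>A\<^esub> z)) \<cdot>
        (((Ide B (onO F x) \<boxtimes> lax2 F y z) \<boxtimes> (Ide B (onO G x) \<boxtimes> lax2 G y z)) \<cdot>
        (interchange B (onO F x) (onO G x) (onO F y \<otimes> onO F z) (onO G y \<otimes> onO G z) \<cdot>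
         (Ide B (onO F x \<otimes> onO G x) \<boxtimes> ?m y z))))"
      by (simp add: F.lax_assoc' G.lax_assoc' B.assoc B.TenA_merge_assoc)
    also have "\<dots> = (onA F (Ass A x y z) \<boxtimes> onA G (Ass A x y z)) \<cdot>
        ((lax2 F x (y \<otimes>\<^bsub>A\<^esub> z) \<boxtimes> lax2 G x (y \<otimes>\<^bsub>A\<^esub> z)) \<cdot> (?m x (y \<otimes>\<^bsub>A\<^esub> z) \<cdot>
        (((Ide B (onO F x) \<boxtimes> Ide B (onO G x)) \<boxtimes> (lax2 F y z \<boxtimes> lax2 G y z)) \<cdot>
         (Ide B (onO F x \<otimes> onO G x) \<boxtimes> ?m y z))))"
      by (simp add: B.interchange_natural[THEN B.Cmp_reduce] B.assoc del: B.Ide_cancel(3))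
    also have "\<dots> = onA ?L (Ass A x y z) \<cdot> (lax2 ?L x (y \<otimes>\<^bsub>A\<^esub> z) \<cdot>
        (Ide B (onO ?L x) \<boxtimes> lax2 ?L y z))"
      by (simp add: box_smf_def B.assoc B.TenA_merge)
    finally show ?case .
  next
    case (15 x)
    then have [simp]: "x \<in> Ob A" by auto
    let ?m = "interchange B (onO F x) (onO G x)"
    have "Rho B (onO F x \<otimes> onO G x) =
      ((Rho B (onO F x) \<boxtimes> Rho B (onO G x)) \<cdot> ?m \<one> \<one>) \<cdot>
       (Ide B (onO F x \<otimes> onO G x) \<boxtimes> inv_arrow B (Rho B \<one>))"
      by (subst B.interchange_Rho) (simp_all add: B.assoc B.TenA_merge)
    also have "\<dots> = (onA F (Rho A x) \<boxtimes> onA G (Rho A x)) \<cdot>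
      ((lax2 F x \<one>\<^bsub>A\<^esub> \<boxtimes> lax2 G x \<one>\<^bsub>A\<^esub>) \<cdot>
      (((Ide B (onO F x) \<boxtimes> lax0 F) \<boxtimes> (Ide B (onO G x) \<boxtimes> lax0 G)) \<cdot> (?m \<one> \<one> \<cdot>
       (Ide B (onO F x \<otimes> onO G x) \<boxtimes> inv_arrow B (Rho B \<one>)))))"
      by (simp add: B.TenA_merge_assoc F.lax_Rho' G.lax_Rho' B.assoc)
    also have "\<dots> = (onA F (Rho A x) \<boxtimes> onA G (Rho A x)) \<cdot>
      ((lax2 F x \<one>\<^bsub>A\<^esub> \<boxtimes> lax2 G x \<one>\<^bsub>A\<^esub>) \<cdot> (?m (onO F \<one>\<^bsub>A\<^esub>) (onO G \<one>\<^bsub>A\<^esub>) \<cdot>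
      (((Ide B (onO F x) \<boxtimes> Ide B (onO G x)) \<boxtimes> (lax0 F \<boxtimes> lax0 G)) \<cdot>
       (Ide B (onO F x \<otimes> onO G x) \<boxtimes> inv_arrow B (Rho B \<one>)))))"
      by (simp add: B.interchange_natural[THEN B.Cmp_reduce] B.assoc del: B.Ide_cancel(3))
    finally show ?case by (simp add: box_smf_def B.assoc B.TenA_merge)
  next
    case (16 x)
    then have [simp]: "x \<in> Ob A" by auto
    let ?m = "\<lambda>y z. interchange B y z (onO F x) (onO G x)"
    have "Lam B (onO F x \<otimes> onO G x) =
      ((Lam B (onO F x) \<boxtimes> Lam B (onO G x)) \<cdot> ?m \<one> \<one>) \<cdot>
       (inv_arrow B (Rho B \<one>) \<boxtimes> Ide B (onO F x \<otimes> onO G x))"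
      by (subst B.interchange_Lam) (simp_all add: B.assoc B.TenA_merge)
    also have "\<dots> = (onA F (Lam A x) \<boxtimes> onA G (Lam A x)) \<cdot>
      ((lax2 F \<one>\<^bsub>A\<^esub> x \<boxtimes> lax2 G \<one>\<^bsub>A\<^esub> x) \<cdot>
      (((lax0 F \<boxtimes> Ide B (onO F x)) \<boxtimes> (lax0 G \<boxtimes> Ide B (onO G x))) \<cdot> (?m \<one> \<one> \<cdot>
       (inv_arrow B (Rho B \<one>) \<boxtimes> Ide B (onO F x \<otimes> onO G x)))))"
      by (simp add: B.TenA_merge_assoc F.lax_Lam' G.lax_Lam' B.assoc)
    also have "\<dots> = (onA F (Lam A x) \<boxtimes> onA G (Lam A x)) \<cdot>
      ((lax2 F \<one>\<^bsub>A\<^esub> x \<boxtimes> lax2 G \<one>\<^bsub>A\<^esub> x) \<cdot> (?m (onO F \<one>\<^bsub>A\<^esub>) (onO G \<one>\<^bsub>A\<^esub>) \<cdot>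
      (((lax0 F \<boxtimes> lax0 G) \<boxtimes> (Ide B (onO F x) \<boxtimes> Ide B (onO G x))) \<cdot>
       (inv_arrow B (Rho B \<one>) \<boxtimes> Ide B (onO F x \<otimes> onO G x)))))"
      by (simp add: B.interchange_natural[THEN B.Cmp_reduce] B.assoc del: B.Ide_cancel(3))
    finally show ?case by (simp add: box_smf_def B.assoc B.TenA_merge)
  next
    case (17 x y)
    then show ?case
      by (simp add: box_smf_def B.assoc B.TenA_merge_assoc F.lax_Sym G.lax_Sym
          flip: B.interchange_Sym)
  }
qed (simp_all add: box_smf_def)

lemma ihom_simps [simp]:
  "F \<in> Ob (ihom A B) \<longleftrightarrow> symmetric_monoidal_functor A B F"
  "\<sigma> \<in> Ar (ihom A B) \<longleftrightarrow> monoidal_transformation A B \<sigma>"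
  "Dom (ihom A B) = NDom" "Cod (ihom A B) = NCod" "Ten (ihom A B) = box_smf A B"
  "\<one>\<^bsub>ihom A B\<^esub> = const_smf A B"
  by (simp_all add: ihom_def)

lemma ihom_arrows:
  "\<sigma> \<in> arrows (ihom A B) F G \<longleftrightarrow> monoidal_transformation A B \<sigma> \<and> NDom \<sigma> = F \<and> NCod \<sigma> = G"
  by (simp add: arrows_def)

end

section \<open>Coherence laws solved for the inverse interchange and the inverse unitor\<close>

context symmetric_monoidal_category
begin

lemma Ass_Rho_inv:
  "Ass A \<one> \<one> \<one> \<cdot> (Ide A \<one> \<boxtimes> inv_arrow A (Rho A \<one>)) = inv_arrow A (Rho A \<one>) \<boxtimes> Ide A \<one>"
proof -
  have "(inv_arrow A (Rho A \<one>) \<boxtimes> Ide A \<one>) \<cdot> (((Rho A \<one> \<boxtimes> Ide A \<one>) \<cdot> Ass A \<one> \<one> \<one>) \<cdot>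
      (Ide A \<one> \<boxtimes> inv_arrow A (Rho A \<one>))) = inv_arrow A (Rho A \<one>) \<boxtimes> Ide A \<one>"
    by (subst triangle) (simp_all add: TenA_merge flip: Rho_Unit)
  then show ?thesis by (simp add: assoc TenA_merge_assoc)
qed

text \<open>\<open>interchange_assoc\<close> composed on both sides with inverse interchanges
  \<open>?k\<close> and \<open>?l\<close>. Here the associators come after the interchanges on one
  side and before them on the other, which is the product condition on the associator of the
  hom.\<close>

lemma interchange_coassoc:
  assumes [simp]: "p \<in> Ob A" "q \<in> Ob A" "r \<in> Ob A" "s \<in> Ob A" "t \<in> Ob A" "u \<in> Ob A"
  shows "Ass A (p \<otimes> q) (r \<otimes> s) (t \<otimes> u) \<cdot> ((Ide A (p \<otimes> q) \<boxtimes> interchange A r t s u) \<cdot>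
      interchange A p (r \<otimes> t) q (s \<otimes> u)) =
    (interchange A p r q s \<boxtimes> Ide A (t \<otimes> u)) \<cdot> (interchange A (p \<otimes> r) t (q \<otimes> s) u \<cdot>
      (Ass A p r t \<boxtimes> Ass A q s u))"
proof -
  let ?k = "(Ide A (p \<otimes> q) \<boxtimes> interchange A r t s u) \<cdot> interchange A p (r \<otimes> t) q (s \<otimes> u)"
  let ?l = "(interchange A p r q s \<boxtimes> Ide A (t \<otimes> u)) \<cdot> interchange A (p \<otimes> r) t (q \<otimes> s) u"
  have "?l \<cdot> ((Ass A p r t \<boxtimes> Ass A q s u) \<cdot> (interchange A p q (r \<otimes> t) (s \<otimes> u) \<cdot>
      (Ide A (p \<otimes> q) \<boxtimes> interchange A r s t u))) \<cdot> ?k =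
     ?l \<cdot> (interchange A (p \<otimes> r) (q \<otimes> s) t u \<cdot> ((interchange A p q r s \<boxtimes> Ide A (t \<otimes> u)) \<cdot>
      Ass A (p \<otimes> q) (r \<otimes> s) (t \<otimes> u))) \<cdot> ?k"
    by (simp only: interchange_assoc assms)
  then show ?thesis by (simp add: assoc TenA_merge_assoc)
qed

lemma interchange_Rho':
  assumes [simp]: "p \<in> Ob A" "q \<in> Ob A"
  shows "Rho A (p \<otimes> q) \<cdot> ((Ide A (p \<otimes> q) \<boxtimes> Rho A \<one>) \<cdot> interchange A p \<one> q \<one>) = Rho A p \<boxtimes> Rho A q"
  using arg_cong[OF interchange_Rho[of p q], of "\<lambda>k. k \<cdot> interchange A p \<one> q \<one>"]
  by (simp add: assoc)

lemma interchange_Lam':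
  assumes [simp]: "p \<in> Ob A" "q \<in> Ob A"
  shows "Lam A (p \<otimes> q) \<cdot> ((Rho A \<one> \<boxtimes> Ide A (p \<otimes> q)) \<cdot> interchange A \<one> p \<one> q) = Lam A p \<boxtimes> Lam A q"
  using arg_cong[OF interchange_Lam[of p q], of "\<lambda>k. k \<cdot> interchange A \<one> p \<one> q"]
  by (simp add: assoc)

lemma interchange_Sym':
  assumes [simp]: "p \<in> Ob A" "q \<in> Ob A" "r \<in> Ob A" "s \<in> Ob A"
  shows "Sym A (p \<otimes> r) (q \<otimes> s) \<cdot> interchange A p q r s =
    interchange A q p s r \<cdot> (Sym A p q \<boxtimes> Sym A r s)"
proof -
  have "interchange A q p s r \<cdot> ((Sym A p q \<boxtimes> Sym A r s) \<cdot> interchange A p r q s) \<cdot>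
      interchange A p q r s =
    interchange A q p s r \<cdot> (interchange A q s p r \<cdot> Sym A (p \<otimes> r) (q \<otimes> s)) \<cdot> interchange A p q r s"
    by (simp only: interchange_Sym assms)
  then show ?thesis by (simp add: assoc)
qed

end

lemma box_smf_proj [simp]:
  "x \<in> Ob A \<Longrightarrow> onO (box_smf A B F G) x = onO F x \<otimes>\<^bsub>B\<^esub> onO G x"
  "f \<in> Ar A \<Longrightarrow> onA (box_smf A B F G) f = onA F f \<boxtimes>\<^bsub>B\<^esub> onA G f"
  "lax0 (box_smf A B F G) = (lax0 F \<boxtimes>\<^bsub>B\<^esub> lax0 G) \<cdot>\<^bsub>B\<^esub> inv_arrow B (Rho B \<one>\<^bsub>B\<^esub>)"
  "x \<in> Ob A \<Longrightarrow> y \<in> Ob A \<Longrightarrow> lax2 (box_smf A B F G) x y =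
    (lax2 F x y \<boxtimes>\<^bsub>B\<^esub> lax2 G x y) \<cdot>\<^bsub>B\<^esub> interchange B (onO F x) (onO G x) (onO F y) (onO G y)"
  by (simp_all add: box_smf_def)

lemma const_smf_proj [simp]:
  "x \<in> Ob A \<Longrightarrow> onO (const_smf A B) x = \<one>\<^bsub>B\<^esub>"
  "f \<in> Ar A \<Longrightarrow> onA (const_smf A B) f = Ide B \<one>\<^bsub>B\<^esub>"
  "lax0 (const_smf A B) = Ide B \<one>\<^bsub>B\<^esub>"
  "x \<in> Ob A \<Longrightarrow> y \<in> Ob A \<Longrightarrow> lax2 (const_smf A B) x y = Rho B \<one>\<^bsub>B\<^esub>"
  by (simp_all add: const_smf_def)

lemma ihom_proj [simp]:
  "NDom (Ide (ihom A B) F) = F" "NCod (Ide (ihom A B) F) = F"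
  "x \<in> Ob A \<Longrightarrow> at (Ide (ihom A B) F) x = Ide B (onO F x)"
  "NDom (\<tau> \<cdot>\<^bsub>ihom A B\<^esub> \<sigma>) = NDom \<sigma>" "NCod (\<tau> \<cdot>\<^bsub>ihom A B\<^esub> \<sigma>) = NCod \<tau>"
  "x \<in> Ob A \<Longrightarrow> at (\<tau> \<cdot>\<^bsub>ihom A B\<^esub> \<sigma>) x = at \<tau> x \<cdot>\<^bsub>B\<^esub> at \<sigma> x"
  "NDom (\<tau> \<boxtimes>\<^bsub>ihom A B\<^esub> \<sigma>) = box_smf A B (NDom \<tau>) (NDom \<sigma>)"
  "NCod (\<tau> \<boxtimes>\<^bsub>ihom A B\<^esub> \<sigma>) = box_smf A B (NCod \<tau>) (NCod \<sigma>)"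
  "x \<in> Ob A \<Longrightarrow> at (\<tau> \<boxtimes>\<^bsub>ihom A B\<^esub> \<sigma>) x = at \<tau> x \<boxtimes>\<^bsub>B\<^esub> at \<sigma> x"
  "NDom (Ass (ihom A B) F G H) = box_smf A B F (box_smf A B G H)"
  "NCod (Ass (ihom A B) F G H) = box_smf A B (box_smf A B F G) H"
  "x \<in> Ob A \<Longrightarrow> at (Ass (ihom A B) F G H) x = Ass B (onO F x) (onO G x) (onO H x)"
  "NDom (Rho (ihom A B) F) = box_smf A B F (const_smf A B)" "NCod (Rho (ihom A B) F) = F"
  "x \<in> Ob A \<Longrightarrow> at (Rho (ihom A B) F) x = Rho B (onO F x)"
  "NDom (Lam (ihom A B) F) = box_smf A B (const_smf A B) F" "NCod (Lam (ihom A B) F) = F"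
  "x \<in> Ob A \<Longrightarrow> at (Lam (ihom A B) F) x = Lam B (onO F x)"
  "NDom (Sym (ihom A B) F G) = box_smf A B F G" "NCod (Sym (ihom A B) F G) = box_smf A B G F"
  "x \<in> Ob A \<Longrightarrow> at (Sym (ihom A B) F G) x = Sym B (onO F x) (onO G x)"
  by (simp_all add: ihom_def)

lemma ihom_extensional [simp]:
  "at (Ide (ihom A B) F) \<in> extensional (Ob A)"
  "at (\<tau> \<cdot>\<^bsub>ihom A B\<^esub> \<sigma>) \<in> extensional (Ob A)"
  "at (\<tau> \<boxtimes>\<^bsub>ihom A B\<^esub> \<sigma>) \<in> extensional (Ob A)"
  "at (Ass (ihom A B) F G H) \<in> extensional (Ob A)"
  "at (Rho (ihom A B) F) \<in> extensional (Ob A)"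
  "at (Lam (ihom A B) F) \<in> extensional (Ob A)"
  "at (Sym (ihom A B) F G) \<in> extensional (Ob A)"
  by (simp_all add: ihom_def)

section \<open>The structure transformations and the axioms of the hom\<close>

context
  fixes A :: "('o, 'm) smcat" and B :: "('p, 'n) smcat" (structure)
  assumes A: "symmetric_monoidal_category A" and B: "symmetric_monoidal_category B"
begin

interpretation A: symmetric_monoidal_category A by (rule A)
interpretation B: symmetric_monoidal_category B by (rule B)

lemma ihom_Ide:
  assumes "symmetric_monoidal_functor A B F"
  shows "monoidal_transformation A B (Ide (ihom A B) F)"
proof -
  interpret F: symmetric_monoidal_functor A B F by fact
  show ?thesis by (rule monoidal_transformationI) (simp_all add: assms)
qed

lemma ihom_Cmp:
  assumes "monoidal_transformation A B \<tau>" "monoidal_transformation A B \<sigma>" and [simp]: "NDom \<tau> = NCod \<sigma>"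
  shows "monoidal_transformation A B (\<tau> \<cdot>\<^bsub>ihom A B\<^esub> \<sigma>)"
proof -
  interpret t: monoidal_transformation A B \<tau> by fact
  interpret s: monoidal_transformation A B \<sigma> by fact
  note [simp] = t.at_typing[simplified] t.at_nat[simplified] s.at_nat
    t.at_nat[simplified, THEN B.Cmp_reduce] t.at_lax2[simplified, THEN B.Cmp_reduce]
    t.at_lax0[simplified] s.at_lax0 s.at_lax2
  show ?thesis
    by (rule monoidal_transformationI)
      (simp_all add: s.F.symmetric_monoidal_functor_axioms t.G.symmetric_monoidal_functor_axioms
        B.assoc B.TenA_merge)
qed

lemma ihom_TenA:
  assumes "monoidal_transformation A B \<tau>" "monoidal_transformation A B \<sigma>"
  shows "monoidal_transformation A B (\<tau> \<boxtimes>\<^bsub>ihom A B\<^esub> \<sigma>)"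
proof -
  interpret t: monoidal_transformation A B \<tau> by fact
  interpret s: monoidal_transformation A B \<sigma> by fact
  show ?thesis
    by (rule monoidal_transformationI)
      (simp_all add: box_smf_functor A B s.F.symmetric_monoidal_functor_axioms
        s.G.symmetric_monoidal_functor_axioms t.F.symmetric_monoidal_functor_axioms
        t.G.symmetric_monoidal_functor_axioms s.at_nat t.at_nat s.at_lax0 t.at_lax0
        s.at_lax2 t.at_lax2 B.assoc B.TenA_merge B.TenA_merge_assoc B.interchange_natural)
qed

text \<open>Naturality is inherited pointwise. The unit condition rests on
  \<open>Ass_Rho_inv\<close> and the product condition on \<open>interchange_coassoc\<close>,
  because the ends are iterated products of functors.\<close>

lemma ihom_Ass:
  assumes "symmetric_monoidal_functor A B F" "symmetric_monoidal_functor A B G"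
    "symmetric_monoidal_functor A B H"
  shows "monoidal_transformation A B (Ass (ihom A B) F G H)"
proof -
  interpret F: symmetric_monoidal_functor A B F by fact
  interpret G: symmetric_monoidal_functor A B G by fact
  interpret H: symmetric_monoidal_functor A B H by fact
  show ?thesis
  proof (rule monoidal_transformationI, goal_cases)
    case 6
    have "Ass B (onO F \<one>\<^bsub>A\<^esub>) (onO G \<one>\<^bsub>A\<^esub>) (onO H \<one>\<^bsub>A\<^esub>) \<cdot>
        ((lax0 F \<boxtimes> (lax0 G \<boxtimes> lax0 H)) \<cdot> ((Ide B \<one> \<boxtimes> inv_arrow B (Rho B \<one>)) \<cdot>
          inv_arrow B (Rho B \<one>))) =
       ((lax0 F \<boxtimes> lax0 G) \<boxtimes> lax0 H) \<cdot> ((inv_arrow B (Rho B \<one>) \<boxtimes> Ide B \<one>) \<cdot>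
          inv_arrow B (Rho B \<one>))"
      by (simp add: B.natural(1)[THEN B.Cmp_reduce] B.assoc B.Ass_Rho_inv[THEN B.Cmp_reduce])
    then show ?case by (simp add: B.TenA_merge_assoc)
  next
    case (7 x y)
    then have "Ass B (onO F (x \<otimes>\<^bsub>A\<^esub> y)) (onO G (x \<otimes>\<^bsub>A\<^esub> y)) (onO H (x \<otimes>\<^bsub>A\<^esub> y)) \<cdot>
        ((lax2 F x y \<boxtimes> (lax2 G x y \<boxtimes> lax2 H x y)) \<cdot>
         ((Ide B (onO F x \<otimes> onO F y) \<boxtimes> interchange B (onO G x) (onO H x) (onO G y) (onO H y)) \<cdot>
          interchange B (onO F x) (onO G x \<otimes> onO H x) (onO F y) (onO G y \<otimes> onO H y))) =
      ((lax2 F x y \<boxtimes> lax2 G x y) \<boxtimes> lax2 H x y) \<cdot>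
         ((interchange B (onO F x) (onO G x) (onO F y) (onO G y) \<boxtimes> Ide B (onO H x \<otimes> onO H y)) \<cdot>
          (interchange B (onO F x \<otimes> onO G x) (onO H x) (onO F y \<otimes> onO G y) (onO H y) \<cdot>
           (Ass B (onO F x) (onO G x) (onO H x) \<boxtimes> Ass B (onO F y) (onO G y) (onO H y))))"
      by (simp add: B.natural(1)[THEN B.Cmp_reduce] B.assoc B.interchange_coassoc)
    then show ?case using 7 by (simp add: B.assoc B.TenA_merge_assoc)
  qed (use assms in \<open>simp_all add: box_smf_functor A B B.natural\<close>)
qed

lemma ihom_Rho:
  assumes "symmetric_monoidal_functor A B F"
  shows "monoidal_transformation A B (Rho (ihom A B) F)"
proof -
  interpret F: symmetric_monoidal_functor A B F by fact
  show ?thesis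
  proof (rule monoidal_transformationI, goal_cases)
    case 6
    show ?case by (simp add: B.natural(2)[THEN B.Cmp_reduce] B.assoc)
  next
    case (7 x y)
    then have "Rho B (onO F (x \<otimes>\<^bsub>A\<^esub> y)) \<cdot> ((lax2 F x y \<boxtimes> Ide B \<one>) \<cdot>
      ((Ide B (onO F x \<otimes> onO F y) \<boxtimes> Rho B \<one>) \<cdot>
         interchange B (onO F x) \<one> (onO F y) \<one>)) =
       lax2 F x y \<cdot> (Rho B (onO F x) \<boxtimes> Rho B (onO F y))"
      by (simp add: B.natural(2)[THEN B.Cmp_reduce] B.assoc B.interchange_Rho')
    then show ?case using 7 by (simp add: B.TenA_merge_assoc)
  qed (use assms in \<open>simp_all add: box_smf_functor const_smf_functor A B B.natural\<close>)
qed

lemma ihom_Lam: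
  assumes "symmetric_monoidal_functor A B F"
  shows "monoidal_transformation A B (Lam (ihom A B) F)"
proof -
  interpret F: symmetric_monoidal_functor A B F by fact
  show ?thesis
  proof (rule monoidal_transformationI, goal_cases)
    case 6
    show ?case by (simp add: B.natural(3)[THEN B.Cmp_reduce] B.assoc B.Rho_Unit)
  next
    case (7 x y)
    then have "Lam B (onO F (x \<otimes>\<^bsub>A\<^esub> y)) \<cdot> ((Ide B \<one> \<boxtimes> lax2 F x y) \<cdot>
      ((Rho B \<one> \<boxtimes> Ide B (onO F x \<otimes> onO F y)) \<cdot>
         interchange B \<one> (onO F x) \<one> (onO F y))) =
       lax2 F x y \<cdot> (Lam B (onO F x) \<boxtimes> Lam B (onO F y))"
      by (simp add: B.natural(3)[THEN B.Cmp_reduce] B.assoc B.interchange_Lam')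
    then show ?case using 7 by (simp add: B.TenA_merge_assoc)
  qed (use assms in \<open>simp_all add: box_smf_functor const_smf_functor A B B.natural\<close>)
qed

lemma ihom_Sym:
  assumes "symmetric_monoidal_functor A B F" "symmetric_monoidal_functor A B G"
  shows "monoidal_transformation A B (Sym (ihom A B) F G)"
proof -
  interpret F: symmetric_monoidal_functor A B F by fact
  interpret G: symmetric_monoidal_functor A B G by fact
  show ?thesis
  proof (rule monoidal_transformationI, goal_cases)
    case 6
    show ?case by (simp add: B.natural(4)[THEN B.Cmp_reduce] B.assoc B.Sym_Unit)
  next
    case (7 x y)
    then show ?case
      by (simp add: B.natural(4)[THEN B.Cmp_reduce] B.assoc B.interchange_Sym')
  qed (use assms in \<open>simp_all add: box_smf_functor A B B.natural\<close>)
qed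

text \<open>Each law for the pointwise inverse is the law for \<open>\<sigma>\<close> conjugated by
  inverse components. Invertibility in the hom thereby reduces to invertibility at each
  object.\<close>

lemma inverse_transformation:
  assumes "monoidal_transformation A B \<sigma>"
    and iso: "\<And>x. x \<in> Ob A \<Longrightarrow> at \<sigma> x \<in> isos B (onO (NDom \<sigma>) x) (onO (NCod \<sigma>) x)"
  defines "\<tau> \<equiv> \<lparr>NDom = NCod \<sigma>, NCod = NDom \<sigma>, at = (\<lambda>x\<in>Ob A. inv_arrow B (at \<sigma> x))\<rparr>"
  shows "monoidal_transformation A B \<tau>" "inverse_arrows (ihom A B) \<sigma> \<tau>"
proof -
  interpret s: monoidal_transformation A B \<sigma> by fact
  note [simp] = B.inv_arrow_facts[OF iso] B.inv_cancel_left[OF iso]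
  have 1: "monoidal_transformation A B \<tau>"
  proof (rule monoidal_transformationI, goal_cases)
    case (5 f)
    have "inv_arrow B (at \<sigma> (Cod A f)) \<cdot> ((at \<sigma> (Cod A f) \<cdot> onA (NDom \<sigma>) f) \<cdot>
        inv_arrow B (at \<sigma> (Dom A f))) =
      inv_arrow B (at \<sigma> (Cod A f)) \<cdot> ((onA (NCod \<sigma>) f \<cdot> at \<sigma> (Dom A f)) \<cdot>
        inv_arrow B (at \<sigma> (Dom A f)))"
      using 5 by (simp only: s.at_nat)
    then show ?case using 5 by (simp add: \<tau>_def B.assoc)
  next
    case 6
    have "inv_arrow B (at \<sigma> \<one>\<^bsub>A\<^esub>) \<cdot> lax0 (NCod \<sigma>) =
        inv_arrow B (at \<sigma> \<one>\<^bsub>A\<^esub>) \<cdot> (at \<sigma> \<one>\<^bsub>A\<^esub> \<cdot> lax0 (NDom \<sigma>))"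
      by (simp only: s.at_lax0)
    then show ?case by (simp add: \<tau>_def)
  next
    case (7 x y)
    have "inv_arrow B (at \<sigma> (x \<otimes>\<^bsub>A\<^esub> y)) \<cdot> ((at \<sigma> (x \<otimes>\<^bsub>A\<^esub> y) \<cdot> lax2 (NDom \<sigma>) x y) \<cdot>
        (inv_arrow B (at \<sigma> x) \<boxtimes> inv_arrow B (at \<sigma> y))) =
      inv_arrow B (at \<sigma> (x \<otimes>\<^bsub>A\<^esub> y)) \<cdot> ((lax2 (NCod \<sigma>) x y \<cdot> (at \<sigma> x \<boxtimes> at \<sigma> y)) \<cdot>
        (inv_arrow B (at \<sigma> x) \<boxtimes> inv_arrow B (at \<sigma> y)))"
      using 7 by (simp only: s.at_lax2)
    then show ?case using 7 by (simp add: \<tau>_def B.assoc B.TenA_merge)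
  qed (simp_all add: \<tau>_def s.F.symmetric_monoidal_functor_axioms s.G.symmetric_monoidal_functor_axioms)
  show "monoidal_transformation A B \<tau>" by (rule 1)
  have "\<tau> \<cdot>\<^bsub>ihom A B\<^esub> \<sigma> = Ide (ihom A B) (NDom \<sigma>)" "\<sigma> \<cdot>\<^bsub>ihom A B\<^esub> \<tau> = Ide (ihom A B) (NCod \<sigma>)"
    using ihom_Cmp[OF 1 assms(1)] ihom_Cmp[OF assms(1) 1]
      ihom_Ide[OF s.F.symmetric_monoidal_functor_axioms]
      ihom_Ide[OF s.G.symmetric_monoidal_functor_axioms]
    by (auto intro!: mtrans_eqI[of A B] simp: \<tau>_def)
  then show "inverse_arrows (ihom A B) \<sigma> \<tau>"
    using 1 assms(1) by (auto simp: inverse_arrows_def ihom_arrows A B \<tau>_def)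
qed

lemma ihom_isosI:
  assumes "monoidal_transformation A B \<sigma>" "NDom \<sigma> = F" "NCod \<sigma> = G"
    and "\<And>x. x \<in> Ob A \<Longrightarrow> at \<sigma> x \<in> isos B (onO F x) (onO G x)"
  shows "\<sigma> \<in> isos (ihom A B) F G"
  using inverse_transformation(2)[OF assms(1)] assms by (auto simp: isos_def ihom_arrows A B)

text \<open>All operations are pointwise, so each equational axiom is the same axiom of
  \<open>B\<close> at an object. That the arrows involved are monoidal transformations, as
  membership in the hom requires, is what the lemmas above provide.\<close>

lemma ihom_symmetric_monoidal_category: "symmetric_monoidal_category (ihom A B)"
proof (unfold_locales, goal_cases)
  case (1 f)
  then interpret f: monoidal_transformation A B f by (simp add: A B)
  show ?case by (simp add: f.F.symmetric_monoidal_functor_axioms A B)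
next
  case (2 f)
  then interpret f: monoidal_transformation A B f by (simp add: A B)
  show ?case by (simp add: f.G.symmetric_monoidal_functor_axioms A B)
next
  case (3 x) then show ?case by (simp add: ihom_arrows ihom_Ide A B)
next
  case (4 g y z f x) then show ?case by (simp add: ihom_arrows ihom_Cmp A B)
next
  case (5 f x y)
  then interpret f: monoidal_transformation A B f by (simp add: ihom_arrows A B)
  show ?case using 5
    by (intro mtrans_eqI[of A B])
      (auto simp: ihom_arrows A B ihom_Cmp ihom_Ide f.G.symmetric_monoidal_functor_axioms)
next
  case (6 f x y)
  then interpret f: monoidal_transformation A B f by (simp add: ihom_arrows A B)
  show ?case using 6
    by (intro mtrans_eqI[of A B])
      (auto simp: ihom_arrows A B ihom_Cmp ihom_Ide f.F.symmetric_monoidal_functor_axioms)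
next
  case (7 h z w g y f x)
  then interpret f: monoidal_transformation A B f by (simp add: ihom_arrows A B)
  interpret g: monoidal_transformation A B g using 7 by (simp add: ihom_arrows A B)
  interpret h: monoidal_transformation A B h using 7 by (simp add: ihom_arrows A B)
  show ?case using 7
    by (intro mtrans_eqI[of A B]) (auto simp: ihom_arrows A B ihom_Cmp B.assoc)
next
  case 8 show ?case by (simp add: A B const_smf_functor)
next
  case (9 x y) then show ?case by (simp add: A B box_smf_functor)
next
  case (10 f x x' g y y') then show ?case by (auto simp add: ihom_arrows ihom_TenA A B)
next
  case (11 x y)
  then interpret x: symmetric_monoidal_functor A B x by (simp add: A B)
  interpret y: symmetric_monoidal_functor A B y using 11 by (simp add: A B)
  show ?case using 11
    by (intro mtrans_eqI[of A B]) (auto simp: A B ihom_TenA ihom_Ide box_smf_functor)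
next
  case (12 f' x' x'' f x g' y' y'' g y)
  then interpret f: monoidal_transformation A B f by (simp add: ihom_arrows A B)
  interpret f': monoidal_transformation A B f' using 12 by (simp add: ihom_arrows A B)
  interpret g: monoidal_transformation A B g using 12 by (simp add: ihom_arrows A B)
  interpret g': monoidal_transformation A B g' using 12 by (simp add: ihom_arrows A B)
  show ?case using 12
    by (intro mtrans_eqI[of A B]) (auto simp: ihom_arrows A B ihom_TenA ihom_Cmp B.TenA_merge)
next
  case (13 x y z)
  then interpret x: symmetric_monoidal_functor A B x by (simp add: A B)
  interpret y: symmetric_monoidal_functor A B y using 13 by (simp add: A B)
  interpret z: symmetric_monoidal_functor A B z using 13 by (simp add: A B)
  show ?case using 13 by (intro ihom_isosI) (auto simp: A B ihom_Ass)
next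
  case (14 x)
  then interpret x: symmetric_monoidal_functor A B x by (simp add: A B)
  show ?case using 14 by (intro ihom_isosI) (auto simp: A B ihom_Rho)
next
  case (15 x)
  then interpret x: symmetric_monoidal_functor A B x by (simp add: A B)
  show ?case using 15 by (intro ihom_isosI) (auto simp: A B ihom_Lam)
next
  case (16 x y)
  then interpret x: symmetric_monoidal_functor A B x by (simp add: A B)
  interpret y: symmetric_monoidal_functor A B y using 16 by (simp add: A B)
  show ?case using 16 by (intro ihom_isosI) (auto simp: A B ihom_Sym)
next
  case (17 f x x' g y y' h z z')
  then interpret f: monoidal_transformation A B f by (simp add: ihom_arrows A B)
  interpret g: monoidal_transformation A B g using 17 by (simp add: ihom_arrows A B)
  interpret h: monoidal_transformation A B h using 17 by (simp add: ihom_arrows A B)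
  note [simp] = f.F.symmetric_monoidal_functor_axioms f.G.symmetric_monoidal_functor_axioms
    g.F.symmetric_monoidal_functor_axioms g.G.symmetric_monoidal_functor_axioms
    h.F.symmetric_monoidal_functor_axioms h.G.symmetric_monoidal_functor_axioms
  show ?case using 17
    by (intro mtrans_eqI[of A B])
      (auto simp: ihom_arrows A B ihom_TenA ihom_Cmp ihom_Ass B.natural)
next
  case (18 f x x')
  then interpret f: monoidal_transformation A B f by (simp add: ihom_arrows A B)
  note [simp] = f.F.symmetric_monoidal_functor_axioms f.G.symmetric_monoidal_functor_axioms
  show ?case using 18
    by (intro mtrans_eqI[of A B])
      (auto simp: ihom_arrows A B ihom_TenA ihom_Cmp ihom_Ide const_smf_functor ihom_Rho B.natural)
next
  case (19 f x x')
  then interpret f: monoidal_transformation A B f by (simp add: ihom_arrows A B)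
  note [simp] = f.F.symmetric_monoidal_functor_axioms f.G.symmetric_monoidal_functor_axioms
  show ?case using 19
    by (intro mtrans_eqI[of A B])
      (auto simp: ihom_arrows A B ihom_TenA ihom_Cmp ihom_Ide const_smf_functor ihom_Lam B.natural)
next
  case (20 f x x' g y y')
  then interpret f: monoidal_transformation A B f by (simp add: ihom_arrows A B)
  interpret g: monoidal_transformation A B g using 20 by (simp add: ihom_arrows A B)
  note [simp] = f.F.symmetric_monoidal_functor_axioms f.G.symmetric_monoidal_functor_axioms
    g.F.symmetric_monoidal_functor_axioms g.G.symmetric_monoidal_functor_axioms
  show ?case using 20
    by (intro mtrans_eqI[of A B])
      (auto simp: ihom_arrows A B ihom_TenA ihom_Cmp ihom_Sym B.natural)
next
  case (21 x y z w)
  then interpret x: symmetric_monoidal_functor A B x by (simp add: A B)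
  interpret y: symmetric_monoidal_functor A B y using 21 by (simp add: A B)
  interpret z: symmetric_monoidal_functor A B z using 21 by (simp add: A B)
  interpret w: symmetric_monoidal_functor A B w using 21 by (simp add: A B)
  show ?case using 21
    by (intro mtrans_eqI[of A B])
      (auto simp: A B ihom_TenA ihom_Cmp ihom_Ass ihom_Ide box_smf_functor B.pentagon)
next
  case (22 x y)
  then interpret x: symmetric_monoidal_functor A B x by (simp add: A B)
  interpret y: symmetric_monoidal_functor A B y using 22 by (simp add: A B)
  show ?case using 22
    by (intro mtrans_eqI[of A B])
      (auto simp: A B ihom_TenA ihom_Cmp ihom_Ass ihom_Rho ihom_Lam ihom_Ide box_smf_functor
        const_smf_functor B.triangle)
next
  case (23 x y z)
  then interpret x: symmetric_monoidal_functor A B x by (simp add: A B)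
  interpret y: symmetric_monoidal_functor A B y using 23 by (simp add: A B)
  interpret z: symmetric_monoidal_functor A B z using 23 by (simp add: A B)
  show ?case using 23
    by (intro mtrans_eqI[of A B])
      (auto simp: A B ihom_TenA ihom_Cmp ihom_Ass ihom_Sym ihom_Ide box_smf_functor B.hexagon)
next
  case (24 x y)
  then interpret x: symmetric_monoidal_functor A B x by (simp add: A B)
  interpret y: symmetric_monoidal_functor A B y using 24 by (simp add: A B)
  show ?case using 24
    by (intro mtrans_eqI[of A B]) (auto simp: A B ihom_Cmp ihom_Sym ihom_Ide box_smf_functor)
next
  case (25 x)
  then interpret x: symmetric_monoidal_functor A B x by (simp add: A B)
  show ?case using 25
    by (intro mtrans_eqI[of A B])
      (auto simp: A B ihom_Cmp ihom_Sym ihom_Rho ihom_Lam const_smf_functor B.Lam_Sym)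
qed

lemmas ihom_closed = box_smf_functor[OF A B] const_smf_functor[OF A B]
  ihom_Ide ihom_Cmp ihom_TenA ihom_Ass ihom_Rho ihom_Lam ihom_Sym

text \<open>\<open>interchange\<close> and \<open>box_smf\<close> in a hom contain
  \<open>inv_arrow\<close>, which is given by a description; this makes such terms computable at an
  object.\<close>

lemma at_inv_arrow_ihom:
  assumes "monoidal_transformation A B \<sigma>"
    and "\<And>x. x \<in> Ob A \<Longrightarrow> at \<sigma> x \<in> isos B (onO (NDom \<sigma>) x) (onO (NCod \<sigma>) x)" and "x \<in> Ob A"
  shows "at (inv_arrow (ihom A B) \<sigma>) x = inv_arrow B (at \<sigma> x)"
  using symmetric_monoidal_category.inv_arrow_eqI[OF ihom_symmetric_monoidal_category
      inverse_transformation(2)[OF assms(1,2)]] assms(3) by simp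

end

section \<open>The tensor product\<close>

lemma tten_simps [simp]:
  "tdom A B (tten A B p q) = WTen (tdom A B p) (tdom A B q)"
  "tcod A B (tten A B p q) = WTen (tcod A B p) (tcod A B q)"
  by (simp_all add: tten_def)

lemma tensor_simps [simp]:
  "X \<in> Ob (A \<Otimes> B) \<longleftrightarrow> word_over A B X"
  "Ten (A \<Otimes> B) = WTen" "\<one>\<^bsub>A \<Otimes> B\<^esub> = WUnit" "Ide (A \<Otimes> B) X = tclass A B (TId X)"
  "Ass (A \<Otimes> B) X Y Z = tclass A B (TAss X Y Z)"
  "Rho (A \<Otimes> B) X = tclass A B (TRho X)"
  "Lam (A \<Otimes> B) X = tclass A B (TLam X)"
  "Sym (A \<Otimes> B) X Y = tclass A B (TSym X Y)"
  by (simp_all add: tensor_def)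

lemma tcong_typing:
  "tcong A B t u \<Longrightarrow> term_over A B t \<and> term_over A B u \<and> tdom A B t = tdom A B u \<and> tcod A B t = tcod A B u"
  by (induction rule: tcong.induct) auto

lemma tclass_eqI: "tcong A B t u \<Longrightarrow> tclass A B t = tclass A B u"
  unfolding tclass_def by (auto intro: tcong.sym tcong.trans)

lemma tclass_relI:
  "trel A B t u \<Longrightarrow> term_over A B t \<Longrightarrow> term_over A B u \<Longrightarrow> tdom A B t = tdom A B u \<Longrightarrow>
    tcod A B t = tcod A B u \<Longrightarrow> tclass A B t = tclass A B u"
  by (rule tclass_eqI[OF tcong.rel])

text \<open>A chosen representative is known only up to congruence. This fact and the congruence
  rules are all that make the operations of the tensor product, which are defined through
  \<open>rep\<close>, independent of the choice.\<close>

lemma rep_tclass: "term_over A B t \<Longrightarrow> tcong A B t (rep (tclass A B t))"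
  using someI[of "\<lambda>u. u \<in> tclass A B t" t] tcong.refl[of A B t] by (simp add: rep_def tclass_def)

lemma tensor_Ar_iff: "c \<in> Ar (A \<Otimes> B) \<longleftrightarrow> (\<exists>t. term_over A B t \<and> c = tclass A B t)"
  by (auto simp: tensor_def)

lemma tclass_Ar [simp]:
  assumes "term_over A B t"
  shows "tclass A B t \<in> Ar (A \<Otimes> B)" "Dom (A \<Otimes> B) (tclass A B t) = tdom A B t"
    "Cod (A \<Otimes> B) (tclass A B t) = tcod A B t"
  using tcong_typing[OF rep_tclass[OF assms]] assms by (auto simp: tensor_def)

lemma tclass_Cmp [simp]:
  assumes "term_over A B t" "term_over A B u" "tdom A B t = tcod A B u"
  shows "tclass A B t \<cdot>\<^bsub>A \<Otimes> B\<^esub> tclass A B u = tclass A B (TComp t u)"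
  using tclass_eqI[OF tcong.Comp[OF rep_tclass[OF assms(1)] rep_tclass[OF assms(2)] assms(3)]]
  by (simp add: tensor_def)

context
  fixes A :: "('a, 'f) smcat" and B :: "('b, 'g) smcat"
  assumes A: "symmetric_monoidal_category A" and B: "symmetric_monoidal_category B"
begin

interpretation A: symmetric_monoidal_category A by (rule A)
interpretation B: symmetric_monoidal_category B by (rule B)

lemma word_over_dom_cod [simp]:
  "term_over A B t \<Longrightarrow> word_over A B (tdom A B t)" "term_over A B t \<Longrightarrow> word_over A B (tcod A B t)"
  by (induction t) auto

lemma term_over_tten [simp]: "term_over A B (tten A B p q) \<longleftrightarrow> term_over A B p \<and> term_over A B q"
  by (auto simp: tten_def)

lemma tcong_tten:
  assumes "tcong A B t t'" "tcong A B u u'"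
  shows "tcong A B (tten A B t u) (tten A B t' u')"
  using tcong_typing[OF assms(1)] tcong_typing[OF assms(2)] assms
  unfolding tten_def by (auto intro!: tcong.Comp tcong.Left tcong.Right)

lemma tclass_TenA [simp]:
  assumes "term_over A B t" "term_over A B u"
  shows "tclass A B t \<boxtimes>\<^bsub>A \<Otimes> B\<^esub> tclass A B u = tclass A B (tten A B t u)"
  using tclass_eqI[OF tcong_tten[OF rep_tclass[OF assms(1)] rep_tclass[OF assms(2)]]]
  by (simp add: tensor_def)

lemma tensor_arrowsE:
  assumes "c \<in> arrows (A \<Otimes> B) X Y"
  obtains t where "term_over A B t" "c = tclass A B t" "tdom A B t = X" "tcod A B t = Y"
    "word_over A B X" "word_over A B Y"
  using assms word_over_dom_cod by (auto simp: arrows_def tensor_Ar_iff)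

lemma tclass_arrows:
  "term_over A B t \<Longrightarrow> tdom A B t = X \<Longrightarrow> tcod A B t = Y \<Longrightarrow> tclass A B t \<in> arrows (A \<Otimes> B) X Y"
  by (simp add: arrows_def)

lemma tensor_isosI:
  assumes "term_over A B t" "term_over A B u" "tdom A B t = X" "tcod A B t = Y"
    "tdom A B u = Y" "tcod A B u = X" "trel A B (TComp t u) (TId Y)" "trel A B (TComp u t) (TId X)"
  shows "tclass A B t \<in> isos (A \<Otimes> B) X Y"
  using assms tclass_relI[OF assms(7)] tclass_relI[OF assms(8)] word_over_dom_cod[OF assms(1)]
  by (auto simp: isos_def inverse_arrows_def tclass_arrows intro!: exI[of _ "tclass A B u"])

lemma tclass_Comp_assoc:
  "term_over A B p \<Longrightarrow> term_over A B q \<Longrightarrow> term_over A B t \<Longrightarrow> tdom A B p = tcod A B q \<Longrightarrow>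
    tdom A B q = tcod A B t \<Longrightarrow>
    tclass A B (TComp (TComp p q) t) = tclass A B (TComp p (TComp q t))"
  by (rule tclass_relI[OF trel.Comp_assoc]) auto

lemma tclass_Id:
  "term_over A B p \<Longrightarrow> tcod A B p = X \<Longrightarrow> tclass A B (TComp (TId X) p) = tclass A B p"
  "term_over A B p \<Longrightarrow> tdom A B p = X \<Longrightarrow> tclass A B (TComp p (TId X)) = tclass A B p"
  using trel.Id_left[of A B p] trel.Id_right[of A B p] word_over_dom_cod[of p]
  \<comment> \<open>Classes are sets, so \<open>equalityI\<close> has to be removed:
    \<open>auto\<close> would otherwise split an equation of classes into two inclusions.\<close>
  by (auto intro!: tclass_relI del: equalityI)

text \<open>The relations are stated with one-sided tensoring, the axioms of a monoidal category
  with the two-sided one. This lemma translates between them.\<close>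

lemma tclass_tten_Id:
  assumes p: "term_over A B p" and X: "word_over A B X"
  shows "tclass A B (tten A B (TId X) p) = tclass A B (TLeft X p)"
    "tclass A B (tten A B p (TId X)) = tclass A B (TRight p X)"
proof -
  have "tclass A B (TRight (TId X) (tcod A B p)) = tclass A B (TId (WTen X (tcod A B p)))"
    "tclass A B (TLeft (tdom A B p) (TId X)) = tclass A B (TId (WTen (tdom A B p) X))"
    using p X by (auto intro!: tclass_relI trel.intros del: equalityI)
  then have "tclass A B (TRight (TId X) (tcod A B p)) \<cdot>\<^bsub>A \<Otimes> B\<^esub> tclass A B (TLeft X p) =
      tclass A B (TId (WTen X (tcod A B p))) \<cdot>\<^bsub>A \<Otimes> B\<^esub> tclass A B (TLeft X p)"
    "tclass A B (TRight p X) \<cdot>\<^bsub>A \<Otimes> B\<^esub> tclass A B (TLeft (tdom A B p) (TId X)) =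
      tclass A B (TRight p X) \<cdot>\<^bsub>A \<Otimes> B\<^esub> tclass A B (TId (WTen (tdom A B p) X))"
    by simp_all
  then show "tclass A B (tten A B (TId X) p) = tclass A B (TLeft X p)"
    "tclass A B (tten A B p (TId X)) = tclass A B (TRight p X)"
    using p X by (simp_all add: tten_def tclass_Id)
qed

text \<open>One-sided tensorings preserve composition by the relations \<open>Left_Comp\<close> and
  \<open>Right_Comp\<close>; the two inner factors then have to change places, which is the relation
  \<open>bifunctor\<close>.\<close>

lemma tclass_tten_Comp:
  assumes "term_over A B p'" "term_over A B p" "term_over A B q'" "term_over A B q"
    and "tdom A B p' = tcod A B p" "tdom A B q' = tcod A B q"
  shows "tclass A B (tten A B (TComp p' p) (TComp q' q)) =
    tclass A B (TComp (tten A B p' q') (tten A B p q))"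
proof -
  let ?c = "tclass A B" and ?R = "TRight" and ?L = "TLeft"
  \<comment> \<open>Associativity and typing of composition are needed here before the tensor
    product is known to be a category.\<close>
  have assoc: "(x \<cdot>\<^bsub>A \<Otimes> B\<^esub> y) \<cdot>\<^bsub>A \<Otimes> B\<^esub> z = x \<cdot>\<^bsub>A \<Otimes> B\<^esub> (y \<cdot>\<^bsub>A \<Otimes> B\<^esub> z)"
    if "x \<in> Ar (A \<Otimes> B)" "y \<in> Ar (A \<Otimes> B)" "z \<in> Ar (A \<Otimes> B)" "Dom (A \<Otimes> B) x = Cod (A \<Otimes> B) y"
      "Dom (A \<Otimes> B) y = Cod (A \<Otimes> B) z" for x y z
    using that tclass_Comp_assoc by (auto simp: tensor_Ar_iff)
  have cmp: "x \<cdot>\<^bsub>A \<Otimes> B\<^esub> y \<in> Ar (A \<Otimes> B)"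
      "Cod (A \<Otimes> B) (x \<cdot>\<^bsub>A \<Otimes> B\<^esub> y) = Cod (A \<Otimes> B) x"
    if "x \<in> Ar (A \<Otimes> B)" "y \<in> Ar (A \<Otimes> B)" "Dom (A \<Otimes> B) x = Cod (A \<Otimes> B) y" for x y
    using that by (auto simp: tensor_Ar_iff[of x] tensor_Ar_iff[of y])
  have 1: "?c (?R (TComp p' p) (tcod A B q')) = ?c (TComp (?R p' (tcod A B q')) (?R p (tcod A B q')))"
    "?c (?L (tdom A B p) (TComp q' q)) = ?c (TComp (?L (tdom A B p) q') (?L (tdom A B p) q))"
    using assms by (auto intro!: tclass_relI trel.intros del: equalityI)
  have 2: "?c (TComp (?R p (tcod A B q')) (?L (tdom A B p) q')) =
      ?c (TComp (?L (tcod A B p) q') (?R p (tdom A B q')))"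
    by (rule tclass_relI[OF trel.bifunctor]) (use assms in auto)
  have "?c (tten A B (TComp p' p) (TComp q' q)) =
      ?c (?R (TComp p' p) (tcod A B q')) \<cdot>\<^bsub>A \<Otimes> B\<^esub> ?c (?L (tdom A B p) (TComp q' q))"
    using assms by (simp add: tten_def)
  also have "\<dots> = ?c (TComp (?R p' (tcod A B q')) (?R p (tcod A B q'))) \<cdot>\<^bsub>A \<Otimes> B\<^esub>
      ?c (TComp (?L (tdom A B p) q') (?L (tdom A B p) q))"
    by (simp only: 1)
  also have "\<dots> = ?c (?R p' (tcod A B q')) \<cdot>\<^bsub>A \<Otimes> B\<^esub> (?c (TComp (?R p (tcod A B q')) (?L (tdom A B p) q')) \<cdot>\<^bsub>A \<Otimes> B\<^esub>
      ?c (?L (tdom A B p) q))"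
    using assms by (simp add: assoc cmp flip: tclass_Cmp)
  also have "\<dots> = ?c (TComp (tten A B p' q') (tten A B p q))"
    unfolding 2 using assms by (simp add: tten_def assoc cmp flip: tclass_Cmp)
  finally show ?thesis .
qed

text \<open>Most axioms are one generating relation each, once tensoring with an identity is
  rewritten as one-sided tensoring. The formal inverses supply the inverses of the structure arrows,
  and \<open>TSym\<close> with its arguments exchanged is its own.\<close>

lemma tensor_symmetric_monoidal_category: "symmetric_monoidal_category (A \<Otimes> B)"
proof (unfold_locales, goal_cases)
  case (1 f) then show ?case by (auto simp: tensor_Ar_iff)
next
  case (2 f) then show ?case by (auto simp: tensor_Ar_iff)
next
  case (3 x) then show ?case by (simp add: tclass_arrows)
next
  case (4 g y z f x) then show ?case by (auto elim!: tensor_arrowsE intro!: tclass_arrows)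
next
  case (5 f x y) then show ?case by (auto elim!: tensor_arrowsE simp: tclass_Id del: equalityI)
next
  case (6 f x y) then show ?case by (auto elim!: tensor_arrowsE simp: tclass_Id del: equalityI)
next
  case (7 h z w g y f x) then show ?case by (auto elim!: tensor_arrowsE simp: tclass_Comp_assoc del: equalityI)
next
  case 8 show ?case by simp
next
  case 9 then show ?case by simp
next
  case (10 f x x' g y y') then show ?case by (auto elim!: tensor_arrowsE intro!: tclass_arrows)
next
  case (11 x y) then show ?case by (auto simp: tclass_tten_Id intro!: tclass_relI trel.intros del: equalityI)
next
  case (12 f' x' x'' f x g' y' y'' g y)
  then show ?case by (auto elim!: tensor_arrowsE simp: tclass_tten_Comp del: equalityI)
next
  case (13 x y z)
  then show ?case by (auto intro!: tensor_isosI[where u = "TAssInv x y z"] trel.intros)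
next
  case (14 x)
  then show ?case by (auto intro!: tensor_isosI[where u = "TRhoInv x"] trel.intros)
next
  case (15 x)
  then show ?case by (auto intro!: tensor_isosI[where u = "TLamInv x"] trel.intros)
next
  case (16 x y)
  then show ?case by (auto intro!: tensor_isosI[where u = "TSym y x"] trel.intros)
next
  case (17 f x x' g y y' h z z')
  then show ?case by (auto elim!: tensor_arrowsE intro!: tclass_relI trel.intros del: equalityI)
next
  case (18 f x x')
  then show ?case
    by (auto elim!: tensor_arrowsE simp: tclass_tten_Id simp flip: tclass_Cmp del: equalityI)
      (auto intro!: tclass_relI trel.intros del: equalityI)
next
  case (19 f x x')
  then show ?case
    by (auto elim!: tensor_arrowsE simp: tclass_tten_Id simp flip: tclass_Cmp del: equalityI)
      (auto intro!: tclass_relI trel.intros del: equalityI)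
next
  case (20 f x x' g y y')
  then show ?case by (auto elim!: tensor_arrowsE intro!: tclass_relI trel.intros del: equalityI)
next
  case (21 x y z w)
  then show ?case
    by (simp add: tclass_tten_Id flip: tclass_Cmp)
      (auto simp: tclass_Comp_assoc intro!: tclass_relI trel.intros del: equalityI)
next
  case (22 x y)
  then show ?case
    by (auto simp: tclass_tten_Id simp flip: tclass_Cmp del: equalityI) (auto intro!: tclass_relI trel.intros del: equalityI)
next
  case (23 x y z)
  then show ?case
    by (simp add: tclass_tten_Id flip: tclass_Cmp)
      (auto simp: tclass_Comp_assoc intro!: tclass_relI trel.intros del: equalityI)
next
  case (24 x y)
  then show ?case by (auto intro!: tclass_relI trel.intros del: equalityI)
next
  case (25 x)
  then show ?case by (auto intro!: tclass_relI trel.intros del: equalityI)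
qed

end

lemma eta_ob_proj [simp]:
  "Src (eta_ob A B a) = B" "Tgt (eta_ob A B a) = A \<Otimes> B"
  "b \<in> Ob B \<Longrightarrow> onO (eta_ob A B a) b = WGen a b"
  "g \<in> Ar B \<Longrightarrow> onA (eta_ob A B a) g = tclass A B (TArrB a g)"
  "lax0 (eta_ob A B a) = tclass A B (TBeta a)"
  "b \<in> Ob B \<Longrightarrow> b' \<in> Ob B \<Longrightarrow> lax2 (eta_ob A B a) b b' = tclass A B (TDelta a b b')"
  by (simp_all add: eta_ob_def)

lemma eta_proj [simp]:
  "a \<in> Ob A \<Longrightarrow> onO (eta A B) a = eta_ob A B a"
  "f \<in> Ar A \<Longrightarrow> NDom (onA (eta A B) f) = eta_ob A B (Dom A f)"
  "f \<in> Ar A \<Longrightarrow> NCod (onA (eta A B) f) = eta_ob A B (Cod A f)"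
  "f \<in> Ar A \<Longrightarrow> b \<in> Ob B \<Longrightarrow> at (onA (eta A B) f) b = tclass A B (TArrA f b)"
  "f \<in> Ar A \<Longrightarrow> at (onA (eta A B) f) \<in> extensional (Ob B)"
  "NDom (lax0 (eta A B)) = const_smf B (A \<Otimes> B)" "NCod (lax0 (eta A B)) = eta_ob A B \<one>\<^bsub>A\<^esub>"
  "b \<in> Ob B \<Longrightarrow> at (lax0 (eta A B)) b = tclass A B (TAlpha b)"
  "at (lax0 (eta A B)) \<in> extensional (Ob B)"
  "a \<in> Ob A \<Longrightarrow> a' \<in> Ob A \<Longrightarrow>
    NDom (lax2 (eta A B) a a') = box_smf B (A \<Otimes> B) (eta_ob A B a) (eta_ob A B a')"
  "a \<in> Ob A \<Longrightarrow> a' \<in> Ob A \<Longrightarrow> NCod (lax2 (eta A B) a a') = eta_ob A B (a \<otimes>\<^bsub>A\<^esub> a')"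
  "a \<in> Ob A \<Longrightarrow> a' \<in> Ob A \<Longrightarrow> b \<in> Ob B \<Longrightarrow> at (lax2 (eta A B) a a') b = tclass A B (TGamma a a' b)"
  "a \<in> Ob A \<Longrightarrow> a' \<in> Ob A \<Longrightarrow> at (lax2 (eta A B) a a') \<in> extensional (Ob B)"
  by (simp_all add: eta_def)

lemma eta_extensional [simp]:
  "Src (eta A B) = A" "Tgt (eta A B) = ihom B (A \<Otimes> B)" "onO (eta A B) \<in> extensional (Ob A)"
  "onA (eta A B) \<in> extensional (Ar A)" "lax2 (eta A B) \<in> extensional (Ob A)"
  "a \<in> Ob A \<Longrightarrow> lax2 (eta A B) a \<in> extensional (Ob A)"
  by (simp_all add: eta_def)

section \<open>The universal functor \<open>eta\<close> into the hom\<close>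

context
  fixes A :: "('a, 'f) smcat" and B :: "('b, 'g) smcat"
  assumes A: "symmetric_monoidal_category A" and B: "symmetric_monoidal_category B"
begin

interpretation A: symmetric_monoidal_category A by (rule A)
interpretation B: symmetric_monoidal_category B by (rule B)
interpretation T: symmetric_monoidal_category "A \<Otimes> B"
  by (rule tensor_symmetric_monoidal_category[OF A B])

lemmas [simp] = word_over_dom_cod[OF A B] term_over_tten[OF A B] tclass_TenA[OF A B]
lemmas tclass_tten_Id' = tclass_tten_Id[OF A B]

lemma inv_tclass:
  assumes "word_over A B X"
  shows "word_over A B Y \<Longrightarrow> word_over A B Z \<Longrightarrow>
      inv_arrow (A \<Otimes> B) (tclass A B (TAss X Y Z)) = tclass A B (TAssInv X Y Z)"
    "inv_arrow (A \<Otimes> B) (tclass A B (TRho X)) = tclass A B (TRhoInv X)"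
    "inv_arrow (A \<Otimes> B) (tclass A B (TLam X)) = tclass A B (TLamInv X)"
  using assms
  by (auto intro!: T.inv_arrow_eqI T.inverse_arrowsI tclass_relI trel.intros del: equalityI)

lemma tinterchange_typing [simp]:
  "tdom A B (tinterchange P Q R S) = WTen (WTen P Q) (WTen R S)"
  "tcod A B (tinterchange P Q R S) = WTen (WTen P R) (WTen Q S)"
  "term_over A B (tinterchange P Q R S) \<longleftrightarrow>
    word_over A B P \<and> word_over A B Q \<and> word_over A B R \<and> word_over A B S"
  by (auto simp: tinterchange_def)

lemma tclass_Left:
  "term_over A B p \<Longrightarrow> word_over A B X \<Longrightarrow> tclass A B (TLeft X p) = tclass A B (TId X) \<boxtimes>\<^bsub>A \<Otimes> B\<^esub> tclass A B p"
  by (simp add: tclass_tten_Id')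

lemma tclass_Right:
  "term_over A B p \<Longrightarrow> word_over A B X \<Longrightarrow> tclass A B (TRight p X) = tclass A B p \<boxtimes>\<^bsub>A \<Otimes> B\<^esub> tclass A B (TId X)"
  by (simp add: tclass_tten_Id')

text \<open>Identifies the formal arrow in the relation \<open>Gamma_Delta\<close> with the
  interchange that occurs in \<open>box_smf\<close>.\<close>

lemma interchange_tensor:
  assumes "word_over A B P" "word_over A B Q" "word_over A B R" "word_over A B S"
  shows "interchange (A \<Otimes> B) P Q R S = tclass A B (tinterchange P Q R S)"
  using assms
  by (simp add: interchange_def tinterchange_def inv_tclass tclass_Left tclass_Right T.assoc
      flip: tclass_Cmp del: tclass_TenA)

lemma eta_ob_functor:
  assumes [simp]: "a \<in> Ob A"
  shows "symmetric_monoidal_functor B (A \<Otimes> B) (eta_ob A B a)"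
proof (rule symmetric_monoidal_functorI[OF B T.symmetric_monoidal_category_axioms], goal_cases)
  case (7 x) then show ?case by simp (rule tclass_relI[OF trel.ArrB_Id]; simp)
next
  case (8 g f) then show ?case by simp (rule tclass_relI[OF trel.ArrB_Comp]; simp)
next
  case (13 f g) then show ?case by simp (rule tclass_relI[OF trel.Delta_natural]; simp)
next
  case (14 x y z) then show ?case
    by (simp add: tclass_tten_Id' flip: tclass_Cmp) (simp, rule tclass_relI[OF trel.Delta_Ass], simp_all)
next
  case (15 x) then show ?case
    by (simp add: tclass_tten_Id' flip: tclass_Cmp) (simp, rule tclass_relI[OF trel.Delta_Rho], simp_all)
next
  case (16 x) then show ?case
    by (simp add: tclass_tten_Id' flip: tclass_Cmp) (simp, rule tclass_relI[OF trel.Delta_Lam], simp_all)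
next
  case (17 x y) then show ?case by simp (rule tclass_relI[OF trel.Delta_Sym]; simp)
qed (simp_all add: eta_ob_def)

lemma eta_onA_transformation:
  assumes [simp]: "f \<in> Ar A"
  shows "monoidal_transformation B (A \<Otimes> B) (onA (eta A B) f)"
proof (rule monoidal_transformationI, goal_cases)
  case (5 g) then show ?case by simp (rule tclass_relI[OF trel.ArrA_ArrB]; simp)
next
  case 6 show ?case by simp (rule tclass_relI[OF trel.ArrA_Beta]; simp)
next
  case (7 x y) then show ?case by simp (rule tclass_relI[OF trel.ArrA_Delta]; simp)
qed (simp_all add: eta_ob_functor)

lemma eta_lax0_transformation: "monoidal_transformation B (A \<Otimes> B) (lax0 (eta A B))"
proof (rule monoidal_transformationI, goal_cases)
  case (5 g)
  have "tclass A B (TComp (TArrB \<one>\<^bsub>A\<^esub> g) (TAlpha (Dom B g))) = tclass A B (TAlpha (Cod B g))"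
    using 5 by (intro tclass_relI[OF trel.ArrB_Alpha]) simp_all
  then show ?case using 5 T.Ide_cancel(2)[of "tclass A B (TAlpha (Cod B g))"] by simp
next
  case 6
  have "tclass A B (TBeta \<one>\<^bsub>A\<^esub>) = tclass A B (TAlpha \<one>\<^bsub>B\<^esub>)"
    by (rule tclass_relI[OF trel.Beta_Alpha]) simp_all
  then show ?case using T.Ide_cancel(2)[of "tclass A B (TAlpha \<one>\<^bsub>B\<^esub>)"] by simp
next
  case (7 x y) then show ?case by simp (rule tclass_relI[OF trel.Alpha_Delta]; simp)
qed (simp_all add: eta_ob_functor const_smf_functor B T.symmetric_monoidal_category_axioms)

text \<open>The relations \<open>Beta_Gamma\<close> and \<open>Gamma_Delta\<close> have the unitor
  and the interchange on the opposite side from the conditions on a transformation out of a product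
  of functors. Cases 6 and 7 carry them across by composing with inverses.\<close>

lemma eta_lax2_transformation:
  assumes [simp]: "a \<in> Ob A" "a' \<in> Ob A"
  shows "monoidal_transformation B (A \<Otimes> B) (lax2 (eta A B) a a')"
proof (rule monoidal_transformationI, goal_cases)
  case (5 g) then show ?case by simp (rule tclass_relI[OF trel.ArrB_Gamma, symmetric]; simp)
next
  case 6
  have *: "tclass A B (TComp (TBeta (a \<otimes>\<^bsub>A\<^esub> a')) (TRho WUnit)) =
      tclass A B (TComp (TGamma a a' \<one>\<^bsub>B\<^esub>) (tten A B (TBeta a) (TBeta a')))"
    by (rule tclass_relI[OF trel.Beta_Gamma]) simp_all
  have r: "tclass A B (TRho WUnit) \<cdot>\<^bsub>A \<Otimes> B\<^esub> tclass A B (TRhoInv WUnit) = tclass A B (TId WUnit)"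
    by simp (rule tclass_relI[OF trel.Rho_RhoInv]; simp)
  have "tclass A B (TBeta (a \<otimes>\<^bsub>A\<^esub> a')) =
      (tclass A B (TBeta (a \<otimes>\<^bsub>A\<^esub> a')) \<cdot>\<^bsub>A \<Otimes> B\<^esub> tclass A B (TRho WUnit)) \<cdot>\<^bsub>A \<Otimes> B\<^esub>
       tclass A B (TRhoInv WUnit)"
    using T.Ide_cancel(2)[of "tclass A B (TBeta (a \<otimes>\<^bsub>A\<^esub> a'))" WUnit]
    by (simp add: T.assoc r del: tclass_Cmp)
  also have "\<dots> = (tclass A B (TGamma a a' \<one>\<^bsub>B\<^esub>) \<cdot>\<^bsub>A \<Otimes> B\<^esub>
      (tclass A B (TBeta a) \<boxtimes>\<^bsub>A \<Otimes> B\<^esub> tclass A B (TBeta a'))) \<cdot>\<^bsub>A \<Otimes> B\<^esub>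
       tclass A B (TRhoInv WUnit)"
    using * by simp
  finally show ?case by (simp add: T.assoc inv_tclass del: tclass_Cmp tclass_TenA)
next
  case (7 b b')
  let ?i = "interchange (A \<Otimes> B)"
  have *: "tclass A B (TGamma a a' (b \<otimes>\<^bsub>B\<^esub> b')) \<cdot>\<^bsub>A \<Otimes> B\<^esub>
      (tclass A B (TDelta a b b') \<boxtimes>\<^bsub>A \<Otimes> B\<^esub> tclass A B (TDelta a' b b')) =
    tclass A B (TDelta (a \<otimes>\<^bsub>A\<^esub> a') b b') \<cdot>\<^bsub>A \<Otimes> B\<^esub>
      ((tclass A B (TGamma a a' b) \<boxtimes>\<^bsub>A \<Otimes> B\<^esub> tclass A B (TGamma a a' b')) \<cdot>\<^bsub>A \<Otimes> B\<^esub>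
       ?i (WGen a b) (WGen a b') (WGen a' b) (WGen a' b'))"
    using 7 by (simp add: interchange_tensor) (rule tclass_relI[OF trel.Gamma_Delta]; simp)
  have "tclass A B (TGamma a a' (b \<otimes>\<^bsub>B\<^esub> b')) \<cdot>\<^bsub>A \<Otimes> B\<^esub>
      ((tclass A B (TDelta a b b') \<boxtimes>\<^bsub>A \<Otimes> B\<^esub> tclass A B (TDelta a' b b')) \<cdot>\<^bsub>A \<Otimes> B\<^esub>
       ?i (WGen a b) (WGen a' b) (WGen a b') (WGen a' b')) =
    tclass A B (TDelta (a \<otimes>\<^bsub>A\<^esub> a') b b') \<cdot>\<^bsub>A \<Otimes> B\<^esub>
      (tclass A B (TGamma a a' b) \<boxtimes>\<^bsub>A \<Otimes> B\<^esub> tclass A B (TGamma a a' b'))"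
    using 7 arg_cong[OF *, of "\<lambda>k. k \<cdot>\<^bsub>A \<Otimes> B\<^esub> ?i (WGen a b) (WGen a' b) (WGen a b') (WGen a' b')"]
      T.Ide_cancel(2)[of "tclass A B (TGamma a a' b) \<boxtimes>\<^bsub>A \<Otimes> B\<^esub> tclass A B (TGamma a a' b')"]
    by (simp add: T.assoc del: tclass_Cmp tclass_TenA)
  then show ?case using 7 by simp
qed (simp_all add: eta_ob_functor box_smf_functor B T.symmetric_monoidal_category_axioms)

text \<open>Equality of transformations is tested at each object of \<open>B\<close>, where the
  functor laws become the generating relations for \<open>- \<otimes> b\<close>.\<close>

lemma eta_functor: "symmetric_monoidal_functor A (ihom B (A \<Otimes> B)) (eta A B)"
proof -
  note T = T.symmetric_monoidal_category_axioms
  note H = ihom_symmetric_monoidal_category[OF B T]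
  interpret H: symmetric_monoidal_category "ihom B (A \<Otimes> B)" by (rule H)
  note [simp] = eta_ob_functor eta_onA_transformation eta_lax0_transformation eta_lax2_transformation
    ihom_simps[OF B T] ihom_closed[OF B T]
  show ?thesis
  proof (rule symmetric_monoidal_functorI[OF A H], goal_cases)
    case (7 x)
    then show ?case
      by (intro mtrans_eqI[of B "A \<Otimes> B"]) (simp_all, rule tclass_relI[OF trel.ArrA_Id], simp_all)
  next
    case (8 g f)
    then show ?case
      by (intro mtrans_eqI[of B "A \<Otimes> B"]) (simp_all, rule tclass_relI[OF trel.ArrA_Comp], simp_all)
  next
    case (13 f g)
    then show ?case
      by (intro mtrans_eqI[of B "A \<Otimes> B"]) (simp_all, rule tclass_relI[OF trel.Gamma_natural], simp_all)
  next
    case (14 x y z)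
    then show ?case
      by (intro mtrans_eqI[of B "A \<Otimes> B"])
        (simp_all add: tclass_tten_Id' flip: tclass_Cmp, simp, rule tclass_relI[OF trel.Gamma_Ass], simp_all)
  next
    case (15 x)
    then show ?case
      by (intro mtrans_eqI[of B "A \<Otimes> B"])
        (simp_all add: tclass_tten_Id' flip: tclass_Cmp, simp, rule tclass_relI[OF trel.Gamma_Rho], simp_all)
  next
    case (16 x)
    then show ?case
      by (intro mtrans_eqI[of B "A \<Otimes> B"])
        (simp_all add: tclass_tten_Id' flip: tclass_Cmp, simp, rule tclass_relI[OF trel.Gamma_Lam], simp_all)
  next
    case (17 x y)
    then show ?case
      by (intro mtrans_eqI[of B "A \<Otimes> B"]) (simp_all, rule tclass_relI[OF trel.Gamma_Sym], simp_all)
  qed simp_all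
qed

end

section \<open>Composition and curried functors\<close>

lemma smf_comp_proj [simp]:
  "Src (G \<circ>\<^sub>1 F) = Src F" "Tgt (G \<circ>\<^sub>1 F) = Tgt G"
  "x \<in> Ob (Src F) \<Longrightarrow> onO (G \<circ>\<^sub>1 F) x = onO G (onO F x)"
  "f \<in> Ar (Src F) \<Longrightarrow> onA (G \<circ>\<^sub>1 F) f = onA G (onA F f)"
  "lax0 (G \<circ>\<^sub>1 F) = onA G (lax0 F) \<cdot>\<^bsub>Tgt G\<^esub> lax0 G"
  "x \<in> Ob (Src F) \<Longrightarrow> y \<in> Ob (Src F) \<Longrightarrow>
    lax2 (G \<circ>\<^sub>1 F) x y = onA G (lax2 F x y) \<cdot>\<^bsub>Tgt G\<^esub> lax2 G (onO F x) (onO F y)"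
  by (simp_all add: smf_comp_def)

lemma smf_comp_functor:
  fixes C :: "('q, 'k) smcat" (structure)
  assumes "symmetric_monoidal_functor B C G" "symmetric_monoidal_functor A B F"
  shows "symmetric_monoidal_functor A C (G \<circ>\<^sub>1 F)"
proof -
  interpret G: symmetric_monoidal_functor B C G by fact
  interpret F: symmetric_monoidal_functor A B F by fact
  note [simp] = F.Src F.Tgt G.Src G.Tgt
  show ?thesis
  proof (rule symmetric_monoidal_functorI[OF F.A.symmetric_monoidal_category_axioms
        G.B.symmetric_monoidal_category_axioms], goal_cases)
    case (8 g f) then show ?case by (simp add: F.preserves_Cmp G.preserves_Cmp)
  next
    case (13 f g)
    have "onA G (lax2 F (Cod A f) (Cod A g)) \<cdot> (lax2 G (onO F (Cod A f)) (onO F (Cod A g)) \<cdot>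
        (onA G (onA F f) \<boxtimes> onA G (onA F g))) =
      onA G (lax2 F (Cod A f) (Cod A g) \<cdot>\<^bsub>B\<^esub> (onA F f \<boxtimes>\<^bsub>B\<^esub> onA F g)) \<cdot>
        lax2 G (onO F (Dom A f)) (onO F (Dom A g))"
      using 13 by (simp add: G.lax2_nat G.preserves_Cmp G.B.assoc)
    then show ?case
      using 13 by (simp add: F.lax2_nat G.preserves_Cmp G.B.assoc)
  next
    case (14 x y z)
    let ?x = "onO F x" and ?y = "onO F y" and ?z = "onO F z"
    have "onA G (lax2 F (x \<otimes>\<^bsub>A\<^esub> y) z) \<cdot> (lax2 G (onO F (x \<otimes>\<^bsub>A\<^esub> y)) ?z \<cdot>
        ((onA G (lax2 F x y) \<boxtimes> onA G (Ide B ?z)) \<cdot> ((lax2 G ?x ?y \<boxtimes> Ide C (onO G ?z)) \<cdot>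
          Ass C (onO G ?x) (onO G ?y) (onO G ?z)))) =
      onA G (lax2 F (x \<otimes>\<^bsub>A\<^esub> y) z) \<cdot> (onA G (lax2 F x y \<boxtimes>\<^bsub>B\<^esub> Ide B ?z) \<cdot>
        (lax2 G (?x \<otimes>\<^bsub>B\<^esub> ?y) ?z \<cdot> ((lax2 G ?x ?y \<boxtimes> Ide C (onO G ?z)) \<cdot>
          Ass C (onO G ?x) (onO G ?y) (onO G ?z))))"
      \<comment> \<open>The identity is kept as an image under \<open>G\<close> so that naturality
        of \<open>lax2 G\<close> matches the product of two images.\<close>
      using 14 by (simp add: G.lax2_nat[THEN G.B.Cmp_reduce] G.B.assoc del: G.preserves_Ide)
    also have "\<dots> = onA G (lax2 F (x \<otimes>\<^bsub>A\<^esub> y) z \<cdot>\<^bsub>B\<^esub> ((lax2 F x y \<boxtimes>\<^bsub>B\<^esub> Ide B ?z) \<cdot>\<^bsub>B\<^esub> Ass B ?x ?y ?z)) \<cdot>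
        (lax2 G ?x (?y \<otimes>\<^bsub>B\<^esub> ?z) \<cdot> (Ide C (onO G ?x) \<boxtimes> lax2 G ?y ?z))"
      using 14 by (simp add: G.lax_assoc' G.preserves_Cmp G.B.assoc)
    also have "\<dots> = onA G (onA F (Ass A x y z)) \<cdot> (onA G (lax2 F x (y \<otimes>\<^bsub>A\<^esub> z)) \<cdot>
       (onA G (Ide B ?x \<boxtimes>\<^bsub>B\<^esub> lax2 F y z) \<cdot>
        (lax2 G ?x (?y \<otimes>\<^bsub>B\<^esub> ?z) \<cdot> (Ide C (onO G ?x) \<boxtimes> lax2 G ?y ?z))))"
      using 14 by (simp add: F.lax_assoc' G.preserves_Cmp G.B.assoc)
    also have "\<dots> = onA G (onA F (Ass A x y z)) \<cdot> (onA G (lax2 F x (y \<otimes>\<^bsub>A\<^esub> z)) \<cdot>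
       (lax2 G ?x (onO F (y \<otimes>\<^bsub>A\<^esub> z)) \<cdot> ((onA G (Ide B ?x) \<boxtimes> onA G (lax2 F y z)) \<cdot>
         (Ide C (onO G ?x) \<boxtimes> lax2 G ?y ?z))))"
      using 14 by (simp add: G.lax2_nat[THEN G.B.Cmp_reduce] G.B.assoc del: G.preserves_Ide)
    finally show ?case using 14 by (simp add: G.B.assoc G.B.TenA_merge G.B.TenA_merge_assoc)
  next
    case (15 x)
    let ?x = "onO F x"
    have "onA G (onA F (Rho A x)) \<cdot> (onA G (lax2 F x \<one>\<^bsub>A\<^esub>) \<cdot> (lax2 G ?x (onO F \<one>\<^bsub>A\<^esub>) \<cdot>
       ((onA G (Ide B ?x) \<boxtimes> onA G (lax0 F)) \<cdot> (Ide C (onO G ?x) \<boxtimes> lax0 G)))) =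
      onA G (onA F (Rho A x) \<cdot>\<^bsub>B\<^esub> (lax2 F x \<one>\<^bsub>A\<^esub> \<cdot>\<^bsub>B\<^esub> (Ide B ?x \<boxtimes>\<^bsub>B\<^esub> lax0 F))) \<cdot>
        (lax2 G ?x \<one>\<^bsub>B\<^esub> \<cdot> (Ide C (onO G ?x) \<boxtimes> lax0 G))"
      using 15 by (simp add: G.lax2_nat[THEN G.B.Cmp_reduce] G.preserves_Cmp G.B.assoc del: G.preserves_Ide)
    also have "\<dots> = Rho C (onO G ?x)" using 15 by (simp add: F.lax_Rho' G.lax_Rho')
    finally show ?case using 15 by (simp add: G.B.assoc G.B.TenA_merge)
  next
    case (16 x)
    let ?x = "onO F x"
    have "onA G (onA F (Lam A x)) \<cdot> (onA G (lax2 F \<one>\<^bsub>A\<^esub> x) \<cdot> (lax2 G (onO F \<one>\<^bsub>A\<^esub>) ?x \<cdot>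
       ((onA G (lax0 F) \<boxtimes> onA G (Ide B ?x)) \<cdot> (lax0 G \<boxtimes> Ide C (onO G ?x))))) =
      onA G (onA F (Lam A x) \<cdot>\<^bsub>B\<^esub> (lax2 F \<one>\<^bsub>A\<^esub> x \<cdot>\<^bsub>B\<^esub> (lax0 F \<boxtimes>\<^bsub>B\<^esub> Ide B ?x))) \<cdot>
        (lax2 G \<one>\<^bsub>B\<^esub> ?x \<cdot> (lax0 G \<boxtimes> Ide C (onO G ?x)))"
      using 16 by (simp add: G.lax2_nat[THEN G.B.Cmp_reduce] G.preserves_Cmp G.B.assoc del: G.preserves_Ide)
    also have "\<dots> = Lam C (onO G ?x)" using 16 by (simp add: F.lax_Lam' G.lax_Lam')
    finally show ?case using 16 by (simp add: G.B.assoc G.B.TenA_merge)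
  next
    case (17 x y)
    have "onA G (onA F (Sym A x y) \<cdot>\<^bsub>B\<^esub> lax2 F x y) \<cdot> lax2 G (onO F x) (onO F y) =
      onA G (lax2 F y x \<cdot>\<^bsub>B\<^esub> Sym B (onO F x) (onO F y)) \<cdot> lax2 G (onO F x) (onO F y)"
      using 17 by (simp add: F.lax_Sym)
    then show ?case using 17 by (simp add: G.preserves_Cmp G.B.assoc G.lax_Sym)
  qed (simp_all add: smf_comp_def)
qed

lemma strict_smf_proj [simp]:
  "Src (strict_smf A B fO fA) = A" "Tgt (strict_smf A B fO fA) = B"
  "x \<in> Ob A \<Longrightarrow> onO (strict_smf A B fO fA) x = fO x"
  "f \<in> Ar A \<Longrightarrow> onA (strict_smf A B fO fA) f = fA f"
  "lax0 (strict_smf A B fO fA) = Ide B \<one>\<^bsub>B\<^esub>"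
  "x \<in> Ob A \<Longrightarrow> y \<in> Ob A \<Longrightarrow> lax2 (strict_smf A B fO fA) x y = Ide B (fO x \<otimes>\<^bsub>B\<^esub> fO y)"
  by (simp_all add: strict_smf_def)

lemma strict_smf_functor:
  assumes A: "symmetric_monoidal_category A" and B: "symmetric_monoidal_category B"
    and [simp]: "\<And>x. x \<in> Ob A \<Longrightarrow> fO x \<in> Ob B"
      "\<And>f. f \<in> Ar A \<Longrightarrow> fA f \<in> Ar B" "\<And>f. f \<in> Ar A \<Longrightarrow> Dom B (fA f) = fO (Dom A f)"
      "\<And>f. f \<in> Ar A \<Longrightarrow> Cod B (fA f) = fO (Cod A f)"
      "\<And>x. x \<in> Ob A \<Longrightarrow> fA (Ide A x) = Ide B (fO x)"
      "\<And>g f. g \<in> Ar A \<Longrightarrow> f \<in> Ar A \<Longrightarrow> Dom A g = Cod A f \<Longrightarrow> fA (g \<cdot>\<^bsub>A\<^esub> f) = fA g \<cdot>\<^bsub>B\<^esub> fA f"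
      "fO \<one>\<^bsub>A\<^esub> = \<one>\<^bsub>B\<^esub>" "\<And>x y. x \<in> Ob A \<Longrightarrow> y \<in> Ob A \<Longrightarrow> fO (x \<otimes>\<^bsub>A\<^esub> y) = fO x \<otimes>\<^bsub>B\<^esub> fO y"
      "\<And>f g. f \<in> Ar A \<Longrightarrow> g \<in> Ar A \<Longrightarrow> fA (f \<boxtimes>\<^bsub>A\<^esub> g) = fA f \<boxtimes>\<^bsub>B\<^esub> fA g"
      "\<And>x y z. x \<in> Ob A \<Longrightarrow> y \<in> Ob A \<Longrightarrow> z \<in> Ob A \<Longrightarrow> fA (Ass A x y z) = Ass B (fO x) (fO y) (fO z)"
      "\<And>x. x \<in> Ob A \<Longrightarrow> fA (Rho A x) = Rho B (fO x)"
      "\<And>x. x \<in> Ob A \<Longrightarrow> fA (Lam A x) = Lam B (fO x)"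
      "\<And>x y. x \<in> Ob A \<Longrightarrow> y \<in> Ob A \<Longrightarrow> fA (Sym A x y) = Sym B (fO x) (fO y)"
  shows "symmetric_monoidal_functor A B (strict_smf A B fO fA)"
proof -
  interpret A: symmetric_monoidal_category A by fact
  interpret B: symmetric_monoidal_category B by fact
  show ?thesis
    by (rule symmetric_monoidal_functorI[OF A B]) (simp_all add: strict_smf_def)
qed

section \<open>Functors into a hom, unpacked into equations in its codomain\<close>

locale curried_functor =
  A: symmetric_monoidal_category A + B: symmetric_monoidal_category B +
  C: symmetric_monoidal_category C + F: symmetric_monoidal_functor A "ihom B C" F
  for A :: "('a, 'f) smcat" and B :: "('b, 'g) smcat" and C :: "('q, 'k) smcat" (structure)
    and F :: "('a, 'f, ('b, 'g, 'q, 'k) smfun, ('b, 'g, 'q, 'k) mtrans) smfun"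
begin

lemmas ihom_simps' [simp] =
  ihom_simps[OF B.symmetric_monoidal_category_axioms C.symmetric_monoidal_category_axioms]

lemma value_functor [simp]: "a \<in> Ob A \<Longrightarrow> symmetric_monoidal_functor B C (onO F a)"
  using F.onO_typing[of a] by (simp del: F.onO_typing)

lemma transformations [simp]:
  "f \<in> Ar A \<Longrightarrow> monoidal_transformation B C (onA F f)"
  "monoidal_transformation B C (lax0 F)"
  "a \<in> Ob A \<Longrightarrow> a' \<in> Ob A \<Longrightarrow> monoidal_transformation B C (lax2 F a a')"
  using F.onA_typing(1)[of f] F.lax_typing(1) F.lax_typing(4)[of a a']
  by (simp_all del: F.onA_typing F.lax_typing)

lemma transformation_ends [simp]:
  "f \<in> Ar A \<Longrightarrow> NDom (onA F f) = onO F (Dom A f)" "f \<in> Ar A \<Longrightarrow> NCod (onA F f) = onO F (Cod A f)"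
  "NDom (lax0 F) = const_smf B C" "NCod (lax0 F) = onO F \<one>\<^bsub>A\<^esub>"
  "a \<in> Ob A \<Longrightarrow> a' \<in> Ob A \<Longrightarrow> NDom (lax2 F a a') = box_smf B C (onO F a) (onO F a')"
  "a \<in> Ob A \<Longrightarrow> a' \<in> Ob A \<Longrightarrow> NCod (lax2 F a a') = onO F (a \<otimes>\<^bsub>A\<^esub> a')"
  using F.onA_typing(2,3)[of f] F.lax_typing(2,3) F.lax_typing(5,6)[of a a']
  by (simp_all del: F.onA_typing F.lax_typing)

lemmas value_typing [simp] =
  symmetric_monoidal_functor.onO_typing[OF value_functor]
  symmetric_monoidal_functor.onA_typing[OF value_functor]
  symmetric_monoidal_functor.lax_typing[OF value_functor]
  symmetric_monoidal_functor.preserves_Ide[OF value_functor]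

lemmas value_laws =
  symmetric_monoidal_functor.preserves_Cmp[OF value_functor]
  symmetric_monoidal_functor.lax2_nat[OF value_functor]
  symmetric_monoidal_functor.lax_assoc'[OF value_functor]
  symmetric_monoidal_functor.lax_Rho'[OF value_functor]
  symmetric_monoidal_functor.lax_Lam'[OF value_functor]
  symmetric_monoidal_functor.lax_Sym[OF value_functor]

lemma component_typing [simp]:
  assumes "b \<in> Ob B"
  shows "f \<in> Ar A \<Longrightarrow> at (onA F f) b \<in> Ar C"
    "f \<in> Ar A \<Longrightarrow> Dom C (at (onA F f) b) = onO (onO F (Dom A f)) b"
    "f \<in> Ar A \<Longrightarrow> Cod C (at (onA F f) b) = onO (onO F (Cod A f)) b"
    "at (lax0 F) b \<in> Ar C" "Dom C (at (lax0 F) b) = \<one>"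
    "Cod C (at (lax0 F) b) = onO (onO F \<one>\<^bsub>A\<^esub>) b"
    "a \<in> Ob A \<Longrightarrow> a' \<in> Ob A \<Longrightarrow> at (lax2 F a a') b \<in> Ar C"
    "a \<in> Ob A \<Longrightarrow> a' \<in> Ob A \<Longrightarrow> Dom C (at (lax2 F a a') b) = onO (onO F a) b \<otimes> onO (onO F a') b"
    "a \<in> Ob A \<Longrightarrow> a' \<in> Ob A \<Longrightarrow> Cod C (at (lax2 F a a') b) = onO (onO F (a \<otimes>\<^bsub>A\<^esub> a')) b"
  using assms by (simp_all add: monoidal_transformation.at_typing[OF transformations(1)]
      monoidal_transformation.at_typing[OF transformations(2)]
      monoidal_transformation.at_typing[OF transformations(3)])

lemma arrow_laws:
  assumes f: "f \<in> Ar A"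
  shows "g \<in> Ar B \<Longrightarrow> Cod B g = b \<Longrightarrow> at (onA F f) b \<cdot> onA (onO F (Dom A f)) g =
      onA (onO F (Cod A f)) g \<cdot> at (onA F f) (Dom B g)"
    "at (onA F f) \<one>\<^bsub>B\<^esub> \<cdot> lax0 (onO F (Dom A f)) = lax0 (onO F (Cod A f))"
    "b \<in> Ob B \<Longrightarrow> b' \<in> Ob B \<Longrightarrow> at (onA F f) (b \<otimes>\<^bsub>B\<^esub> b') \<cdot> lax2 (onO F (Dom A f)) b b' =
      lax2 (onO F (Cod A f)) b b' \<cdot> (at (onA F f) b \<boxtimes> at (onA F f) b')"
  using monoidal_transformation.at_nat[OF transformations(1)[OF f]]
    monoidal_transformation.at_lax0[OF transformations(1)[OF f]]
    monoidal_transformation.at_lax2[OF transformations(1)[OF f]] f by auto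

lemma unit_laws:
  "g \<in> Ar B \<Longrightarrow> Cod B g = b \<Longrightarrow> onA (onO F \<one>\<^bsub>A\<^esub>) g \<cdot> at (lax0 F) (Dom B g) = at (lax0 F) b"
  "at (lax0 F) \<one>\<^bsub>B\<^esub> = lax0 (onO F \<one>\<^bsub>A\<^esub>)"
  "b \<in> Ob B \<Longrightarrow> b' \<in> Ob B \<Longrightarrow> at (lax0 F) (b \<otimes>\<^bsub>B\<^esub> b') \<cdot> Rho C \<one> =
     lax2 (onO F \<one>\<^bsub>A\<^esub>) b b' \<cdot> (at (lax0 F) b \<boxtimes> at (lax0 F) b')"
  using monoidal_transformation.at_nat[OF transformations(2), of g b]
    monoidal_transformation.at_lax0[OF transformations(2)]
    monoidal_transformation.at_lax2[OF transformations(2)] by auto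

text \<open>The inverse unitor and the interchange contained in \<open>box_smf\<close> are moved to
  the other side, which gives the last two laws the shape of the relations \<open>Beta_Gamma\<close>
  and \<open>Gamma_Delta\<close>.\<close>

lemma product_laws:
  assumes a [simp]: "a \<in> Ob A" "a' \<in> Ob A"
  shows "g \<in> Ar B \<Longrightarrow> Cod B g = b \<Longrightarrow> at (lax2 F a a') b \<cdot> (onA (onO F a) g \<boxtimes> onA (onO F a') g) =
      onA (onO F (a \<otimes>\<^bsub>A\<^esub> a')) g \<cdot> at (lax2 F a a') (Dom B g)"
    "at (lax2 F a a') \<one>\<^bsub>B\<^esub> \<cdot> (lax0 (onO F a) \<boxtimes> lax0 (onO F a')) =
      lax0 (onO F (a \<otimes>\<^bsub>A\<^esub> a')) \<cdot> Rho C \<one>"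
    "b \<in> Ob B \<Longrightarrow> b' \<in> Ob B \<Longrightarrow>
      at (lax2 F a a') (b \<otimes>\<^bsub>B\<^esub> b') \<cdot> (lax2 (onO F a) b b' \<boxtimes> lax2 (onO F a') b b') =
      lax2 (onO F (a \<otimes>\<^bsub>A\<^esub> a')) b b' \<cdot> ((at (lax2 F a a') b \<boxtimes> at (lax2 F a a') b') \<cdot>
        interchange C (onO (onO F a) b) (onO (onO F a) b') (onO (onO F a') b) (onO (onO F a') b'))"
proof -
  show "g \<in> Ar B \<Longrightarrow> Cod B g = b \<Longrightarrow> at (lax2 F a a') b \<cdot> (onA (onO F a) g \<boxtimes> onA (onO F a') g) =
      onA (onO F (a \<otimes>\<^bsub>A\<^esub> a')) g \<cdot> at (lax2 F a a') (Dom B g)"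
    using monoidal_transformation.at_nat[OF transformations(3)[OF a]] by auto
  have "at (lax2 F a a') \<one>\<^bsub>B\<^esub> \<cdot> ((lax0 (onO F a) \<boxtimes> lax0 (onO F a')) \<cdot>
      inv_arrow C (Rho C \<one>)) \<cdot> Rho C \<one> = lax0 (onO F (a \<otimes>\<^bsub>A\<^esub> a')) \<cdot> Rho C \<one>"
    using monoidal_transformation.at_lax0[OF transformations(3)[OF a]] by simp
  then show "at (lax2 F a a') \<one>\<^bsub>B\<^esub> \<cdot> (lax0 (onO F a) \<boxtimes> lax0 (onO F a')) =
      lax0 (onO F (a \<otimes>\<^bsub>A\<^esub> a')) \<cdot> Rho C \<one>"
    by (simp add: C.assoc)
  assume b [simp]: "b \<in> Ob B" "b' \<in> Ob B"
  let ?i = "interchange C (onO (onO F a) b) (onO (onO F a) b') (onO (onO F a') b) (onO (onO F a') b')"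
  have "at (lax2 F a a') (b \<otimes>\<^bsub>B\<^esub> b') \<cdot> ((lax2 (onO F a) b b' \<boxtimes> lax2 (onO F a') b b') \<cdot>
        interchange C (onO (onO F a) b) (onO (onO F a') b) (onO (onO F a) b') (onO (onO F a') b')) \<cdot> ?i =
      lax2 (onO F (a \<otimes>\<^bsub>A\<^esub> a')) b b' \<cdot> (at (lax2 F a a') b \<boxtimes> at (lax2 F a a') b') \<cdot> ?i"
    using monoidal_transformation.at_lax2[OF transformations(3)[OF a] b] by simp
  then show "at (lax2 F a a') (b \<otimes>\<^bsub>B\<^esub> b') \<cdot> (lax2 (onO F a) b b' \<boxtimes> lax2 (onO F a') b b') =
      lax2 (onO F (a \<otimes>\<^bsub>A\<^esub> a')) b b' \<cdot> ((at (lax2 F a a') b \<boxtimes> at (lax2 F a a') b') \<cdot> ?i)"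
    by (simp add: C.assoc)
qed

text \<open>The laws of \<open>F\<close> are equations between transformations; evaluating them at
  \<open>b\<close> with \<open>arg_cong\<close> turns them into equations in
  \<open>C\<close>.\<close>

lemma component_laws:
  assumes b: "b \<in> Ob B"
  shows "f \<in> Ar A \<Longrightarrow> f' \<in> Ar A \<Longrightarrow> Dom A f' = Cod A f \<Longrightarrow>
      at (onA F (f' \<cdot>\<^bsub>A\<^esub> f)) b = at (onA F f') b \<cdot> at (onA F f) b"
    "f \<in> Ar A \<Longrightarrow> f' \<in> Ar A \<Longrightarrow> Cod A f = a \<Longrightarrow> Cod A f' = a' \<Longrightarrow>
      at (lax2 F a a') b \<cdot> (at (onA F f) b \<boxtimes> at (onA F f') b) =
      at (onA F (f \<boxtimes>\<^bsub>A\<^esub> f')) b \<cdot> at (lax2 F (Dom A f) (Dom A f')) b"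
    "a \<in> Ob A \<Longrightarrow> a' \<in> Ob A \<Longrightarrow> a'' \<in> Ob A \<Longrightarrow>
      at (lax2 F (a \<otimes>\<^bsub>A\<^esub> a') a'') b \<cdot> ((at (lax2 F a a') b \<boxtimes> Ide C (onO (onO F a'') b)) \<cdot>
        Ass C (onO (onO F a) b) (onO (onO F a') b) (onO (onO F a'') b)) =
      at (onA F (Ass A a a' a'')) b \<cdot> (at (lax2 F a (a' \<otimes>\<^bsub>A\<^esub> a'')) b \<cdot>
        (Ide C (onO (onO F a) b) \<boxtimes> at (lax2 F a' a'') b))"
    "a \<in> Ob A \<Longrightarrow> at (onA F (Rho A a)) b \<cdot> (at (lax2 F a \<one>\<^bsub>A\<^esub>) b \<cdot>
        (Ide C (onO (onO F a) b) \<boxtimes> at (lax0 F) b)) = Rho C (onO (onO F a) b)"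
    "a \<in> Ob A \<Longrightarrow> at (onA F (Lam A a)) b \<cdot> (at (lax2 F \<one>\<^bsub>A\<^esub> a) b \<cdot>
        (at (lax0 F) b \<boxtimes> Ide C (onO (onO F a) b))) = Lam C (onO (onO F a) b)"
    "a \<in> Ob A \<Longrightarrow> a' \<in> Ob A \<Longrightarrow> at (onA F (Sym A a a')) b \<cdot> at (lax2 F a a') b =
        at (lax2 F a' a) b \<cdot> Sym C (onO (onO F a) b) (onO (onO F a') b)"
  using b arg_cong[OF F.lax2_nat[of f f' a a'], of "\<lambda>\<sigma>. at \<sigma> b"]
    arg_cong[OF F.lax_assoc'[of a a' a''], of "\<lambda>\<sigma>. at \<sigma> b"]
    arg_cong[OF F.lax_Rho'[of a], of "\<lambda>\<sigma>. at \<sigma> b"] arg_cong[OF F.lax_Lam'[of a], of "\<lambda>\<sigma>. at \<sigma> b"]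
    arg_cong[OF F.lax_Sym[of a a'], of "\<lambda>\<sigma>. at \<sigma> b"]
  by (simp_all add: F.preserves_Cmp)

end

lemma (in symmetric_monoidal_category) hexagon':
  "x \<in> Ob A \<Longrightarrow> y \<in> Ob A \<Longrightarrow> z \<in> Ob A \<Longrightarrow>
    Ass A z x y \<cdot> (Sym A (x \<otimes> y) z \<cdot> Ass A x y z) =
    (Sym A x z \<boxtimes> Ide A y) \<cdot> (Ass A x z y \<cdot> (Ide A x \<boxtimes> Sym A y z))"
  using hexagon[of x y z] by (simp add: assoc)

text \<open>The functor bound locally as \<open>ob\<close> in \<open>dual\<close>, named so that its
  projections can serve as rewrite rules.\<close>

definition dual_value ::
  "('o, 'm) smcat \<Rightarrow> ('q, 'k) smcat \<Rightarrow>
   ('o, 'm, ('p, 'n, 'q, 'k) smfun, ('p, 'n, 'q, 'k) mtrans) smfun \<Rightarrow> 'p \<Rightarrow> ('o, 'm, 'q, 'k) smfun" where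
  "dual_value A C F b = \<lparr>Src = A, Tgt = C,
     onO = (\<lambda>a\<in>Ob A. onO (onO F a) b),
     onA = (\<lambda>f\<in>Ar A. at (onA F f) b),
     lax0 = at (lax0 F) b,
     lax2 = (\<lambda>a\<in>Ob A. \<lambda>a'\<in>Ob A. at (lax2 F a a') b)\<rparr>"

lemma dual_value_proj [simp]:
  "a \<in> Ob A \<Longrightarrow> onO (dual_value A C F b) a = onO (onO F a) b"
  "f \<in> Ar A \<Longrightarrow> onA (dual_value A C F b) f = at (onA F f) b"
  "lax0 (dual_value A C F b) = at (lax0 F) b"
  "a \<in> Ob A \<Longrightarrow> a' \<in> Ob A \<Longrightarrow> lax2 (dual_value A C F b) a a' = at (lax2 F a a') b"
  by (simp_all add: dual_value_def)

lemma dual_proj [simp]: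
  "Src (dual A B C F) = B" "Tgt (dual A B C F) = ihom A C"
  "b \<in> Ob B \<Longrightarrow> onO (dual A B C F) b = dual_value A C F b"
  "g \<in> Ar B \<Longrightarrow> NDom (onA (dual A B C F) g) = dual_value A C F (Dom B g)"
  "g \<in> Ar B \<Longrightarrow> NCod (onA (dual A B C F) g) = dual_value A C F (Cod B g)"
  "g \<in> Ar B \<Longrightarrow> a \<in> Ob A \<Longrightarrow> at (onA (dual A B C F) g) a = onA (onO F a) g"
  "g \<in> Ar B \<Longrightarrow> at (onA (dual A B C F) g) \<in> extensional (Ob A)"
  "NDom (lax0 (dual A B C F)) = const_smf A C"
  "NCod (lax0 (dual A B C F)) = dual_value A C F \<one>\<^bsub>B\<^esub>"
  "a \<in> Ob A \<Longrightarrow> at (lax0 (dual A B C F)) a = lax0 (onO F a)"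
  "at (lax0 (dual A B C F)) \<in> extensional (Ob A)"
  "b \<in> Ob B \<Longrightarrow> b' \<in> Ob B \<Longrightarrow>
    NDom (lax2 (dual A B C F) b b') = box_smf A C (dual_value A C F b) (dual_value A C F b')"
  "b \<in> Ob B \<Longrightarrow> b' \<in> Ob B \<Longrightarrow> NCod (lax2 (dual A B C F) b b') = dual_value A C F (b \<otimes>\<^bsub>B\<^esub> b')"
  "b \<in> Ob B \<Longrightarrow> b' \<in> Ob B \<Longrightarrow> a \<in> Ob A \<Longrightarrow> at (lax2 (dual A B C F) b b') a = lax2 (onO F a) b b'"
  "b \<in> Ob B \<Longrightarrow> b' \<in> Ob B \<Longrightarrow> at (lax2 (dual A B C F) b b') \<in> extensional (Ob A)"
  "onO (dual A B C F) \<in> extensional (Ob B)" "onA (dual A B C F) \<in> extensional (Ar B)"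
  "lax2 (dual A B C F) \<in> extensional (Ob B)" "b \<in> Ob B \<Longrightarrow> lax2 (dual A B C F) b \<in> extensional (Ob B)"
  by (simp_all add: dual_def dual_value_def)

section \<open>Well-definedness of \<open>En\<close> and of the dual\<close>

context curried_functor
begin

lemmas tensor_word_simps [simp] =
  word_over_dom_cod[OF A.symmetric_monoidal_category_axioms B.symmetric_monoidal_category_axioms]
  term_over_tten[OF A.symmetric_monoidal_category_axioms B.symmetric_monoidal_category_axioms]

lemma En_word_Ob [simp]: "word_over A B X \<Longrightarrow> En_word C F X \<in> Ob C"
  by (induction X) auto

lemma En_term_typing [simp]:
  assumes "term_over A B t"
  shows "En_term C F t \<in> Ar C" "Dom C (En_term C F t) = En_word C F (tdom A B t)"
    "Cod C (En_term C F t) = En_word C F (tcod A B t)"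
proof -
  from assms have "En_term C F t \<in> Ar C \<and> Dom C (En_term C F t) = En_word C F (tdom A B t) \<and>
      Cod C (En_term C F t) = En_word C F (tcod A B t)"
    by (induction t) auto
  then show "En_term C F t \<in> Ar C" "Dom C (En_term C F t) = En_word C F (tdom A B t)"
    "Cod C (En_term C F t) = En_word C F (tcod A B t)" by auto
qed

lemma En_term_tten [simp]:
  "term_over A B t \<Longrightarrow> term_over A B u \<Longrightarrow>
    En_term C F (tten A B t u) = En_term C F t \<boxtimes> En_term C F u"
  by (simp add: tten_def C.TenA_merge)

lemma En_term_tinterchange:
  "En_term C F (tinterchange P Q R S) =
    Ass C (En_word C F P) (En_word C F R) (En_word C F Q \<otimes> En_word C F S) \<cdot>
     ((Ide C (En_word C F P) \<boxtimes> (inv_arrow C (Ass C (En_word C F R) (En_word C F Q) (En_word C F S)) \<cdot>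
        ((Sym C (En_word C F Q) (En_word C F R) \<boxtimes> Ide C (En_word C F S)) \<cdot>
          Ass C (En_word C F Q) (En_word C F R) (En_word C F S)))) \<cdot>
      inv_arrow C (Ass C (En_word C F P) (En_word C F Q) (En_word C F R \<otimes> En_word C F S)))"
  by (simp add: tinterchange_def)

text \<open>The image of \<open>tinterchange\<close> under \<open>En_term\<close> appears in this
  right-nested form; the rule folds it back into \<open>interchange\<close>.\<close>

lemma interchange_right_nested:
  "p \<in> Ob C \<Longrightarrow> q \<in> Ob C \<Longrightarrow> r \<in> Ob C \<Longrightarrow> s \<in> Ob C \<Longrightarrow>
    Ass C p r (q \<otimes> s) \<cdot> ((Ide C p \<boxtimes> (inv_arrow C (Ass C r q s) \<cdot>
      ((Sym C q r \<boxtimes> Ide C s) \<cdot> Ass C q r s))) \<cdot> inv_arrow C (Ass C p q (r \<otimes> s))) =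
    interchange C p q r s"
  by (simp add: interchange_def C.assoc)

text \<open>Soundness of the relations: those on \<open>a \<otimes> -\<close> are the laws of the
  functor \<open>F a\<close>, those on \<open>- \<otimes> b\<close> the laws of \<open>F\<close>
  evaluated at \<open>b\<close>, and the remaining mixed ones say that \<open>F f\<close> and the
  constraints of \<open>F\<close> are monoidal transformations.\<close>

lemma En_term_trel:
  assumes "trel A B t u" "term_over A B t" "term_over A B u"
    "tdom A B t = tdom A B u" "tcod A B t = tcod A B u"
  shows "En_term C F t = En_term C F u"
  using assms
proof (cases rule: trel.cases)
  case (Gamma_Delta a a' b b')
  then show ?thesis
    using assms product_laws(3)[of a a' b b']
    by (simp add: En_term_tinterchange interchange_right_nested)
next
  case (Gamma_natural f f' b)
  then show ?thesis using assms component_laws(2)[of b f f'] by auto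
next
  case (ArrA_Comp f' f b)
  then show ?thesis using assms component_laws(1)[of b f f'] by auto
next
  case (ArrA_ArrB f g)
  then show ?thesis using assms arrow_laws(1)[of f g] by auto
qed (auto simp: C.assoc C.TenA_merge C.natural C.pentagon' C.triangle C.hexagon' C.Lam_Sym
    value_laws arrow_laws unit_laws product_laws component_laws)

lemma En_term_tcong: "tcong A B t u \<Longrightarrow> En_term C F t = En_term C F u"
proof (induction rule: tcong.induct)
  case (rel t u) then show ?case by (rule En_term_trel)
qed auto

lemma En_proj [simp]:
  "Src (En A B C F) = A \<Otimes> B" "Tgt (En A B C F) = C"
  "word_over A B X \<Longrightarrow> onO (En A B C F) X = En_word C F X"
  "term_over A B t \<Longrightarrow> onA (En A B C F) (tclass A B t) = En_term C F t"
  "lax0 (En A B C F) = Ide C \<one>"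
  "word_over A B X \<Longrightarrow> word_over A B Y \<Longrightarrow>
    lax2 (En A B C F) X Y = Ide C (En_word C F X \<otimes> En_word C F Y)"
  by (simp_all add: En_def flip: En_term_tcong[OF rep_tclass])

lemma En_functor: "symmetric_monoidal_functor (A \<Otimes> B) C (En A B C F)"
proof -
  note A = A.symmetric_monoidal_category_axioms and B = B.symmetric_monoidal_category_axioms
  note T = tensor_symmetric_monoidal_category[OF A B]
  have *: "En_term C F (rep (tclass A B t)) = En_term C F t" if "term_over A B t" for t
    using En_term_tcong[OF rep_tclass[OF that]] by simp
  show ?thesis
    unfolding En_def
    by (rule strict_smf_functor[OF T C.symmetric_monoidal_category_axioms])
      (auto simp: tensor_Ar_iff * tclass_TenA[OF A B])
qed

lemma dual_value_functor [simp]: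
  assumes [simp]: "b \<in> Ob B"
  shows "symmetric_monoidal_functor A C (dual_value A C F b)"
proof (rule symmetric_monoidal_functorI[OF A.symmetric_monoidal_category_axioms
      C.symmetric_monoidal_category_axioms], goal_cases)
  case (15 a) then show ?case by (simp add: component_laws(4))
next
  case (16 a) then show ?case by (simp add: component_laws(5))
next
  case (17 a a') then show ?case by (simp add: component_laws(6))
qed (simp_all add: component_laws(1-3), simp_all add: dual_value_def)

text \<open>The laws are transposed. The functor laws of the values \<open>F a\<close> become those
  of the dual, and the monoidality of \<open>F f\<close>, \<open>lax0 F\<close> and
  \<open>lax2 F\<close> becomes naturality, unit condition and product condition for the
  transformations in the dual.\<close>

lemma dual_functor: "symmetric_monoidal_functor B (ihom A C) (dual A B C F)"
proof -
  note A = A.symmetric_monoidal_category_axioms and B = B.symmetric_monoidal_category_axioms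
  note C = C.symmetric_monoidal_category_axioms
  note H = ihom_symmetric_monoidal_category[OF A C]
  note [simp] = ihom_simps[OF A C] ihom_closed[OF A C]
  have arr [simp]: "monoidal_transformation A C (onA (dual A B C F) g)" if "g \<in> Ar B" for g
    using that
    by (intro monoidal_transformationI) (auto simp: arrow_laws unit_laws product_laws)
  have unit [simp]: "monoidal_transformation A C (lax0 (dual A B C F))"
    by (intro monoidal_transformationI) (auto simp: arrow_laws unit_laws product_laws)
  have prod [simp]: "monoidal_transformation A C (lax2 (dual A B C F) b b')"
    if b [simp]: "b \<in> Ob B" "b' \<in> Ob B" for b b'
  proof (rule monoidal_transformationI, goal_cases)
    case 6
    have "(lax2 (onO F \<one>\<^bsub>A\<^esub>) b b' \<cdot> (at (lax0 F) b \<boxtimes> at (lax0 F) b')) \<cdot>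
        inv_arrow C (Rho C \<one>) = at (lax0 F) (b \<otimes>\<^bsub>B\<^esub> b')"
      by (simp add: C.assoc flip: unit_laws(3))
    then show ?case by (simp add: C.assoc)
  next
    case (7 a a')
    then show ?case by (simp add: product_laws(3))
  qed (auto simp: arrow_laws)
  show ?thesis
    by (rule symmetric_monoidal_functorI[OF B H])
      (auto intro!: mtrans_eqI[of A C] simp: value_laws)
qed

end

section \<open>Post- and precomposition\<close>

context
  fixes A :: "('o, 'm) smcat" and B :: "('p, 'n) smcat" (structure)
    and F :: "('o, 'm, 'p, 'n) smfun"
  assumes F: "symmetric_monoidal_functor A B F"
begin

interpretation symmetric_monoidal_functor A B F by (rule F)

lemma preserves_isos:
  assumes "f \<in> isos A x y" shows "onA F f \<in> isos B (onO F x) (onO F y)"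
proof -
  note A.inv_arrow_facts[OF assms, simp]
  have "x \<in> Ob A" "y \<in> Ob A" using A.typing(1,2)[of f] by auto
  moreover have "onA F (inv_arrow A f) \<cdot> onA F f = onA F (inv_arrow A f \<cdot>\<^bsub>A\<^esub> f)"
    "onA F f \<cdot> onA F (inv_arrow A f) = onA F (f \<cdot>\<^bsub>A\<^esub> inv_arrow A f)"
    using preserves_Cmp[of "inv_arrow A f" f] preserves_Cmp[of f "inv_arrow A f"] by simp_all
  ultimately have "inverse_arrows B (onA F f) (onA F (inv_arrow A f))"
    by (intro B.inverse_arrowsI) simp_all
  then show ?thesis by (rule B.isosI) simp_all
qed

text \<open>After composition with the image of an associator, which is invertible, this is two uses
  of \<open>lax_assoc\<close> around one of \<open>lax_Sym\<close>.\<close>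

lemma lax2_swap_left:
  assumes [simp]: "q \<in> Ob A" "r \<in> Ob A" "z \<in> Ob A"
  shows "onA F (swap_left A q r z) \<cdot> (lax2 F q (r \<otimes>\<^bsub>A\<^esub> z) \<cdot> (Ide B (onO F q) \<boxtimes> lax2 F r z)) =
    lax2 F r (q \<otimes>\<^bsub>A\<^esub> z) \<cdot> ((Ide B (onO F r) \<boxtimes> lax2 F q z) \<cdot>
      swap_left B (onO F q) (onO F r) (onO F z))"
proof -
  let ?q = "onO F q" and ?r = "onO F r" and ?z = "onO F z"
  have "onA F (Ass A r q z) \<cdot> (onA F (swap_left A q r z) \<cdot> (lax2 F q (r \<otimes>\<^bsub>A\<^esub> z) \<cdot>
      (Ide B ?q \<boxtimes> lax2 F r z))) =
    onA F (Ass A r q z \<cdot>\<^bsub>A\<^esub> swap_left A q r z) \<cdot> (lax2 F q (r \<otimes>\<^bsub>A\<^esub> z) \<cdot>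
      (Ide B ?q \<boxtimes> lax2 F r z))"
    by (simp add: preserves_Cmp B.assoc)
  also have "\<dots> = onA F (Sym A q r \<boxtimes>\<^bsub>A\<^esub> Ide A z) \<cdot> (onA F (Ass A q r z) \<cdot>
      (lax2 F q (r \<otimes>\<^bsub>A\<^esub> z) \<cdot> (Ide B ?q \<boxtimes> lax2 F r z)))"
    by (simp add: preserves_Cmp B.assoc A.Ass_swap_left)
  also have "\<dots> = onA F (Sym A q r \<boxtimes>\<^bsub>A\<^esub> Ide A z) \<cdot> (lax2 F (q \<otimes>\<^bsub>A\<^esub> r) z \<cdot>
      ((lax2 F q r \<boxtimes> Ide B ?z) \<cdot> Ass B ?q ?r ?z))"
    by (simp add: lax_assoc')
  also have "\<dots> = lax2 F (r \<otimes>\<^bsub>A\<^esub> q) z \<cdot> ((onA F (Sym A q r) \<boxtimes> onA F (Ide A z)) \<cdot>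
      ((lax2 F q r \<boxtimes> Ide B ?z) \<cdot> Ass B ?q ?r ?z))"
    by (simp add: lax2_nat[THEN B.Cmp_reduce] B.assoc del: preserves_Ide)
  also have "\<dots> = lax2 F (r \<otimes>\<^bsub>A\<^esub> q) z \<cdot> ((lax2 F r q \<boxtimes> Ide B ?z) \<cdot>
      ((Sym B ?q ?r \<boxtimes> Ide B ?z) \<cdot> Ass B ?q ?r ?z))"
    by (simp add: B.TenA_merge_assoc lax_Sym)
  also have "\<dots> = (lax2 F (r \<otimes>\<^bsub>A\<^esub> q) z \<cdot> ((lax2 F r q \<boxtimes> Ide B ?z) \<cdot> Ass B ?r ?q ?z)) \<cdot>
      swap_left B ?q ?r ?z"
    by (simp add: B.Ass_swap_left B.assoc)
  also have "\<dots> = onA F (Ass A r q z) \<cdot> (lax2 F r (q \<otimes>\<^bsub>A\<^esub> z) \<cdot> ((Ide B ?r \<boxtimes> lax2 F q z) \<cdot>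
      swap_left B ?q ?r ?z))"
    by (simp add: lax_assoc' B.assoc)
  finally show ?thesis
    using B.iso_cancel_left[OF preserves_isos[OF A.structure_isos(1)[of r q z]]] by simp
qed

text \<open>Compatibility of the constraint of \<open>F\<close> with the interchange;
  \<open>ihom_post\<close> needs it for its own constraint to be a monoidal transformation.\<close>

lemma lax2_interchange:
  assumes [simp]: "p \<in> Ob A" "q \<in> Ob A" "r \<in> Ob A" "s \<in> Ob A"
  shows "onA F (interchange A p q r s) \<cdot> (lax2 F (p \<otimes>\<^bsub>A\<^esub> q) (r \<otimes>\<^bsub>A\<^esub> s) \<cdot>
      (lax2 F p q \<boxtimes> lax2 F r s)) =
    lax2 F (p \<otimes>\<^bsub>A\<^esub> r) (q \<otimes>\<^bsub>A\<^esub> s) \<cdot> ((lax2 F p r \<boxtimes> lax2 F q s) \<cdot>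
      interchange B (onO F p) (onO F q) (onO F r) (onO F s))"
proof -
  let ?p = "onO F p" and ?q = "onO F q" and ?r = "onO F r" and ?s = "onO F s"
  \<comment> \<open>A four-fold product formed in pairs is compared with the right-nested one. There
    the interchange is a single swap, to which \<open>lax2_swap_left\<close> applies.\<close>
  have lax3: "lax2 F (p \<otimes>\<^bsub>A\<^esub> u) (v \<otimes>\<^bsub>A\<^esub> w) \<cdot> ((lax2 F p u \<boxtimes> lax2 F v w) \<cdot>
      Ass B ?p (onO F u) (onO F v \<otimes> onO F w)) =
    onA F (Ass A p u (v \<otimes>\<^bsub>A\<^esub> w)) \<cdot> (lax2 F p (u \<otimes>\<^bsub>A\<^esub> (v \<otimes>\<^bsub>A\<^esub> w)) \<cdot>
      (Ide B ?p \<boxtimes> (lax2 F u (v \<otimes>\<^bsub>A\<^esub> w) \<cdot> (Ide B (onO F u) \<boxtimes> lax2 F v w))))"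
    if [simp]: "u \<in> Ob A" "v \<in> Ob A" "w \<in> Ob A" for u v w
  proof -
    have "lax2 F (p \<otimes>\<^bsub>A\<^esub> u) (v \<otimes>\<^bsub>A\<^esub> w) \<cdot> ((lax2 F p u \<boxtimes> lax2 F v w) \<cdot>
        Ass B ?p (onO F u) (onO F v \<otimes> onO F w)) =
      lax2 F (p \<otimes>\<^bsub>A\<^esub> u) (v \<otimes>\<^bsub>A\<^esub> w) \<cdot> ((lax2 F p u \<boxtimes> Ide B (onO F (v \<otimes>\<^bsub>A\<^esub> w))) \<cdot>
       (((Ide B ?p \<boxtimes> Ide B (onO F u)) \<boxtimes> lax2 F v w) \<cdot> Ass B ?p (onO F u) (onO F v \<otimes> onO F w)))"
      by (simp add: B.TenA_merge_assoc)
    also have "\<dots> = (lax2 F (p \<otimes>\<^bsub>A\<^esub> u) (v \<otimes>\<^bsub>A\<^esub> w) \<cdot> ((lax2 F p u \<boxtimes> Ide B (onO F (v \<otimes>\<^bsub>A\<^esub> w))) \<cdot>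
        Ass B ?p (onO F u) (onO F (v \<otimes>\<^bsub>A\<^esub> w)))) \<cdot> (Ide B ?p \<boxtimes> (Ide B (onO F u) \<boxtimes> lax2 F v w))"
      by (simp add: B.natural(1) B.assoc del: B.Ide_cancel(3))
    finally show ?thesis by (simp add: lax_assoc' B.assoc B.TenA_merge)
  qed
  have "onA F (interchange A p q r s) \<cdot> (lax2 F (p \<otimes>\<^bsub>A\<^esub> q) (r \<otimes>\<^bsub>A\<^esub> s) \<cdot>
      (lax2 F p q \<boxtimes> lax2 F r s)) \<cdot> Ass B ?p ?q (?r \<otimes> ?s) =
    onA F (interchange A p q r s \<cdot>\<^bsub>A\<^esub> Ass A p q (r \<otimes>\<^bsub>A\<^esub> s)) \<cdot> (lax2 F p (q \<otimes>\<^bsub>A\<^esub> (r \<otimes>\<^bsub>A\<^esub> s)) \<cdot>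
      (Ide B ?p \<boxtimes> (lax2 F q (r \<otimes>\<^bsub>A\<^esub> s) \<cdot> (Ide B ?q \<boxtimes> lax2 F r s))))"
    by (simp add: lax3 preserves_Cmp B.assoc)
  also have "\<dots> = onA F (Ass A p r (q \<otimes>\<^bsub>A\<^esub> s)) \<cdot> (onA F (Ide A p \<boxtimes>\<^bsub>A\<^esub> swap_left A q r s) \<cdot>
      (lax2 F p (q \<otimes>\<^bsub>A\<^esub> (r \<otimes>\<^bsub>A\<^esub> s)) \<cdot>
       (Ide B ?p \<boxtimes> (lax2 F q (r \<otimes>\<^bsub>A\<^esub> s) \<cdot> (Ide B ?q \<boxtimes> lax2 F r s)))))"
    by (simp add: A.interchange_Ass preserves_Cmp B.assoc)
  also have "\<dots> = onA F (Ass A p r (q \<otimes>\<^bsub>A\<^esub> s)) \<cdot> (lax2 F p (r \<otimes>\<^bsub>A\<^esub> (q \<otimes>\<^bsub>A\<^esub> s)) \<cdot>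
      ((onA F (Ide A p) \<boxtimes> onA F (swap_left A q r s)) \<cdot>
       (Ide B ?p \<boxtimes> (lax2 F q (r \<otimes>\<^bsub>A\<^esub> s) \<cdot> (Ide B ?q \<boxtimes> lax2 F r s)))))"
    by (simp add: lax2_nat[THEN B.Cmp_reduce] B.assoc del: preserves_Ide)
  also have "\<dots> = onA F (Ass A p r (q \<otimes>\<^bsub>A\<^esub> s)) \<cdot> (lax2 F p (r \<otimes>\<^bsub>A\<^esub> (q \<otimes>\<^bsub>A\<^esub> s)) \<cdot>
      ((Ide B ?p \<boxtimes> (lax2 F r (q \<otimes>\<^bsub>A\<^esub> s) \<cdot> (Ide B ?r \<boxtimes> lax2 F q s))) \<cdot>
        (Ide B ?p \<boxtimes> swap_left B ?q ?r ?s)))"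
    by (simp add: B.TenA_merge lax2_swap_left B.assoc)
  also have "\<dots> = (onA F (Ass A p r (q \<otimes>\<^bsub>A\<^esub> s)) \<cdot> (lax2 F p (r \<otimes>\<^bsub>A\<^esub> (q \<otimes>\<^bsub>A\<^esub> s)) \<cdot>
      (Ide B ?p \<boxtimes> (lax2 F r (q \<otimes>\<^bsub>A\<^esub> s) \<cdot> (Ide B ?r \<boxtimes> lax2 F q s))))) \<cdot>
        (Ide B ?p \<boxtimes> swap_left B ?q ?r ?s)"
    by (simp add: B.assoc)
  also have "\<dots> = lax2 F (p \<otimes>\<^bsub>A\<^esub> r) (q \<otimes>\<^bsub>A\<^esub> s) \<cdot> ((lax2 F p r \<boxtimes> lax2 F q s) \<cdot>
      interchange B ?p ?q ?r ?s) \<cdot> Ass B ?p ?q (?r \<otimes> ?s)"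
    by (subst lax3[symmetric]) (simp_all add: B.interchange_Ass B.assoc)
  finally show ?thesis
    using B.iso_cancel_right[OF B.structure_isos(1)[of ?p ?q "?r \<otimes> ?s"]] by simp
qed

text \<open>\<open>lax0 F\<close> is a morphism of monoids from the unit of \<open>B\<close> to the
  image of the unit of \<open>A\<close>. This is the product condition on the unit constraint of
  \<open>ihom_post\<close>.\<close>

lemma lax0_Rho:
  "onA F (Rho A \<one>\<^bsub>A\<^esub>) \<cdot> (lax2 F \<one>\<^bsub>A\<^esub> \<one>\<^bsub>A\<^esub> \<cdot> (lax0 F \<boxtimes> lax0 F)) = lax0 F \<cdot> Rho B \<one>"
proof -
  have "onA F (Rho A \<one>\<^bsub>A\<^esub>) \<cdot> (lax2 F \<one>\<^bsub>A\<^esub> \<one>\<^bsub>A\<^esub> \<cdot> (lax0 F \<boxtimes> lax0 F)) =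
    (onA F (Rho A \<one>\<^bsub>A\<^esub>) \<cdot> (lax2 F \<one>\<^bsub>A\<^esub> \<one>\<^bsub>A\<^esub> \<cdot> (Ide B (onO F \<one>\<^bsub>A\<^esub>) \<boxtimes> lax0 F))) \<cdot>
      (lax0 F \<boxtimes> Ide B \<one>)"
    by (simp add: B.assoc B.TenA_merge)
  then show ?thesis by (simp add: lax_Rho' B.natural)
qed

lemma lax0_Rho_inv:
  "lax2 F \<one>\<^bsub>A\<^esub> \<one>\<^bsub>A\<^esub> \<cdot> ((lax0 F \<boxtimes> lax0 F) \<cdot> inv_arrow B (Rho B \<one>)) =
    onA F (inv_arrow A (Rho A \<one>\<^bsub>A\<^esub>)) \<cdot> lax0 F"
proof -
  have "onA F (inv_arrow A (Rho A \<one>\<^bsub>A\<^esub>)) \<cdot> onA F (Rho A \<one>\<^bsub>A\<^esub>) = Ide B (onO F (\<one>\<^bsub>A\<^esub> \<otimes>\<^bsub>A\<^esub> \<one>\<^bsub>A\<^esub>))"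
    using preserves_Cmp[of "inv_arrow A (Rho A \<one>\<^bsub>A\<^esub>)" "Rho A \<one>\<^bsub>A\<^esub>"] by simp
  note [simp] = this[THEN B.Cmp_reduce]
  have "onA F (inv_arrow A (Rho A \<one>\<^bsub>A\<^esub>)) \<cdot> (onA F (Rho A \<one>\<^bsub>A\<^esub>) \<cdot>
      (lax2 F \<one>\<^bsub>A\<^esub> \<one>\<^bsub>A\<^esub> \<cdot> (lax0 F \<boxtimes> lax0 F))) \<cdot> inv_arrow B (Rho B \<one>) =
    onA F (inv_arrow A (Rho A \<one>\<^bsub>A\<^esub>)) \<cdot> (lax0 F \<cdot> Rho B \<one>) \<cdot> inv_arrow B (Rho B \<one>)"
    by (simp only: lax0_Rho)
  then show ?thesis by (simp add: B.assoc)
qed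

end

lemma whisker_proj [simp]:
  "NDom (whisker_left F \<theta>) = F \<circ>\<^sub>1 NDom \<theta>" "NCod (whisker_left F \<theta>) = F \<circ>\<^sub>1 NCod \<theta>"
  "x \<in> Ob (Src (NDom \<theta>)) \<Longrightarrow> at (whisker_left F \<theta>) x = onA F (at \<theta> x)"
  "at (whisker_left F \<theta>) \<in> extensional (Ob (Src (NDom \<theta>)))"
  "NDom (whisker_right \<sigma> H) = NDom \<sigma> \<circ>\<^sub>1 H" "NCod (whisker_right \<sigma> H) = NCod \<sigma> \<circ>\<^sub>1 H"
  "y \<in> Ob (Src H) \<Longrightarrow> at (whisker_right \<sigma> H) y = at \<sigma> (onO H y)"
  "at (whisker_right \<sigma> H) \<in> extensional (Ob (Src H))"
  by (simp_all add: whisker_left_def whisker_right_def)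

lemma whisker_left_transformation:
  assumes "symmetric_monoidal_functor B C F" "monoidal_transformation A B \<theta>"
  shows "monoidal_transformation A C (whisker_left F \<theta>)"
proof -
  interpret F: symmetric_monoidal_functor B C F by fact
  interpret \<theta>: monoidal_transformation A B \<theta> by fact
  note [simp] = \<theta>.F.Src \<theta>.F.Tgt \<theta>.G.Src \<theta>.G.Tgt F.Src F.Tgt
  note ax = \<theta>.F.symmetric_monoidal_functor_axioms \<theta>.G.symmetric_monoidal_functor_axioms
  have ext: "at (whisker_left F \<theta>) \<in> extensional (Ob A)" using whisker_proj(4)[of F \<theta>] by simp
  show ?thesis
  proof (rule monoidal_transformationI, goal_cases)
    case (5 f)
    then have "onA F (at \<theta> (Cod A f) \<cdot>\<^bsub>B\<^esub> onA (NDom \<theta>) f) = onA F (onA (NCod \<theta>) f \<cdot>\<^bsub>B\<^esub> at \<theta> (Dom A f))"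
      by (simp add: \<theta>.at_nat)
    with 5 show ?case by (simp add: F.preserves_Cmp)
  next
    case 6
    have "onA F (at \<theta> \<one>\<^bsub>A\<^esub> \<cdot>\<^bsub>B\<^esub> lax0 (NDom \<theta>)) \<cdot>\<^bsub>C\<^esub> lax0 F = onA F (lax0 (NCod \<theta>)) \<cdot>\<^bsub>C\<^esub> lax0 F"
      by (simp add: \<theta>.at_lax0)
    then show ?case by (simp add: F.preserves_Cmp F.B.assoc)
  next
    case (7 x y)
    then have "onA F (at \<theta> (x \<otimes>\<^bsub>A\<^esub> y) \<cdot>\<^bsub>B\<^esub> lax2 (NDom \<theta>) x y) \<cdot>\<^bsub>C\<^esub>
        lax2 F (onO (NDom \<theta>) x) (onO (NDom \<theta>) y) =
      onA F (lax2 (NCod \<theta>) x y \<cdot>\<^bsub>B\<^esub> (at \<theta> x \<boxtimes>\<^bsub>B\<^esub> at \<theta> y)) \<cdot>\<^bsub>C\<^esub>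
        lax2 F (onO (NDom \<theta>) x) (onO (NDom \<theta>) y)"
      by (simp add: \<theta>.at_lax2)
    with 7 show ?case by (simp add: F.preserves_Cmp F.B.assoc F.lax2_nat)
  qed (use ext in \<open>simp_all add: smf_comp_functor[OF assms(1)] ax\<close>)
qed

lemma whisker_right_transformation:
  assumes "monoidal_transformation B C \<sigma>" "symmetric_monoidal_functor A B H"
  shows "monoidal_transformation A C (whisker_right \<sigma> H)"
proof -
  interpret H: symmetric_monoidal_functor A B H by fact
  interpret \<sigma>: monoidal_transformation B C \<sigma> by fact
  note [simp] = \<sigma>.F.Src \<sigma>.F.Tgt \<sigma>.G.Src \<sigma>.G.Tgt H.Src H.Tgt
  note ax = \<sigma>.F.symmetric_monoidal_functor_axioms \<sigma>.G.symmetric_monoidal_functor_axioms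
  have ext: "at (whisker_right \<sigma> H) \<in> extensional (Ob A)" using whisker_proj(8)[of \<sigma> H] by simp
  show ?thesis
  proof (rule monoidal_transformationI, goal_cases)
    case (5 f)
    then show ?case by (simp add: \<sigma>.at_nat)
  next
    case 6
    show ?case
      by (simp add: \<sigma>.at_nat[THEN \<sigma>.F.B.Cmp_reduce] \<sigma>.F.B.assoc \<sigma>.at_lax0)
  next
    case (7 x y)
    then show ?case
      by (simp add: \<sigma>.at_nat[THEN \<sigma>.F.B.Cmp_reduce] \<sigma>.F.B.assoc \<sigma>.at_lax2)
  qed (use ext in \<open>simp_all add: smf_comp_functor[OF _ assms(2)] ax\<close>)
qed

lemma curried_functorI:
  "symmetric_monoidal_category A \<Longrightarrow> symmetric_monoidal_category B \<Longrightarrow>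
    symmetric_monoidal_category C \<Longrightarrow> symmetric_monoidal_functor A (ihom B C) F \<Longrightarrow>
    curried_functor A B C F"
  by (rule curried_functor.intro)

text \<open>The seven families are the data of a curried functor on the generators of
  \<open>A \<Otimes> B\<close>: objects, arrows \<open>a \<otimes> g\<close>, \<beta>, \<delta>,
  arrows \<open>f \<otimes> b\<close>, \<alpha> and \<gamma>, in this order.\<close>

lemma curried_functor_eqI:
  assumes "curried_functor A B C F" "curried_functor A B C G"
    and onO: "\<And>a b. a \<in> Ob A \<Longrightarrow> b \<in> Ob B \<Longrightarrow> onO (onO F a) b = onO (onO G a) b"
    and onA: "\<And>a g. a \<in> Ob A \<Longrightarrow> g \<in> Ar B \<Longrightarrow> onA (onO F a) g = onA (onO G a) g"
    and lax0: "\<And>a. a \<in> Ob A \<Longrightarrow> lax0 (onO F a) = lax0 (onO G a)"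
    and lax2: "\<And>a b b'. a \<in> Ob A \<Longrightarrow> b \<in> Ob B \<Longrightarrow> b' \<in> Ob B \<Longrightarrow>
      lax2 (onO F a) b b' = lax2 (onO G a) b b'"
    and arr: "\<And>f b. f \<in> Ar A \<Longrightarrow> b \<in> Ob B \<Longrightarrow> at (onA F f) b = at (onA G f) b"
    and unit: "\<And>b. b \<in> Ob B \<Longrightarrow> at (lax0 F) b = at (lax0 G) b"
    and prod: "\<And>a a' b. a \<in> Ob A \<Longrightarrow> a' \<in> Ob A \<Longrightarrow> b \<in> Ob B \<Longrightarrow>
      at (lax2 F a a') b = at (lax2 G a a') b"
  shows "F = G"
proof -
  interpret F: curried_functor A B C F by fact
  interpret G: curried_functor A B C G by fact
  \<comment> \<open>Equality of the values comes first, since it makes the ends of the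
    transformations compared afterwards agree.\<close>
  have vals: "onO F a = onO G a" if "a \<in> Ob A" for a
    using that onO onA lax0 lax2 by (intro smf_eqI[of B C]) auto
  show ?thesis
    using vals arr unit prod
    by (intro smf_eqI[OF F.F.symmetric_monoidal_functor_axioms G.F.symmetric_monoidal_functor_axioms])
      (auto intro!: mtrans_eqI[of B C])
qed

lemma curried_transformation_eqI:
  assumes B: "symmetric_monoidal_category B" and C: "symmetric_monoidal_category C"
    and \<sigma>: "monoidal_transformation A (ihom B C) \<sigma>" and \<tau>: "monoidal_transformation A (ihom B C) \<tau>"
    and ends: "NDom \<sigma> = NDom \<tau>" "NCod \<sigma> = NCod \<tau>"
    and "\<And>a b. a \<in> Ob A \<Longrightarrow> b \<in> Ob B \<Longrightarrow> at (at \<sigma> a) b = at (at \<tau> a) b"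
  shows "\<sigma> = \<tau>"
proof (rule mtrans_eqI[OF \<sigma> \<tau> ends])
  fix a assume a: "a \<in> Ob A"
  note [simp] = ihom_simps[OF B C]
  show "at \<sigma> a = at \<tau> a"
    using monoidal_transformation.at_typing[OF \<sigma> a] monoidal_transformation.at_typing[OF \<tau> a] assms a
    by (intro mtrans_eqI[of B C]) auto
qed

lemma ihom_post_proj [simp]:
  "Src (ihom_post A F) = ihom A (Src F)" "Tgt (ihom_post A F) = ihom A (Tgt F)"
  "H \<in> Ob (ihom A (Src F)) \<Longrightarrow> onO (ihom_post A F) H = F \<circ>\<^sub>1 H"
  "\<theta> \<in> Ar (ihom A (Src F)) \<Longrightarrow> onA (ihom_post A F) \<theta> = whisker_left F \<theta>"
  "NDom (lax0 (ihom_post A F)) = const_smf A (Tgt F)"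
  "NCod (lax0 (ihom_post A F)) = F \<circ>\<^sub>1 const_smf A (Src F)"
  "x \<in> Ob A \<Longrightarrow> at (lax0 (ihom_post A F)) x = lax0 F"
  "at (lax0 (ihom_post A F)) \<in> extensional (Ob A)"
  "H \<in> Ob (ihom A (Src F)) \<Longrightarrow> K \<in> Ob (ihom A (Src F)) \<Longrightarrow>
    NDom (lax2 (ihom_post A F) H K) = box_smf A (Tgt F) (F \<circ>\<^sub>1 H) (F \<circ>\<^sub>1 K)"
  "H \<in> Ob (ihom A (Src F)) \<Longrightarrow> K \<in> Ob (ihom A (Src F)) \<Longrightarrow>
    NCod (lax2 (ihom_post A F) H K) = F \<circ>\<^sub>1 box_smf A (Src F) H K"
  "H \<in> Ob (ihom A (Src F)) \<Longrightarrow> K \<in> Ob (ihom A (Src F)) \<Longrightarrow> x \<in> Ob A \<Longrightarrow>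
    at (lax2 (ihom_post A F) H K) x = lax2 F (onO H x) (onO K x)"
  "H \<in> Ob (ihom A (Src F)) \<Longrightarrow> K \<in> Ob (ihom A (Src F)) \<Longrightarrow>
    at (lax2 (ihom_post A F) H K) \<in> extensional (Ob A)"
  "onO (ihom_post A F) \<in> extensional (Ob (ihom A (Src F)))"
  "onA (ihom_post A F) \<in> extensional (Ar (ihom A (Src F)))"
  "lax2 (ihom_post A F) \<in> extensional (Ob (ihom A (Src F)))"
  "H \<in> Ob (ihom A (Src F)) \<Longrightarrow> lax2 (ihom_post A F) H \<in> extensional (Ob (ihom A (Src F)))"
  by (simp_all add: ihom_post_def Let_def) (simp_all add: ihom_def)

lemma box_const_src [simp]: "Src (box_smf A B F G) = A" "Src (const_smf A B) = A"
  by (simp_all add: box_smf_def const_smf_def)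

text \<open>The laws of the functor are those of \<open>F\<close> at each object. The content lies
  in its constraints being arrows of the hom, by \<open>lax0_Rho\<close>,
  \<open>lax0_Rho_inv\<close> and \<open>lax2_interchange\<close>.\<close>

lemma ihom_post_functor:
  fixes C :: "('q, 'k) smcat" (structure)
  assumes A: "symmetric_monoidal_category A" and F: "symmetric_monoidal_functor B C F"
  shows "symmetric_monoidal_functor (ihom A B) (ihom A C) (ihom_post A F)"
proof -
  interpret A: symmetric_monoidal_category A by fact
  interpret F: symmetric_monoidal_functor B C F by fact
  note B = F.A.symmetric_monoidal_category_axioms and C = F.B.symmetric_monoidal_category_axioms
  note [simp] = F.Src F.Tgt ihom_simps[OF A B] ihom_simps[OF A C] ihom_closed[OF A B] ihom_closed[OF A C]
    smf_comp_functor[OF F] whisker_left_transformation[OF F]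
  have ends [simp]: "symmetric_monoidal_functor A B (NDom \<theta>)" "symmetric_monoidal_functor A B (NCod \<theta>)"
      "Src (NDom \<theta>) = A"
    if "monoidal_transformation A B \<theta>" for \<theta>
    using that by (auto simp: monoidal_transformation_def dest: symmetric_monoidal_functor.Src)
  have src [simp]: "Src H = A" if "symmetric_monoidal_functor A B H" for H
    using that by (rule symmetric_monoidal_functor.Src)
  note vals [simp] = symmetric_monoidal_functor.onO_typing[of A B]
    monoidal_transformation.at_typing[of A B]
  have unit [simp]: "monoidal_transformation A C (lax0 (ihom_post A F))"
    by (rule monoidal_transformationI) (simp_all add: lax0_Rho[OF F] F.B.assoc)
  have prod [simp]: "monoidal_transformation A C (lax2 (ihom_post A F) H K)"
    if H: "symmetric_monoidal_functor A B H" and K: "symmetric_monoidal_functor A B K" for H K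
  proof -
    interpret H: symmetric_monoidal_functor A B H by fact
    interpret K: symmetric_monoidal_functor A B K by fact
    note [simp] = H K
    show ?thesis
    proof (rule monoidal_transformationI, goal_cases)
      case (5 f) then show ?case by (simp add: F.lax2_nat)
    next
      case 6
      have "lax2 F (onO H \<one>\<^bsub>A\<^esub>) (onO K \<one>\<^bsub>A\<^esub>) \<cdot> ((onA F (lax0 H) \<boxtimes> onA F (lax0 K)) \<cdot>
          ((lax0 F \<boxtimes> lax0 F) \<cdot> inv_arrow C (Rho C \<one>))) =
        onA F (lax0 H \<boxtimes>\<^bsub>B\<^esub> lax0 K) \<cdot> (onA F (inv_arrow B (Rho B \<one>\<^bsub>B\<^esub>)) \<cdot> lax0 F)"
        by (simp add: F.lax2_nat[THEN F.B.Cmp_reduce] F.B.assoc lax0_Rho_inv[OF F])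
      then show ?case by (simp add: F.B.TenA_merge_assoc F.preserves_Cmp F.B.assoc)
    next
      case (7 x y)
      let ?m = "interchange B (onO H x) (onO K x) (onO H y) (onO K y)"
      have "lax2 F (onO H (x \<otimes>\<^bsub>A\<^esub> y)) (onO K (x \<otimes>\<^bsub>A\<^esub> y)) \<cdot>
          ((onA F (lax2 H x y) \<boxtimes> onA F (lax2 K x y)) \<cdot>
          ((lax2 F (onO H x) (onO H y) \<boxtimes> lax2 F (onO K x) (onO K y)) \<cdot>
           interchange C (onO F (onO H x)) (onO F (onO K x)) (onO F (onO H y)) (onO F (onO K y)))) =
         onA F (lax2 H x y \<boxtimes>\<^bsub>B\<^esub> lax2 K x y) \<cdot> (onA F ?m \<cdot>
          (lax2 F (onO H x \<otimes>\<^bsub>B\<^esub> onO K x) (onO H y \<otimes>\<^bsub>B\<^esub> onO K y) \<cdot>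
           (lax2 F (onO H x) (onO K x) \<boxtimes> lax2 F (onO H y) (onO K y))))"
        using 7 by (simp add: F.lax2_nat[THEN F.B.Cmp_reduce] F.B.assoc lax2_interchange[OF F])
      with 7 show ?case by (simp add: F.B.TenA_merge_assoc F.preserves_Cmp F.B.assoc)
    qed simp_all
  qed
  have ext: "onO (ihom_post A F) \<in> extensional (Ob (ihom A B))"
    "onA (ihom_post A F) \<in> extensional (Ar (ihom A B))"
    "lax2 (ihom_post A F) \<in> extensional (Ob (ihom A B))"
    "H \<in> Ob (ihom A B) \<Longrightarrow> lax2 (ihom_post A F) H \<in> extensional (Ob (ihom A B))" for H
    using ihom_post_proj(13-15)[of A F] ihom_post_proj(16)[of H A F] by simp_all
  show ?thesis
    by (rule symmetric_monoidal_functorI[OF ihom_symmetric_monoidal_category[OF A B]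
          ihom_symmetric_monoidal_category[OF A C]])
      (auto intro!: mtrans_eqI[of A C] intro: ext simp: ext F.preserves_Cmp F.lax2_nat F.lax_assoc'
        F.lax_Rho' F.lax_Lam' F.lax_Sym)
qed

section \<open>Currying\<close>

text \<open>With identity components, the conditions on a monoidal transformation say precisely that
  its two ends agree. Thus strictness of a curried functor can be read off from equations in the
  innermost codomain.\<close>

lemma identity_transformation:
  assumes "monoidal_transformation A B \<sigma>"
    and id: "\<And>x. x \<in> Ob A \<Longrightarrow> at \<sigma> x = Ide B (onO (NDom \<sigma>) x)"
  shows "NCod \<sigma> = NDom \<sigma>" "\<sigma> = Ide (ihom A B) (NDom \<sigma>)"
proof -
  interpret \<sigma>: monoidal_transformation A B \<sigma> by fact
  note A = \<sigma>.F.A.symmetric_monoidal_category_axioms and B = \<sigma>.F.B.symmetric_monoidal_category_axioms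
  have onO: "onO (NCod \<sigma>) x = onO (NDom \<sigma>) x" if "x \<in> Ob A" for x
    using \<sigma>.at_typing(3)[OF that] that by (simp add: id)
  show "NCod \<sigma> = NDom \<sigma>"
  proof (rule smf_eqI[OF \<sigma>.G.symmetric_monoidal_functor_axioms \<sigma>.F.symmetric_monoidal_functor_axioms])
    show "onA (NCod \<sigma>) f = onA (NDom \<sigma>) f" if "f \<in> Ar A" for f
      using \<sigma>.at_nat[OF that HOL.refl] that by (simp add: id onO)
    show "lax0 (NCod \<sigma>) = lax0 (NDom \<sigma>)" using \<sigma>.at_lax0 by (simp add: id)
    show "lax2 (NCod \<sigma>) x y = lax2 (NDom \<sigma>) x y" if "x \<in> Ob A" "y \<in> Ob A" for x y
      using \<sigma>.at_lax2[OF that] that by (simp add: id onO)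
  qed (rule onO)
  then show "\<sigma> = Ide (ihom A B) (NDom \<sigma>)"
    using ihom_Ide[OF A B \<sigma>.F.symmetric_monoidal_functor_axioms] assms
    by (intro mtrans_eqI[of A B]) (auto simp: id)
qed

lemma const_smf_comp:
  assumes "symmetric_monoidal_functor C A G" "symmetric_monoidal_category B"
  shows "const_smf A B \<circ>\<^sub>1 G = const_smf C B"
proof -
  interpret G: symmetric_monoidal_functor C A G by fact
  interpret B: symmetric_monoidal_category B by fact
  note G.Src [simp] G.Tgt [simp]
  have [simp]: "Tgt (const_smf A B) = B" by (simp add: const_smf_def)
  show ?thesis
    using assms G.A.symmetric_monoidal_category_axioms G.B.symmetric_monoidal_category_axioms
    by (intro smf_eqI[of C B] smf_comp_functor[of A B _ C] const_smf_functor) auto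
qed

text \<open>An equality rather than an isomorphism, as strictness of \<open>ihom_pre\<close>
  demands: the interchange in the constraint slides past the product of the images under
  \<open>H\<close> and \<open>K\<close>.\<close>

lemma box_smf_comp:
  assumes "symmetric_monoidal_functor C A G" "symmetric_monoidal_functor A B H"
    "symmetric_monoidal_functor A B K"
  shows "box_smf A B H K \<circ>\<^sub>1 G = box_smf C B (H \<circ>\<^sub>1 G) (K \<circ>\<^sub>1 G)"
proof -
  interpret G: symmetric_monoidal_functor C A G by fact
  interpret H: symmetric_monoidal_functor A B H by fact
  interpret K: symmetric_monoidal_functor A B K by fact
  note [simp] = G.Src G.Tgt H.Src H.Tgt K.Src K.Tgt
  have [simp]: "Tgt (box_smf A B H K) = B" by (simp add: box_smf_def)
  show ?thesis
    using assms G.A.symmetric_monoidal_category_axioms G.B.symmetric_monoidal_category_axioms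
      H.B.symmetric_monoidal_category_axioms
    by (intro smf_eqI[of C B] smf_comp_functor[of A B _ C] box_smf_functor)
      (auto simp: H.B.TenA_merge H.B.TenA_merge_assoc H.B.assoc)
qed

lemma ihom_pre_functor:
  assumes G: "symmetric_monoidal_functor C A G" and B: "symmetric_monoidal_category B"
  shows "symmetric_monoidal_functor (ihom A B) (ihom C B) (ihom_pre G B)"
proof -
  interpret G: symmetric_monoidal_functor C A G by fact
  interpret B: symmetric_monoidal_category B by fact
  note C = G.A.symmetric_monoidal_category_axioms and A = G.B.symmetric_monoidal_category_axioms
  note [simp] = G.Src G.Tgt ihom_simps[OF A B] ihom_simps[OF C B] ihom_closed[OF A B] ihom_closed[OF C B]
    smf_comp_functor[OF _ G] whisker_right_transformation[OF _ G]
    const_smf_comp[OF G B] box_smf_comp[OF G]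
  have ends [simp]: "symmetric_monoidal_functor A B (NDom \<theta>)" "symmetric_monoidal_functor A B (NCod \<theta>)"
    if "monoidal_transformation A B \<theta>" for \<theta>
    using that by (auto simp: monoidal_transformation_def)
  have src [simp]: "Src H = A" if "symmetric_monoidal_functor A B H" for H
    using that by (rule symmetric_monoidal_functor.Src)
  show ?thesis
    unfolding ihom_pre_def G.Src G.Tgt
    by (rule strict_smf_functor[OF ihom_symmetric_monoidal_category[OF A B]
          ihom_symmetric_monoidal_category[OF C B]])
      (auto intro!: mtrans_eqI[of C B])
qed

lemma ihom_post_trans_proj [simp]:
  "NDom (ihom_post_trans A \<sigma>) = ihom_post A (NDom \<sigma>)"
  "NCod (ihom_post_trans A \<sigma>) = ihom_post A (NCod \<sigma>)"
  "H \<in> Ob (ihom A (Src (NDom \<sigma>))) \<Longrightarrow> at (ihom_post_trans A \<sigma>) H = whisker_right \<sigma> H"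
  "at (ihom_post_trans A \<sigma>) \<in> extensional (Ob (ihom A (Src (NDom \<sigma>))))"
  by (simp_all add: ihom_post_trans_def)

lemma ihom_post_trans_transformation:
  assumes A: "symmetric_monoidal_category A" and \<sigma>: "monoidal_transformation B C \<sigma>"
  shows "monoidal_transformation (ihom A B) (ihom A C) (ihom_post_trans A \<sigma>)"
proof -
  interpret A: symmetric_monoidal_category A by fact
  interpret \<sigma>: monoidal_transformation B C \<sigma> by fact
  note B = \<sigma>.F.A.symmetric_monoidal_category_axioms and C = \<sigma>.F.B.symmetric_monoidal_category_axioms
  note ax [simp] = \<sigma>.F.symmetric_monoidal_functor_axioms \<sigma>.G.symmetric_monoidal_functor_axioms
  note [simp] = \<sigma>.F.Src \<sigma>.F.Tgt \<sigma>.G.Src \<sigma>.G.Tgt ihom_simps[OF A B] ihom_simps[OF A C]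
    box_smf_functor[OF A B] const_smf_functor[OF A B] box_smf_functor[OF A C] const_smf_functor[OF A C]
    ihom_Cmp[OF A C] ihom_TenA[OF A C]
    smf_comp_functor[OF ax(1)] smf_comp_functor[OF ax(2)] whisker_right_transformation[OF \<sigma>]
    whisker_left_transformation[OF ax(1)] whisker_left_transformation[OF ax(2)]
    ihom_post_functor[OF A ax(1)] ihom_post_functor[OF A ax(2)]
    symmetric_monoidal_functor.onO_typing[of A B] monoidal_transformation.at_typing[of A B]
  have ends [simp]: "symmetric_monoidal_functor A B (NDom \<theta>)" "symmetric_monoidal_functor A B (NCod \<theta>)"
    if "monoidal_transformation A B \<theta>" for \<theta>
    using that by (auto simp: monoidal_transformation_def)
  have src [simp]: "Src H = A" if "symmetric_monoidal_functor A B H" for H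
    using that by (rule symmetric_monoidal_functor.Src)
  interpret P: curried_functor "ihom A B" A C "ihom_post A (NDom \<sigma>)"
    by (intro curried_functorI ihom_symmetric_monoidal_category A B C) simp
  interpret Q: curried_functor "ihom A B" A C "ihom_post A (NCod \<sigma>)"
    by (intro curried_functorI ihom_symmetric_monoidal_category A B C) simp
  have ext: "at (ihom_post_trans A \<sigma>) \<in> extensional (Ob (ihom A B))"
    using ihom_post_trans_proj(4)[of A \<sigma>] by simp
  note P.transformations(2,3) [simp] Q.transformations(2,3) [simp]
  show ?thesis
    using ext
    by (intro monoidal_transformationI)
      (auto intro!: mtrans_eqI[of A C] simp: \<sigma>.at_nat \<sigma>.at_lax0 \<sigma>.at_lax2)
qed

text \<open>The object part of \<open>Rn\<close>; a strict functor is recovered from it by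
  \<open>En\<close>.\<close>

definition curry_smf ::
  "('a, 'f) smcat \<Rightarrow> ('b, 'g) smcat \<Rightarrow> (('a, 'b) tword, ('a, 'f, 'b, 'g) tterm set, 'q, 'k) smfun \<Rightarrow>
   ('a, 'f, ('b, 'g, 'q, 'k) smfun, ('b, 'g, 'q, 'k) mtrans) smfun" where
  "curry_smf A B F = ihom_post B F \<circ>\<^sub>1 eta A B"

context
  fixes A :: "('a, 'f) smcat" and B :: "('b, 'g) smcat" and C :: "('q, 'k) smcat"
  assumes A: "symmetric_monoidal_category A" and B: "symmetric_monoidal_category B"
    and C: "symmetric_monoidal_category C"
begin

interpretation A: symmetric_monoidal_category A by (rule A)
interpretation B: symmetric_monoidal_category B by (rule B)
interpretation C: symmetric_monoidal_category C by (rule C)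
interpretation eta: curried_functor A B "A \<Otimes> B" "eta A B"
  by (intro curried_functorI A B tensor_symmetric_monoidal_category eta_functor)

lemma curry_functor:
  assumes F: "symmetric_monoidal_functor (A \<Otimes> B) C F"
  shows "symmetric_monoidal_functor A (ihom B C) (curry_smf A B F)"
  unfolding curry_smf_def
  by (rule smf_comp_functor[OF ihom_post_functor[OF B F] eta_functor[OF A B]])

lemma curry_curried_functor:
  "symmetric_monoidal_functor (A \<Otimes> B) C F \<Longrightarrow> curried_functor A B C (curry_smf A B F)"
  by (intro curried_functorI A B C curry_functor)

context
  fixes F :: "(('a, 'b) tword, ('a, 'f, 'b, 'g) tterm set, 'q, 'k) smfun"
  assumes F: "symmetric_monoidal_functor (A \<Otimes> B) C F"
begin

interpretation F: symmetric_monoidal_functor "A \<Otimes> B" C F by (rule F)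

lemma curry_components:
  shows "a \<in> Ob A \<Longrightarrow> b \<in> Ob B \<Longrightarrow> onO (onO (curry_smf A B F) a) b = onO F (WGen a b)"
    "a \<in> Ob A \<Longrightarrow> g \<in> Ar B \<Longrightarrow> onA (onO (curry_smf A B F) a) g = onA F (tclass A B (TArrB a g))"
    "a \<in> Ob A \<Longrightarrow> lax0 (onO (curry_smf A B F) a) = onA F (tclass A B (TBeta a)) \<cdot>\<^bsub>C\<^esub> lax0 F"
    "a \<in> Ob A \<Longrightarrow> b \<in> Ob B \<Longrightarrow> b' \<in> Ob B \<Longrightarrow> lax2 (onO (curry_smf A B F) a) b b' =
       onA F (tclass A B (TDelta a b b')) \<cdot>\<^bsub>C\<^esub> lax2 F (WGen a b) (WGen a b')"
    "f \<in> Ar A \<Longrightarrow> b \<in> Ob B \<Longrightarrow> at (onA (curry_smf A B F) f) b = onA F (tclass A B (TArrA f b))"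
    "b \<in> Ob B \<Longrightarrow> at (lax0 (curry_smf A B F)) b = onA F (tclass A B (TAlpha b)) \<cdot>\<^bsub>C\<^esub> lax0 F"
    "a \<in> Ob A \<Longrightarrow> a' \<in> Ob A \<Longrightarrow> b \<in> Ob B \<Longrightarrow> at (lax2 (curry_smf A B F) a a') b =
       onA F (tclass A B (TGamma a a' b)) \<cdot>\<^bsub>C\<^esub> lax2 F (WGen a b) (WGen a' b)"
  by (simp_all add: F.Src F.Tgt curry_smf_def eta_ob_functor[OF A B]
      ihom_simps[OF B tensor_symmetric_monoidal_category[OF A B]])

end

lemma curry_const: "curry_smf A B (const_smf (A \<Otimes> B) C) = const_smf A (ihom B C)"
proof -
  note T = tensor_symmetric_monoidal_category[OF A B]
  note const = const_smf_functor[OF T C]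
  have c: "curried_functor A B C (const_smf A (ihom B C))"
    by (intro curried_functorI A B C const_smf_functor ihom_symmetric_monoidal_category)
  show ?thesis
    by (rule curried_functor_eqI[OF curry_curried_functor[OF const] c])
      (simp_all add: curry_components[OF const] ihom_simps[OF B C])
qed

text \<open>With \<open>curry_const\<close>, this is what makes \<open>Rn\<close> strict: the
  constraints of both sides agree because products and interchanges in the hom are evaluated
  pointwise.\<close>

lemma curry_box:
  assumes F: "symmetric_monoidal_functor (A \<Otimes> B) C F" and G: "symmetric_monoidal_functor (A \<Otimes> B) C G"
  shows "curry_smf A B (box_smf (A \<Otimes> B) C F G) = box_smf A (ihom B C) (curry_smf A B F) (curry_smf A B G)"
proof -
  note T = tensor_symmetric_monoidal_category[OF A B] and H = ihom_symmetric_monoidal_category[OF B C]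
  note FG = box_smf_functor[OF T C F G]
  have c: "curried_functor A B C (box_smf A (ihom B C) (curry_smf A B F) (curry_smf A B G))"
    by (intro curried_functorI A B C box_smf_functor H curry_functor F G)
  interpret F: symmetric_monoidal_functor "A \<Otimes> B" C F by fact
  interpret G: symmetric_monoidal_functor "A \<Otimes> B" C G by fact
  interpret cF: curried_functor A B C "curry_smf A B F" by (rule curry_curried_functor[OF F])
  interpret cG: curried_functor A B C "curry_smf A B G" by (rule curry_curried_functor[OF G])
  have inv: "at (inv_arrow (ihom B C) (Rho (ihom B C) (const_smf B C))) b = inv_arrow C (Rho C \<one>\<^bsub>C\<^esub>)"
    if "b \<in> Ob B" for b
    using that by (simp add: at_inv_arrow_ihom B C ihom_Rho const_smf_functor)
  have m: "at (interchange (ihom B C) P Q R S) b =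
      interchange C (onO P b) (onO Q b) (onO R b) (onO S b)"
    if [simp]: "symmetric_monoidal_functor B C P" "symmetric_monoidal_functor B C Q"
      "symmetric_monoidal_functor B C R" "symmetric_monoidal_functor B C S" "b \<in> Ob B" for P Q R S b
    by (simp add: interchange_def at_inv_arrow_ihom B C ihom_Ass box_smf_functor
        symmetric_monoidal_functor.onO_typing[of B C])
  show ?thesis
    by (rule curried_functor_eqI[OF curry_curried_functor[OF FG] c])
      (simp_all add: curry_components[OF FG] curry_components[OF F] curry_components[OF G]
        ihom_simps[OF B C] inv m C.TenA_merge C.TenA_merge_assoc C.assoc)
qed

end

definition curry_mtrans ::
  "('a, 'f) smcat \<Rightarrow> ('b, 'g) smcat \<Rightarrow> (('a, 'b) tword, ('a, 'f, 'b, 'g) tterm set, 'q, 'k) mtrans \<Rightarrow>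
   ('a, 'f, ('b, 'g, 'q, 'k) smfun, ('b, 'g, 'q, 'k) mtrans) mtrans" where
  "curry_mtrans A B \<sigma> = whisker_right (ihom_post_trans B \<sigma>) (eta A B)"

context
  fixes A :: "('a, 'f) smcat" and B :: "('b, 'g) smcat" and C :: "('q, 'k) smcat"
  assumes A: "symmetric_monoidal_category A" and B: "symmetric_monoidal_category B"
    and C: "symmetric_monoidal_category C"
begin

interpretation A: symmetric_monoidal_category A by (rule A)
interpretation B: symmetric_monoidal_category B by (rule B)
interpretation C: symmetric_monoidal_category C by (rule C)

lemma curry_trans_transformation:
  "monoidal_transformation (A \<Otimes> B) C \<sigma> \<Longrightarrow>
    monoidal_transformation A (ihom B C) (curry_mtrans A B \<sigma>)"
  unfolding curry_mtrans_def
  by (rule whisker_right_transformation[OF ihom_post_trans_transformation[OF B] eta_functor[OF A B]])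

lemma curry_trans_proj:
  "NDom (curry_mtrans A B \<sigma>) = curry_smf A B (NDom \<sigma>)" "NCod (curry_mtrans A B \<sigma>) = curry_smf A B (NCod \<sigma>)"
  by (simp_all add: curry_mtrans_def curry_smf_def)

lemma curry_trans_components:
  assumes "monoidal_transformation (A \<Otimes> B) C \<sigma>" "a \<in> Ob A" "b \<in> Ob B"
  shows "at (at (curry_mtrans A B \<sigma>) a) b = at \<sigma> (WGen a b)"
proof -
  interpret \<sigma>: monoidal_transformation "A \<Otimes> B" C \<sigma> by fact
  show ?thesis
    using assms
    by (simp add: curry_mtrans_def \<sigma>.F.Src ihom_simps[OF B tensor_symmetric_monoidal_category[OF A B]]
        eta_ob_functor[OF A B])
qed

lemma Rn_eq:
  "Rn A B C = strict_smf (ihom (A \<Otimes> B) C) (ihom A (ihom B C)) (curry_smf A B) (curry_mtrans A B)"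
  by (simp add: Rn_def curry_smf_def[abs_def] curry_mtrans_def[abs_def])

lemma Rn_functor:
  "symmetric_monoidal_functor (ihom (A \<Otimes> B) C) (ihom A (ihom B C)) (Rn A B C)"
proof -
  note T = tensor_symmetric_monoidal_category[OF A B] and H = ihom_symmetric_monoidal_category[OF B C]
  note [simp] = ihom_simps[OF T C] ihom_simps[OF A H] curry_trans_transformation curry_trans_proj
    curry_functor[OF A B C] curry_const[OF A B C] curry_box[OF A B C] ihom_closed[OF T C] ihom_closed[OF A H]
    curry_components[OF A B C] curry_trans_components
  have ends [simp]: "symmetric_monoidal_functor (A \<Otimes> B) C (NDom \<theta>)"
      "symmetric_monoidal_functor (A \<Otimes> B) C (NCod \<theta>)"
    if "monoidal_transformation (A \<Otimes> B) C \<theta>" for \<theta>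
    using that by (auto simp: monoidal_transformation_def)
  show ?thesis
    unfolding Rn_eq
    by (rule strict_smf_functor[OF ihom_symmetric_monoidal_category[OF T C]
          ihom_symmetric_monoidal_category[OF A H]])
      (auto intro!: curried_transformation_eqI[OF B C, of A])
qed

end

text \<open>The functor \<open>eta A (B \<Otimes> C)\<close> is generalised to an arbitrary curried
  \<open>G\<close>. The three stages \<open>K\<close>, \<open>En\<close> of \<open>K\<close> and
  \<open>A2\<close> then go from \<open>A\<close> to a double hom, from \<open>A \<Otimes> B\<close>
  to a hom, and from the iterated tensor product to \<open>D\<close>.\<close>

locale A'_setup =
  A: symmetric_monoidal_category A + B: symmetric_monoidal_category B +
  C: symmetric_monoidal_category C + D: symmetric_monoidal_category D +
  G: curried_functor A "B \<Otimes> C" D G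
  for A :: "('a, 'f) smcat" and B :: "('b, 'g) smcat" and C :: "('c, 'h) smcat"
    and D :: "('q, 'k) smcat"
    and G :: "('a, 'f, (('b, 'c) tword, ('b, 'g, 'c, 'h) tterm set, 'q, 'k) smfun,
      (('b, 'c) tword, ('b, 'g, 'c, 'h) tterm set, 'q, 'k) mtrans) smfun"
begin

lemmas A = A.symmetric_monoidal_category_axioms
lemmas B = B.symmetric_monoidal_category_axioms
lemmas C = C.symmetric_monoidal_category_axioms
lemmas D = D.symmetric_monoidal_category_axioms
lemmas AB = tensor_symmetric_monoidal_category[OF A B]
lemmas CD = ihom_symmetric_monoidal_category[OF C D]

abbreviation "K \<equiv> Rn B C D \<circ>\<^sub>1 G"

lemma K_functor: "symmetric_monoidal_functor A (ihom B (ihom C D)) K"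
  by (rule smf_comp_functor[OF Rn_functor[OF B C D] G.F.symmetric_monoidal_functor_axioms])

sublocale K: curried_functor A B "ihom C D" K
  by (intro curried_functorI A B CD K_functor)

text \<open>\<open>Rn\<close> is strict, so composing with it adds only identities to the
  constraints of \<open>G\<close>.\<close>

lemma K_components:
  shows "a \<in> Ob A \<Longrightarrow> onO K a = curry_smf B C (onO G a)"
    "f \<in> Ar A \<Longrightarrow> b \<in> Ob B \<Longrightarrow> c \<in> Ob C \<Longrightarrow> at (at (onA K f) b) c = at (onA G f) (WGen b c)"
    "b \<in> Ob B \<Longrightarrow> c \<in> Ob C \<Longrightarrow> at (at (lax0 K) b) c = at (lax0 G) (WGen b c)"
    "a \<in> Ob A \<Longrightarrow> a' \<in> Ob A \<Longrightarrow> b \<in> Ob B \<Longrightarrow> c \<in> Ob C \<Longrightarrow>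
      at (at (lax2 K a a') b) c = at (lax2 G a a') (WGen b c)"
  by (simp_all add: Rn_eq[OF B C D] G.F.Src curry_trans_components[OF B C D]
      curry_components[OF B C D] ihom_simps[OF B CD] ihom_simps[OF C D])

lemma E_functor: "symmetric_monoidal_functor (A \<Otimes> B) (ihom C D) (En A B (ihom C D) K)"
  by (rule K.En_functor)

sublocale E: curried_functor "A \<Otimes> B" C D "En A B (ihom C D) K"
  by (intro curried_functorI AB C D E_functor)

abbreviation "A2 \<equiv> En (A \<Otimes> B) C D (En A B (ihom C D) K)"

lemmas A2_functor = E.En_functor

text \<open>Four values are composites because the functors \<open>onO G a\<close> are merely lax
  and contribute their own constraints when curried. In the last two, outer \<alpha> and \<gamma> go
  to the constraints of a functor built by \<open>En\<close>, which are identities.\<close>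

lemma A2_values:
  shows "a \<in> Ob A \<Longrightarrow> b \<in> Ob B \<Longrightarrow> c \<in> Ob C \<Longrightarrow>
      onO A2 (WGen (WGen a b) c) = onO (onO G a) (WGen b c)"
    "a \<in> Ob A \<Longrightarrow> b \<in> Ob B \<Longrightarrow> h \<in> Ar C \<Longrightarrow>
      onA A2 (tclass (A \<Otimes> B) C (TArrB (WGen a b) h)) = onA (onO G a) (tclass B C (TArrB b h))"
    "a \<in> Ob A \<Longrightarrow> b \<in> Ob B \<Longrightarrow>
      onA A2 (tclass (A \<Otimes> B) C (TBeta (WGen a b))) =
        onA (onO G a) (tclass B C (TBeta b)) \<cdot>\<^bsub>D\<^esub> lax0 (onO G a)"
    "a \<in> Ob A \<Longrightarrow> b \<in> Ob B \<Longrightarrow> c \<in> Ob C \<Longrightarrow> c' \<in> Ob C \<Longrightarrow>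
      onA A2 (tclass (A \<Otimes> B) C (TDelta (WGen a b) c c')) =
        onA (onO G a) (tclass B C (TDelta b c c')) \<cdot>\<^bsub>D\<^esub> lax2 (onO G a) (WGen b c) (WGen b c')"
    "f \<in> Ar A \<Longrightarrow> b \<in> Ob B \<Longrightarrow> c \<in> Ob C \<Longrightarrow>
      onA A2 (tclass (A \<Otimes> B) C (TArrA (tclass A B (TArrA f b)) c)) = at (onA G f) (WGen b c)"
    "a \<in> Ob A \<Longrightarrow> g \<in> Ar B \<Longrightarrow> c \<in> Ob C \<Longrightarrow>
      onA A2 (tclass (A \<Otimes> B) C (TArrA (tclass A B (TArrB a g)) c)) =
        onA (onO G a) (tclass B C (TArrA g c))"
    "b \<in> Ob B \<Longrightarrow> c \<in> Ob C \<Longrightarrow>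
      onA A2 (tclass (A \<Otimes> B) C (TArrA (tclass A B (TAlpha b)) c)) = at (lax0 G) (WGen b c)"
    "a \<in> Ob A \<Longrightarrow> c \<in> Ob C \<Longrightarrow>
      onA A2 (tclass (A \<Otimes> B) C (TArrA (tclass A B (TBeta a)) c)) =
        onA (onO G a) (tclass B C (TAlpha c)) \<cdot>\<^bsub>D\<^esub> lax0 (onO G a)"
    "a \<in> Ob A \<Longrightarrow> a' \<in> Ob A \<Longrightarrow> b \<in> Ob B \<Longrightarrow> c \<in> Ob C \<Longrightarrow>
      onA A2 (tclass (A \<Otimes> B) C (TArrA (tclass A B (TGamma a a' b)) c)) =
        at (lax2 G a a') (WGen b c)"
    "a \<in> Ob A \<Longrightarrow> b \<in> Ob B \<Longrightarrow> b' \<in> Ob B \<Longrightarrow> c \<in> Ob C \<Longrightarrow>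
      onA A2 (tclass (A \<Otimes> B) C (TArrA (tclass A B (TDelta a b b')) c)) =
        onA (onO G a) (tclass B C (TGamma b b' c)) \<cdot>\<^bsub>D\<^esub> lax2 (onO G a) (WGen b c) (WGen b' c)"
    "c \<in> Ob C \<Longrightarrow> onA A2 (tclass (A \<Otimes> B) C (TAlpha c)) = Ide D \<one>\<^bsub>D\<^esub>"
    "word_over A B X \<Longrightarrow> word_over A B Y \<Longrightarrow> c \<in> Ob C \<Longrightarrow>
      onA A2 (tclass (A \<Otimes> B) C (TGamma X Y c)) =
        Ide D (onO A2 (WGen X c) \<otimes>\<^bsub>D\<^esub> onO A2 (WGen Y c))"
  by (simp_all add: K_components curry_components[OF B C D] del: smf_comp_proj)

end

section \<open>Strict functors and their values on generators\<close>

definition strict_functor :: "('o, 'm, 'p, 'n) smfun \<Rightarrow> bool" where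
  "strict_functor F \<longleftrightarrow> lax0 F = Ide (Tgt F) \<one>\<^bsub>Tgt F\<^esub> \<and>
    (\<forall>x\<in>Ob (Src F). \<forall>y\<in>Ob (Src F). lax2 F x y = Ide (Tgt F) (onO F x \<otimes>\<^bsub>Tgt F\<^esub> onO F y))"

locale strict_symmetric_monoidal_functor = symmetric_monoidal_functor +
  assumes strict: "strict_functor F"
begin

lemma strict_lax:
  "lax0 F = Ide B \<one>\<^bsub>B\<^esub>"
  "x \<in> Ob A \<Longrightarrow> y \<in> Ob A \<Longrightarrow> lax2 F x y = Ide B (onO F x \<otimes>\<^bsub>B\<^esub> onO F y)"
  using strict by (simp_all add: strict_functor_def Src Tgt)

text \<open>Read off from typing: a constraint that is an identity has equal domain and
  codomain.\<close>

lemma strict_onO [simp]: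
  "onO F \<one>\<^bsub>A\<^esub> = \<one>\<^bsub>B\<^esub>"
  "x \<in> Ob A \<Longrightarrow> y \<in> Ob A \<Longrightarrow> onO F (x \<otimes>\<^bsub>A\<^esub> y) = onO F x \<otimes>\<^bsub>B\<^esub> onO F y"
  using lax_typing(3) lax_typing(6)[of x y] by (simp_all add: strict_lax)

lemma strict_TenA:
  "f \<in> Ar A \<Longrightarrow> g \<in> Ar A \<Longrightarrow> onA F (f \<boxtimes>\<^bsub>A\<^esub> g) = onA F f \<boxtimes>\<^bsub>B\<^esub> onA F g"
  using lax2_nat[of f g "Cod A f" "Cod A g"] by (simp add: strict_lax)

lemma strict_structure:
  "x \<in> Ob A \<Longrightarrow> y \<in> Ob A \<Longrightarrow> z \<in> Ob A \<Longrightarrow>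
    onA F (Ass A x y z) = Ass B (onO F x) (onO F y) (onO F z)"
  "x \<in> Ob A \<Longrightarrow> onA F (Rho A x) = Rho B (onO F x)"
  "x \<in> Ob A \<Longrightarrow> onA F (Lam A x) = Lam B (onO F x)"
  "x \<in> Ob A \<Longrightarrow> y \<in> Ob A \<Longrightarrow> onA F (Sym A x y) = Sym B (onO F x) (onO F y)"
  using lax_assoc'[of x y z] lax_Rho'[of x] lax_Lam'[of x] lax_Sym[of x y]
  by (simp_all add: strict_lax)

lemma preserves_inv_arrow:
  assumes "f \<in> isos A x y" shows "onA F (inv_arrow A f) = inv_arrow B (onA F f)"
proof -
  note [simp] = A.inv_arrow_facts[OF assms]
  have "x \<in> Ob A" "y \<in> Ob A" using A.typing(1,2)[of f] by auto
  then have "inverse_arrows B (onA F f) (onA F (inv_arrow A f))"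
    using preserves_Cmp[of "inv_arrow A f" f] preserves_Cmp[of f "inv_arrow A f"]
    by (intro B.inverse_arrowsI) simp_all
  then show ?thesis by (simp add: B.inv_arrow_eqI)
qed

end

lemma strict_symmetric_monoidal_functorI:
  "symmetric_monoidal_functor A B F \<Longrightarrow> strict_functor F \<Longrightarrow> strict_symmetric_monoidal_functor A B F"
  by (simp add: strict_symmetric_monoidal_functor_def strict_symmetric_monoidal_functor_axioms_def)

lemma strict_functor_comp:
  assumes "symmetric_monoidal_functor B C G" "symmetric_monoidal_functor A B F"
    "strict_functor G" "strict_functor F"
  shows "strict_functor (G \<circ>\<^sub>1 F)"
proof -
  interpret G: strict_symmetric_monoidal_functor B C G
    using assms by (simp add: strict_symmetric_monoidal_functorI)
  interpret F: strict_symmetric_monoidal_functor A B F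
    using assms by (simp add: strict_symmetric_monoidal_functorI)
  show ?thesis
    by (simp add: strict_functor_def F.Src F.Tgt G.Src G.Tgt F.strict_lax G.strict_lax)
qed

lemma (in curried_functor) En_strict: "strict_functor (En A B C F)"
  by (simp add: strict_functor_def)

context
  fixes A :: "('a, 'f) smcat" and B :: "('b, 'g) smcat" and C :: "('q, 'k) smcat"
  assumes A: "symmetric_monoidal_category A" and B: "symmetric_monoidal_category B"
    and C: "symmetric_monoidal_category C"
begin

text \<open>A strict functor preserves every operation that builds words and formal arrows, so
  induction on these leaves only the generators. There the curried components are the values of
  \<open>P\<close>, its own constraints being identities.\<close>

lemma En_curry:
  assumes P: "symmetric_monoidal_functor (A \<Otimes> B) C P" and "strict_functor P"
  shows "En A B C (curry_smf A B P) = P"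
proof -
  interpret P: strict_symmetric_monoidal_functor "A \<Otimes> B" C P
    using assms by (simp add: strict_symmetric_monoidal_functorI)
  interpret c: curried_functor A B C "curry_smf A B P"
    by (rule curry_curried_functor[OF A B C P])
  note comps = curry_components[OF A B C P]
  have word: "En_word C (curry_smf A B P) X = onO P X" if "word_over A B X" for X
    using that P.strict_onO by (induction X) (simp_all add: comps)
  have eq: "En_term C (curry_smf A B P) t = onA P (tclass A B t)" if "term_over A B t" for t
    using that
  proof (induction t)
    case (TId X)
    then show ?case using P.preserves_Ide[of X] by (simp add: word)
  next
    case (TComp t u)
    then show ?case using P.preserves_Cmp[of "tclass A B t" "tclass A B u"] by simp
  next
    case (TLeft X t)
    then show ?case
      using P.strict_TenA[of "tclass A B (TId X)" "tclass A B t"] P.preserves_Ide[of X]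
      by (simp add: word tclass_TenA[OF A B] tclass_tten_Id[OF A B])
  next
    case (TRight t X)
    then show ?case
      using P.strict_TenA[of "tclass A B t" "tclass A B (TId X)"] P.preserves_Ide[of X]
      by (simp add: word tclass_TenA[OF A B] tclass_tten_Id[OF A B])
  next
    case (TAss X Y Z)
    then show ?case using P.strict_structure(1)[of X Y Z] by (simp add: word)
  next
    case (TAssInv X Y Z)
    then show ?case
      using P.strict_structure(1)[of X Y Z] P.preserves_inv_arrow[OF P.A.structure_isos(1)[of X Y Z]]
      by (simp add: word inv_tclass[OF A B])
  next
    case (TRho X)
    then show ?case using P.strict_structure(2)[of X] by (simp add: word)
  next
    case (TRhoInv X)
    then show ?case
      using P.strict_structure(2)[of X] P.preserves_inv_arrow[OF P.A.structure_isos(2)[of X]]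
      by (simp add: word inv_tclass[OF A B])
  next
    case (TLam X)
    then show ?case using P.strict_structure(3)[of X] by (simp add: word)
  next
    case (TLamInv X)
    then show ?case
      using P.strict_structure(3)[of X] P.preserves_inv_arrow[OF P.A.structure_isos(3)[of X]]
      by (simp add: word inv_tclass[OF A B])
  next
    case (TSym X Y)
    then show ?case using P.strict_structure(4)[of X Y] by (simp add: word)
  next
    case (TAlpha b)
    then show ?case using P.strict_onO(1) by (simp add: comps P.strict_lax)
  next
    case (TBeta a)
    then show ?case using P.strict_onO(1) by (simp add: comps P.strict_lax)
  next
    case (TGamma a a' b)
    then show ?case using P.strict_onO(2)[of "WGen a b" "WGen a' b"]
      by (simp add: comps P.strict_lax)
  next
    case (TDelta a b b')
    then show ?case using P.strict_onO(2)[of "WGen a b" "WGen a b'"]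
      by (simp add: comps P.strict_lax)
  qed (simp_all add: comps)
  show ?thesis
    by (rule smf_eqI[OF c.En_functor P])
      (auto simp: word eq tensor_Ar_iff P.strict_lax)
qed

text \<open>The constraints of the curried functor have as components the values of \<open>P\<close>
  at \<alpha> and \<gamma>; \<open>identity_transformation\<close> upgrades the pointwise hypotheses
  to identities in the hom.\<close>

lemma curry_strict:
  assumes P: "symmetric_monoidal_functor (A \<Otimes> B) C P" and "strict_functor P"
    and "\<And>b. b \<in> Ob B \<Longrightarrow> onA P (tclass A B (TAlpha b)) = Ide C \<one>\<^bsub>C\<^esub>"
    and "\<And>a a' b. a \<in> Ob A \<Longrightarrow> a' \<in> Ob A \<Longrightarrow> b \<in> Ob B \<Longrightarrow>
      onA P (tclass A B (TGamma a a' b)) = Ide C (onO P (WGen a b) \<otimes>\<^bsub>C\<^esub> onO P (WGen a' b))"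
  shows "strict_functor (curry_smf A B P)"
proof -
  interpret P: strict_symmetric_monoidal_functor "A \<Otimes> B" C P
    using assms by (simp add: strict_symmetric_monoidal_functorI)
  interpret c: curried_functor A B C "curry_smf A B P"
    by (rule curry_curried_functor[OF A B C P])
  note comps = curry_components[OF A B C P]
  have *: "onO P (WGen a b) \<in> Ob C" if "a \<in> Ob A" "b \<in> Ob B" for a b
    using P.onO_typing[of "WGen a b"] that by simp
  have "lax0 (curry_smf A B P) = Ide (ihom B C) (const_smf B C)"
    using identity_transformation(2)[OF c.transformations(2)]
    by (simp add: comps assms P.strict_lax)
  moreover have "lax2 (curry_smf A B P) a a' =
      Ide (ihom B C) (box_smf B C (onO (curry_smf A B P) a) (onO (curry_smf A B P) a'))"
    if "a \<in> Ob A" "a' \<in> Ob A" for a a'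
    using identity_transformation(2)[OF c.transformations(3)[OF that]] that
    by (simp add: comps assms P.strict_lax *)
  ultimately show ?thesis by (simp add: strict_functor_def c.F.Src c.F.Tgt)
qed

end

lemma trilinear_eqI:
  fixes A :: "('a, 'f) smcat" and B :: "('b, 'g) smcat" and C :: "('c, 'h) smcat"
    and D :: "('q, 'k) smcat"
  defines "c1 \<equiv> tclass A B" and "c2 \<equiv> tclass (A \<Otimes> B) C"
  assumes A: "symmetric_monoidal_category A" and B: "symmetric_monoidal_category B"
    and C: "symmetric_monoidal_category C"
    and P: "symmetric_monoidal_functor ((A \<Otimes> B) \<Otimes> C) D P" "strict_functor P"
    and Q: "symmetric_monoidal_functor ((A \<Otimes> B) \<Otimes> C) D Q" "strict_functor Q"
    and P_id: "\<And>c. c \<in> Ob C \<Longrightarrow> onA P (c2 (TAlpha c)) = Ide D \<one>\<^bsub>D\<^esub>"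
      "\<And>X Y c. word_over A B X \<Longrightarrow> word_over A B Y \<Longrightarrow> c \<in> Ob C \<Longrightarrow>
        onA P (c2 (TGamma X Y c)) = Ide D (onO P (WGen X c) \<otimes>\<^bsub>D\<^esub> onO P (WGen Y c))"
    and Q_id: "\<And>c. c \<in> Ob C \<Longrightarrow> onA Q (c2 (TAlpha c)) = Ide D \<one>\<^bsub>D\<^esub>"
      "\<And>X Y c. word_over A B X \<Longrightarrow> word_over A B Y \<Longrightarrow> c \<in> Ob C \<Longrightarrow>
        onA Q (c2 (TGamma X Y c)) = Ide D (onO Q (WGen X c) \<otimes>\<^bsub>D\<^esub> onO Q (WGen Y c))"
    and gens: "\<And>a b c. a \<in> Ob A \<Longrightarrow> b \<in> Ob B \<Longrightarrow> c \<in> Ob C \<Longrightarrow>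
        onO P (WGen (WGen a b) c) = onO Q (WGen (WGen a b) c)"
      "\<And>a b h. a \<in> Ob A \<Longrightarrow> b \<in> Ob B \<Longrightarrow> h \<in> Ar C \<Longrightarrow>
        onA P (c2 (TArrB (WGen a b) h)) = onA Q (c2 (TArrB (WGen a b) h))"
      "\<And>a b. a \<in> Ob A \<Longrightarrow> b \<in> Ob B \<Longrightarrow>
        onA P (c2 (TBeta (WGen a b))) = onA Q (c2 (TBeta (WGen a b)))"
      "\<And>a b c c'. a \<in> Ob A \<Longrightarrow> b \<in> Ob B \<Longrightarrow> c \<in> Ob C \<Longrightarrow> c' \<in> Ob C \<Longrightarrow>
        onA P (c2 (TDelta (WGen a b) c c')) = onA Q (c2 (TDelta (WGen a b) c c'))"
      "\<And>f b c. f \<in> Ar A \<Longrightarrow> b \<in> Ob B \<Longrightarrow> c \<in> Ob C \<Longrightarrow>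
        onA P (c2 (TArrA (c1 (TArrA f b)) c)) = onA Q (c2 (TArrA (c1 (TArrA f b)) c))"
      "\<And>a g c. a \<in> Ob A \<Longrightarrow> g \<in> Ar B \<Longrightarrow> c \<in> Ob C \<Longrightarrow>
        onA P (c2 (TArrA (c1 (TArrB a g)) c)) = onA Q (c2 (TArrA (c1 (TArrB a g)) c))"
      "\<And>b c. b \<in> Ob B \<Longrightarrow> c \<in> Ob C \<Longrightarrow>
        onA P (c2 (TArrA (c1 (TAlpha b)) c)) = onA Q (c2 (TArrA (c1 (TAlpha b)) c))"
      "\<And>a c. a \<in> Ob A \<Longrightarrow> c \<in> Ob C \<Longrightarrow>
        onA P (c2 (TArrA (c1 (TBeta a)) c)) = onA Q (c2 (TArrA (c1 (TBeta a)) c))"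
      "\<And>a a' b c. a \<in> Ob A \<Longrightarrow> a' \<in> Ob A \<Longrightarrow> b \<in> Ob B \<Longrightarrow> c \<in> Ob C \<Longrightarrow>
        onA P (c2 (TArrA (c1 (TGamma a a' b)) c)) = onA Q (c2 (TArrA (c1 (TGamma a a' b)) c))"
      "\<And>a b b' c. a \<in> Ob A \<Longrightarrow> b \<in> Ob B \<Longrightarrow> b' \<in> Ob B \<Longrightarrow> c \<in> Ob C \<Longrightarrow>
        onA P (c2 (TArrA (c1 (TDelta a b b')) c)) = onA Q (c2 (TArrA (c1 (TDelta a b b')) c))"
  shows "P = Q"
proof -
  note AB = tensor_symmetric_monoidal_category[OF A B]
  interpret P: strict_symmetric_monoidal_functor "(A \<Otimes> B) \<Otimes> C" D P
    using P by (simp add: strict_symmetric_monoidal_functorI)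
  interpret Q: strict_symmetric_monoidal_functor "(A \<Otimes> B) \<Otimes> C" D Q
    using Q by (simp add: strict_symmetric_monoidal_functorI)
  have D: "symmetric_monoidal_category D" by (rule P.B.symmetric_monoidal_category_axioms)
  note CD = ihom_symmetric_monoidal_category[OF C D]
  let ?P = "curry_smf (A \<Otimes> B) C P" and ?Q = "curry_smf (A \<Otimes> B) C Q"
  note comps = curry_components[OF AB C D P(1)] curry_components[OF AB C D Q(1)]
  have sP: "strict_functor ?P"
    by (rule curry_strict[OF AB C D P]) (use P_id in \<open>simp_all add: c2_def\<close>)
  have sQ: "strict_functor ?Q"
    by (rule curry_strict[OF AB C D Q]) (use Q_id in \<open>simp_all add: c2_def\<close>)
  interpret cP: strict_symmetric_monoidal_functor "A \<Otimes> B" "ihom C D" ?P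
    using sP curry_functor[OF AB C D P(1)] by (simp add: strict_symmetric_monoidal_functorI)
  interpret cQ: strict_symmetric_monoidal_functor "A \<Otimes> B" "ihom C D" ?Q
    using sQ curry_functor[OF AB C D Q(1)] by (simp add: strict_symmetric_monoidal_functorI)
  interpret dP: curried_functor "A \<Otimes> B" C D ?P by (rule curry_curried_functor[OF AB C D P(1)])
  interpret dQ: curried_functor "A \<Otimes> B" C D ?Q by (rule curry_curried_functor[OF AB C D Q(1)])
  \<comment> \<open>On a generator two functors out of \<open>C\<close> are compared, which takes
    the first four families; strictness of both curried functors extends this to all words.\<close>
  have obj: "onO ?P X = onO ?Q X" if "word_over A B X" for X
    using that
  proof (induction X)
    case WUnit
    then show ?case using cP.strict_onO(1) cQ.strict_onO(1) by simp
  next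
    case (WGen a b)
    then show ?case
      by (intro smf_eqI[of C D])
        (simp_all add: comps gens(1-4)[unfolded c2_def] P.strict_lax Q.strict_lax)
  next
    case (WTen X Y)
    then show ?case using cP.strict_onO(2)[of X Y] cQ.strict_onO(2)[of X Y] by simp
  qed
  \<comment> \<open>Equality at all \<open>c\<close> suffices because \<open>obj\<close> has already
    matched the ends of the two transformations.\<close>
  have arr: "onA ?P (tclass A B t) = onA ?Q (tclass A B t)"
    if "term_over A B t" and "\<And>c. c \<in> Ob C \<Longrightarrow>
        onA P (c2 (TArrA (tclass A B t) c)) = onA Q (c2 (TArrA (tclass A B t) c))" for t
    using that by (intro mtrans_eqI[of C D])
      (simp_all add: obj comps c2_def word_over_dom_cod[OF A B])
  note arrs = arr[unfolded c2_def] gens(5-10)[unfolded c1_def c2_def]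
  \<comment> \<open>The second currying: the seven families are \<open>obj\<close> and, through
    \<open>arr\<close>, the last six hypotheses on generators.\<close>
  have "curry_smf A B ?P = curry_smf A B ?Q"
    by (rule curried_functor_eqI[OF curry_curried_functor[OF A B CD] curry_curried_functor[OF A B CD]])
      (simp_all add: curry_components[OF A B CD] cP.symmetric_monoidal_functor_axioms
        cQ.symmetric_monoidal_functor_axioms obj arrs cP.strict_lax cQ.strict_lax)
  then have "?P = ?Q"
    using En_curry[OF A B CD cP.symmetric_monoidal_functor_axioms sP]
      En_curry[OF A B CD cQ.symmetric_monoidal_functor_axioms sQ] by metis
  then show ?thesis
    using En_curry[OF AB C D P] En_curry[OF AB C D Q] by metis
qed

section \<open>Values of the canonical arrows on generators\<close>

context
  fixes A :: "('a, 'f) smcat" and B :: "('b, 'g) smcat"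
  assumes A: "symmetric_monoidal_category A" and B: "symmetric_monoidal_category B"
begin

text \<open>Composition with a strict functor leaves factors such as \<open>TArrA\<close> or
  \<open>TArrB\<close> of an identity in the constraints; this removes them.\<close>

lemma tclass_Arr_Id:
  assumes "a \<in> Ob A" "b \<in> Ob B"
  shows "tclass A B (TArrA (Ide A a) b) = tclass A B (TId (WGen a b))"
    "tclass A B (TArrB a (Ide B b)) = tclass A B (TId (WGen a b))"
proof -
  interpret A: symmetric_monoidal_category A by (rule A)
  interpret B: symmetric_monoidal_category B by (rule B)
  show "tclass A B (TArrA (Ide A a) b) = tclass A B (TId (WGen a b))"
    by (rule tclass_relI[OF trel.ArrA_Id]) (simp_all add: assms)
  show "tclass A B (TArrB a (Ide B b)) = tclass A B (TId (WGen a b))"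
    by (rule tclass_relI[OF trel.ArrB_Id]) (simp_all add: assms)
qed

lemma eta_curried_functor: "curried_functor A B (A \<Otimes> B) (eta A B)"
  by (intro curried_functorI A B tensor_symmetric_monoidal_category eta_functor)

text \<open>\<open>A'_can\<close> sends some generators to classes of composites, and the next
  functor in the chain has to be evaluated on these.\<close>

lemma tensor_functor_Comp:
  assumes "symmetric_monoidal_functor (A \<Otimes> B) C F"
    and "term_over A B t" "term_over A B u" "tdom A B t = tcod A B u"
  shows "onA F (tclass A B (TComp t u)) = onA F (tclass A B t) \<cdot>\<^bsub>C\<^esub> onA F (tclass A B u)"
proof -
  interpret F: symmetric_monoidal_functor "A \<Otimes> B" C F by fact
  show ?thesis using F.preserves_Cmp[of "tclass A B t" "tclass A B u"] assms by simp
qed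

end

context
  fixes A :: "('a, 'f) smcat" and B :: "('b, 'g) smcat"
  assumes A: "symmetric_monoidal_category A" and B: "symmetric_monoidal_category B"
begin

interpretation eta: curried_functor B A "B \<Otimes> A" "eta B A" by (rule eta_curried_functor[OF B A])
interpretation S: curried_functor A B "B \<Otimes> A" "dual B A (B \<Otimes> A) (eta B A)"
  by (intro curried_functorI A B tensor_symmetric_monoidal_category eta.dual_functor)

lemma S_can_functor: "symmetric_monoidal_functor (A \<Otimes> B) (B \<Otimes> A) (S_can A B)"
  unfolding S_can_def by (rule S.En_functor)

lemma S_can_strict: "strict_functor (S_can A B)"
  unfolding S_can_def by (rule S.En_strict)

text \<open>The dual exchanges constraints of \<open>eta\<close> with constraints of its values,
  hence \<alpha> with \<beta> and \<gamma> with \<delta>.\<close>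

lemma S_can_values:
  "Src (S_can A B) = A \<Otimes> B" "Tgt (S_can A B) = B \<Otimes> A"
    "a \<in> Ob A \<Longrightarrow> b \<in> Ob B \<Longrightarrow> onO (S_can A B) (WGen a b) = WGen b a"
    "b \<in> Ob B \<Longrightarrow> onA (S_can A B) (tclass A B (TAlpha b)) = tclass B A (TBeta b)"
    "a \<in> Ob A \<Longrightarrow> onA (S_can A B) (tclass A B (TBeta a)) = tclass B A (TAlpha a)"
    "a \<in> Ob A \<Longrightarrow> a' \<in> Ob A \<Longrightarrow> b \<in> Ob B \<Longrightarrow>
      onA (S_can A B) (tclass A B (TGamma a a' b)) = tclass B A (TDelta b a a')"
    "a \<in> Ob A \<Longrightarrow> b \<in> Ob B \<Longrightarrow> b' \<in> Ob B \<Longrightarrow>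
      onA (S_can A B) (tclass A B (TDelta a b b')) = tclass B A (TGamma b b' a)"
    "f \<in> Ar A \<Longrightarrow> b \<in> Ob B \<Longrightarrow>
      onA (S_can A B) (tclass A B (TArrA f b)) = tclass B A (TArrB b f)"
    "a \<in> Ob A \<Longrightarrow> g \<in> Ar B \<Longrightarrow>
      onA (S_can A B) (tclass A B (TArrB a g)) = tclass B A (TArrA g a)"
  by (simp_all add: S_can_def)

end

context
  fixes A :: "('a, 'f) smcat" and B :: "('b, 'g) smcat" and C :: "('q, 'k) smcat"
    and G :: "('a, 'f, 'q, 'k) smfun"
  assumes G: "symmetric_monoidal_functor A C G" "strict_functor G"
    and B: "symmetric_monoidal_category B"
begin

interpretation G: strict_symmetric_monoidal_functor A C G
  using G by (rule strict_symmetric_monoidal_functorI)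
interpretation F: curried_functor A B "C \<Otimes> B" "eta C B \<circ>\<^sub>1 G"
  by (intro curried_functorI B tensor_symmetric_monoidal_category G.A.symmetric_monoidal_category_axioms
      G.B.symmetric_monoidal_category_axioms smf_comp_functor[OF eta_functor G(1)])

lemmas tensor_right_eq = tensor_right_def[of G B, unfolded G.Src G.Tgt]

lemma tensor_right_functor: "symmetric_monoidal_functor (A \<Otimes> B) (C \<Otimes> B) (tensor_right G B)"
  unfolding tensor_right_eq by (rule F.En_functor)

lemma tensor_right_strict: "strict_functor (tensor_right G B)"
  unfolding tensor_right_eq by (rule F.En_strict)

text \<open>For a lax \<open>G\<close> the values at \<alpha> and \<gamma> would contain its
  constraints; strictness reduces these to identities.\<close>

lemma tensor_right_values:
  "Src (tensor_right G B) = A \<Otimes> B" "Tgt (tensor_right G B) = C \<Otimes> B"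
    "a \<in> Ob A \<Longrightarrow> b \<in> Ob B \<Longrightarrow> onO (tensor_right G B) (WGen a b) = WGen (onO G a) b"
    "b \<in> Ob B \<Longrightarrow> onA (tensor_right G B) (tclass A B (TAlpha b)) = tclass C B (TAlpha b)"
    "a \<in> Ob A \<Longrightarrow> onA (tensor_right G B) (tclass A B (TBeta a)) = tclass C B (TBeta (onO G a))"
    "a \<in> Ob A \<Longrightarrow> a' \<in> Ob A \<Longrightarrow> b \<in> Ob B \<Longrightarrow> onA (tensor_right G B) (tclass A B (TGamma a a' b)) =
      tclass C B (TGamma (onO G a) (onO G a') b)"
    "a \<in> Ob A \<Longrightarrow> b \<in> Ob B \<Longrightarrow> b' \<in> Ob B \<Longrightarrow> onA (tensor_right G B) (tclass A B (TDelta a b b')) =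
      tclass C B (TDelta (onO G a) b b')"
    "f \<in> Ar A \<Longrightarrow> b \<in> Ob B \<Longrightarrow>
      onA (tensor_right G B) (tclass A B (TArrA f b)) = tclass C B (TArrA (onA G f) b)"
    "a \<in> Ob A \<Longrightarrow> g \<in> Ar B \<Longrightarrow>
      onA (tensor_right G B) (tclass A B (TArrB a g)) = tclass C B (TArrB (onO G a) g)"
  by (simp_all add: tensor_right_eq G.Src G.Tgt G.strict_lax B G.B.symmetric_monoidal_category_axioms
      tclass_Arr_Id tclass_Id)

end

lemma ihom_pre_proj [simp]:
  "Src (ihom_pre F B) = ihom (Tgt F) B" "Tgt (ihom_pre F B) = ihom (Src F) B"
  "H \<in> Ob (ihom (Tgt F) B) \<Longrightarrow> onO (ihom_pre F B) H = H \<circ>\<^sub>1 F"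
  "\<theta> \<in> Ar (ihom (Tgt F) B) \<Longrightarrow> onA (ihom_pre F B) \<theta> = whisker_right \<theta> F"
  "lax0 (ihom_pre F B) = Ide (ihom (Src F) B) \<one>\<^bsub>ihom (Src F) B\<^esub>"
  "H \<in> Ob (ihom (Tgt F) B) \<Longrightarrow> K \<in> Ob (ihom (Tgt F) B) \<Longrightarrow>
    lax2 (ihom_pre F B) H K = Ide (ihom (Src F) B) ((H \<circ>\<^sub>1 F) \<otimes>\<^bsub>ihom (Src F) B\<^esub> (K \<circ>\<^sub>1 F))"
  by (simp_all add: ihom_pre_def)

context
  fixes A :: "('a, 'f) smcat" and B :: "('b, 'g) smcat" and C :: "('q, 'k) smcat"
    and G :: "('b, 'g, 'q, 'k) smfun"
  assumes G: "symmetric_monoidal_functor B C G" "strict_functor G"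
    and A: "symmetric_monoidal_category A"
begin

interpretation G: strict_symmetric_monoidal_functor B C G
  using G by (rule strict_symmetric_monoidal_functorI)
interpretation eta: curried_functor A C "A \<Otimes> C" "eta A C"
  by (rule eta_curried_functor[OF A G.B.symmetric_monoidal_category_axioms])
interpretation F: curried_functor A B "A \<Otimes> C" "ihom_pre G (A \<Otimes> C) \<circ>\<^sub>1 eta A C"
  by (intro curried_functorI A G.A.symmetric_monoidal_category_axioms
      eta.C.symmetric_monoidal_category_axioms
      smf_comp_functor[OF ihom_pre_functor[OF G(1)] eta.F.symmetric_monoidal_functor_axioms])

lemmas tensor_left_eq = tensor_left_def[of A G, unfolded G.Src G.Tgt]

lemma tensor_left_functor: "symmetric_monoidal_functor (A \<Otimes> B) (A \<Otimes> C) (tensor_left A G)"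
  unfolding tensor_left_eq by (rule F.En_functor)

lemma tensor_left_strict: "strict_functor (tensor_left A G)"
  unfolding tensor_left_eq by (rule F.En_strict)

text \<open>Here it is at \<beta> and \<delta> that the constraints of \<open>G\<close> would
  enter.\<close>

lemma tensor_left_values:
  "Src (tensor_left A G) = A \<Otimes> B" "Tgt (tensor_left A G) = A \<Otimes> C"
    "a \<in> Ob A \<Longrightarrow> b \<in> Ob B \<Longrightarrow> onO (tensor_left A G) (WGen a b) = WGen a (onO G b)"
    "b \<in> Ob B \<Longrightarrow> onA (tensor_left A G) (tclass A B (TAlpha b)) = tclass A C (TAlpha (onO G b))"
    "a \<in> Ob A \<Longrightarrow> onA (tensor_left A G) (tclass A B (TBeta a)) = tclass A C (TBeta a)"
    "a \<in> Ob A \<Longrightarrow> a' \<in> Ob A \<Longrightarrow> b \<in> Ob B \<Longrightarrow> onA (tensor_left A G) (tclass A B (TGamma a a' b)) =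
      tclass A C (TGamma a a' (onO G b))"
    "a \<in> Ob A \<Longrightarrow> b \<in> Ob B \<Longrightarrow> b' \<in> Ob B \<Longrightarrow> onA (tensor_left A G) (tclass A B (TDelta a b b')) =
      tclass A C (TDelta a (onO G b) (onO G b'))"
    "f \<in> Ar A \<Longrightarrow> b \<in> Ob B \<Longrightarrow>
      onA (tensor_left A G) (tclass A B (TArrA f b)) = tclass A C (TArrA f (onO G b))"
    "a \<in> Ob A \<Longrightarrow> g \<in> Ar B \<Longrightarrow>
      onA (tensor_left A G) (tclass A B (TArrB a g)) = tclass A C (TArrB a (onA G g))"
  by (simp_all add: tensor_left_eq G.Src G.Tgt G.strict_lax A G.A.symmetric_monoidal_category_axioms
      G.B.symmetric_monoidal_category_axioms tclass_Arr_Id tclass_Id ihom_simps eta_ob_functor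
      eta.C.symmetric_monoidal_category_axioms)

end

context
  fixes A :: "('a, 'f) smcat" and B :: "('b, 'g) smcat" and C :: "('c, 'h) smcat"
  assumes A: "symmetric_monoidal_category A" and B: "symmetric_monoidal_category B"
    and C: "symmetric_monoidal_category C"
begin

interpretation A': A'_setup A B C "A \<Otimes> (B \<Otimes> C)" "eta A (B \<Otimes> C)"
  by (intro A'_setup.intro A B C tensor_symmetric_monoidal_category eta_curried_functor)

lemma A'_can_eq: "A'_can A B C = A'.A2"
  by (simp add: A'_can_def Let_def)

lemma A'_can_functor: "symmetric_monoidal_functor ((A \<Otimes> B) \<Otimes> C) (A \<Otimes> (B \<Otimes> C)) (A'_can A B C)"
  unfolding A'_can_eq by (rule A'.A2_functor)

lemma A'_can_strict: "strict_functor (A'_can A B C)"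
  unfolding A'_can_eq by (rule A'.E.En_strict)

lemma A'_can_ends: "Src (A'_can A B C) = (A \<Otimes> B) \<Otimes> C" "Tgt (A'_can A B C) = A \<Otimes> (B \<Otimes> C)"
  by (simp_all add: A'_can_eq)

lemma A'_can_values:
  "a \<in> Ob A \<Longrightarrow> b \<in> Ob B \<Longrightarrow> c \<in> Ob C \<Longrightarrow>
      onO (A'_can A B C) (WGen (WGen a b) c) = WGen a (WGen b c)"
    "a \<in> Ob A \<Longrightarrow> b \<in> Ob B \<Longrightarrow> h \<in> Ar C \<Longrightarrow> onA (A'_can A B C) (tclass (A \<Otimes> B) C (TArrB (WGen a b) h)) =
      tclass A (B \<Otimes> C) (TArrB a (tclass B C (TArrB b h)))"
    "a \<in> Ob A \<Longrightarrow> b \<in> Ob B \<Longrightarrow> onA (A'_can A B C) (tclass (A \<Otimes> B) C (TBeta (WGen a b))) =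
      tclass A (B \<Otimes> C) (TComp (TArrB a (tclass B C (TBeta b))) (TBeta a))"
    "a \<in> Ob A \<Longrightarrow> b \<in> Ob B \<Longrightarrow> c \<in> Ob C \<Longrightarrow> c' \<in> Ob C \<Longrightarrow>
      onA (A'_can A B C) (tclass (A \<Otimes> B) C (TDelta (WGen a b) c c')) =
      tclass A (B \<Otimes> C) (TComp (TArrB a (tclass B C (TDelta b c c'))) (TDelta a (WGen b c) (WGen b c')))"
    "f \<in> Ar A \<Longrightarrow> b \<in> Ob B \<Longrightarrow> c \<in> Ob C \<Longrightarrow>
      onA (A'_can A B C) (tclass (A \<Otimes> B) C (TArrA (tclass A B (TArrA f b)) c)) = tclass A (B \<Otimes> C) (TArrA f (WGen b c))"
    "a \<in> Ob A \<Longrightarrow> g \<in> Ar B \<Longrightarrow> c \<in> Ob C \<Longrightarrow>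
      onA (A'_can A B C) (tclass (A \<Otimes> B) C (TArrA (tclass A B (TArrB a g)) c)) =
      tclass A (B \<Otimes> C) (TArrB a (tclass B C (TArrA g c)))"
    "b \<in> Ob B \<Longrightarrow> c \<in> Ob C \<Longrightarrow>
      onA (A'_can A B C) (tclass (A \<Otimes> B) C (TArrA (tclass A B (TAlpha b)) c)) = tclass A (B \<Otimes> C) (TAlpha (WGen b c))"
    "a \<in> Ob A \<Longrightarrow> c \<in> Ob C \<Longrightarrow>
      onA (A'_can A B C) (tclass (A \<Otimes> B) C (TArrA (tclass A B (TBeta a)) c)) =
      tclass A (B \<Otimes> C) (TComp (TArrB a (tclass B C (TAlpha c))) (TBeta a))"
    "a \<in> Ob A \<Longrightarrow> a' \<in> Ob A \<Longrightarrow> b \<in> Ob B \<Longrightarrow> c \<in> Ob C \<Longrightarrow>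
      onA (A'_can A B C) (tclass (A \<Otimes> B) C (TArrA (tclass A B (TGamma a a' b)) c)) =
      tclass A (B \<Otimes> C) (TGamma a a' (WGen b c))"
    "a \<in> Ob A \<Longrightarrow> b \<in> Ob B \<Longrightarrow> b' \<in> Ob B \<Longrightarrow> c \<in> Ob C \<Longrightarrow>
      onA (A'_can A B C) (tclass (A \<Otimes> B) C (TArrA (tclass A B (TDelta a b b')) c)) =
      tclass A (B \<Otimes> C) (TComp (TArrB a (tclass B C (TGamma b b' c))) (TDelta a (WGen b c) (WGen b' c)))"
    "c \<in> Ob C \<Longrightarrow> onA (A'_can A B C) (tclass (A \<Otimes> B) C (TAlpha c)) = Ide (A \<Otimes> (B \<Otimes> C)) WUnit"
    "word_over A B X \<Longrightarrow> word_over A B Y \<Longrightarrow> c \<in> Ob C \<Longrightarrow> onA (A'_can A B C) (tclass (A \<Otimes> B) C (TGamma X Y c)) =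
      Ide (A \<Otimes> (B \<Otimes> C)) (WTen (onO (A'_can A B C) (WGen X c)) (onO (A'_can A B C) (WGen Y c)))"
  by (simp_all add: A'.A2_values[folded A'_can_eq])

end

section \<open>Comparison of the two composites\<close>

theorem lemma19p11:
  fixes A :: "('a, 'f) smcat" and B :: "('b, 'g) smcat" and C :: "('c, 'h) smcat"
  assumes "symmetric_monoidal_category A"
    and "symmetric_monoidal_category B"
    and "symmetric_monoidal_category C"
  shows "symmetric_monoidal_functor ((A \<Otimes> B) \<Otimes> C) (B \<Otimes> (A \<Otimes> C))
           (A'_can B A C \<circ>\<^sub>1 tensor_right (S_can A B) C) \<and>
         A'_can B A C \<circ>\<^sub>1 tensor_right (S_can A B) C =
         tensor_left B (S_can C A) \<circ>\<^sub>1 A'_can B C A \<circ>\<^sub>1 S_can A (B \<Otimes> C) \<circ>\<^sub>1 A'_can A B C"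
proof -
  note A = assms(1) and B = assms(2) and C = assms(3)
  note AB = tensor_symmetric_monoidal_category[OF A B] and BA = tensor_symmetric_monoidal_category[OF B A]
    and BC = tensor_symmetric_monoidal_category[OF B C] and CA = tensor_symmetric_monoidal_category[OF C A]
    and AC = tensor_symmetric_monoidal_category[OF A C]
  interpret A: symmetric_monoidal_category A by (rule A)
  interpret B: symmetric_monoidal_category B by (rule B)
  interpret C: symmetric_monoidal_category C by (rule C)
  let ?S = "S_can A B" and ?S' = "S_can C A" and ?S'' = "S_can A (B \<Otimes> C)"
  let ?R = "tensor_right ?S C" and ?L = "tensor_left B ?S'"
  note S = S_can_functor[OF A B] S_can_strict[OF A B]
    and S' = S_can_functor[OF C A] S_can_strict[OF C A]
    and S'' = S_can_functor[OF A BC] S_can_strict[OF A BC]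
  note R = tensor_right_functor[OF S C] tensor_right_strict[OF S C]
    and L = tensor_left_functor[OF S' B] tensor_left_strict[OF S' B]
    and A1 = A'_can_functor[OF B A C] A'_can_strict[OF B A C]
    and A2 = A'_can_functor[OF A B C] A'_can_strict[OF A B C]
    and A3 = A'_can_functor[OF B C A] A'_can_strict[OF B C A]
  let ?P = "A'_can B A C \<circ>\<^sub>1 ?R" and ?Q = "?L \<circ>\<^sub>1 A'_can B C A \<circ>\<^sub>1 ?S'' \<circ>\<^sub>1 A'_can A B C"
  have P: "symmetric_monoidal_functor ((A \<Otimes> B) \<Otimes> C) (B \<Otimes> (A \<Otimes> C)) ?P" "strict_functor ?P"
    by (rule smf_comp_functor[OF A1(1) R(1)], rule strict_functor_comp[OF A1(1) R(1) A1(2) R(2)])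
  have LA: "symmetric_monoidal_functor ((B \<Otimes> C) \<Otimes> A) (B \<Otimes> (A \<Otimes> C)) (?L \<circ>\<^sub>1 A'_can B C A)"
      "strict_functor (?L \<circ>\<^sub>1 A'_can B C A)"
    by (rule smf_comp_functor[OF L(1) A3(1)], rule strict_functor_comp[OF L(1) A3(1) L(2) A3(2)])
  have LAS: "symmetric_monoidal_functor (A \<Otimes> (B \<Otimes> C)) (B \<Otimes> (A \<Otimes> C)) (?L \<circ>\<^sub>1 A'_can B C A \<circ>\<^sub>1 ?S'')"
      "strict_functor (?L \<circ>\<^sub>1 A'_can B C A \<circ>\<^sub>1 ?S'')"
    by (rule smf_comp_functor[OF LA(1) S''(1)], rule strict_functor_comp[OF LA(1) S''(1) LA(2) S''(2)])
  have Q: "symmetric_monoidal_functor ((A \<Otimes> B) \<Otimes> C) (B \<Otimes> (A \<Otimes> C)) ?Q" "strict_functor ?Q"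
    by (rule smf_comp_functor[OF LAS(1) A2(1)], rule strict_functor_comp[OF LAS(1) A2(1) LAS(2) A2(2)])
  interpret S: strict_symmetric_monoidal_functor "A \<Otimes> B" "B \<Otimes> A" ?S
    using S by (simp add: strict_symmetric_monoidal_functorI)
  interpret A2: symmetric_monoidal_functor "(A \<Otimes> B) \<Otimes> C" "A \<Otimes> (B \<Otimes> C)" "A'_can A B C" by (rule A2)
  have wR: "word_over B A (onO ?S X)" if "word_over A B X" for X
    using S.onO_typing[of X] that by simp
  have wA2: "word_over A (B \<Otimes> C) (onO (A'_can A B C) (WGen X c))"
    if "word_over A B X" "c \<in> Ob C" for X c
    using A2.onO_typing[of "WGen X c"] that by simp
  note [simp] = S_can_values[OF A B] S_can_values[OF C A] S_can_values[OF A BC]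
    tensor_right_values[OF S C] tensor_left_values[OF S' B]
    A'_can_ends[OF B A C] A'_can_ends[OF A B C] A'_can_ends[OF B C A]
    A'_can_values[OF B A C] A'_can_values[OF A B C] A'_can_values[OF B C A]
    tensor_functor_Comp[OF A BC S''(1)] tensor_functor_Comp[OF BC A A3(1)]
    tensor_functor_Comp[OF B CA L(1)]
  \<comment> \<open>The conditions on \<alpha> and \<gamma> of the outer tensor product concern
    arbitrary words, whose images need not be generators. The last three factors are therefore kept
    opaque as \<open>M\<close>, of which only strictness is used.\<close>
  define M where "M = ?L \<circ>\<^sub>1 A'_can B C A \<circ>\<^sub>1 ?S''"
  interpret M: strict_symmetric_monoidal_functor "A \<Otimes> (B \<Otimes> C)" "B \<Otimes> (A \<Otimes> C)" M
    using LAS by (simp add: M_def strict_symmetric_monoidal_functorI)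
  have Q_id: "onA (M \<circ>\<^sub>1 A'_can A B C) (tclass (A \<Otimes> B) C (TAlpha c)) = Ide (B \<Otimes> (A \<Otimes> C)) \<one>\<^bsub>B \<Otimes> (A \<Otimes> C)\<^esub>"
      "word_over A B X \<Longrightarrow> word_over A B Y \<Longrightarrow>
        onA (M \<circ>\<^sub>1 A'_can A B C) (tclass (A \<Otimes> B) C (TGamma X Y c)) =
        Ide (B \<Otimes> (A \<Otimes> C)) (onO (M \<circ>\<^sub>1 A'_can A B C) (WGen X c) \<otimes>\<^bsub>B \<Otimes> (A \<Otimes> C)\<^esub>
          onO (M \<circ>\<^sub>1 A'_can A B C) (WGen Y c))"
    if c: "c \<in> Ob C" for X Y c
  proof -
    show "onA (M \<circ>\<^sub>1 A'_can A B C) (tclass (A \<Otimes> B) C (TAlpha c)) = Ide (B \<Otimes> (A \<Otimes> C)) \<one>\<^bsub>B \<Otimes> (A \<Otimes> C)\<^esub>"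
      using c M.preserves_Ide[of WUnit] M.strict_onO(1) by simp
    assume X: "word_over A B X" "word_over A B Y"
    let ?X = "onO (A'_can A B C) (WGen X c)" and ?Y = "onO (A'_can A B C) (WGen Y c)"
    show "onA (M \<circ>\<^sub>1 A'_can A B C) (tclass (A \<Otimes> B) C (TGamma X Y c)) =
        Ide (B \<Otimes> (A \<Otimes> C)) (onO (M \<circ>\<^sub>1 A'_can A B C) (WGen X c) \<otimes>\<^bsub>B \<Otimes> (A \<Otimes> C)\<^esub>
          onO (M \<circ>\<^sub>1 A'_can A B C) (WGen Y c))"
      using c X M.preserves_Ide[of "WTen ?X ?Y"] M.strict_onO(2)[of ?X ?Y] by (simp add: wA2)
  qed
  interpret L: strict_symmetric_monoidal_functor "B \<Otimes> (C \<Otimes> A)" "B \<Otimes> (A \<Otimes> C)" ?L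
    using L by (simp add: strict_symmetric_monoidal_functorI)
  \<comment> \<open>At the generators involving \<beta> or \<delta> of a composite object,
    \<open>A'_can A B C\<close> leaves a factor \<beta> or \<delta>;
    \<open>S_can A (B \<Otimes> C)\<close> turns it into \<alpha> or \<gamma>, and
    \<open>A'_can B C A\<close> into an identity. \<open>?L\<close> has to carry this identity
    through, after which it is dropped.\<close>
  have L_Id: "onA ?L (tclass B (C \<Otimes> A) (TId X)) = tclass B (A \<Otimes> C) (TId (onO ?L X))"
    if "word_over B (C \<Otimes> A) X" for X
    using that L.preserves_Ide[of X] by simp
  note [simp] = L_Id L.strict_onO[simplified] tclass_Id[OF B AC]
  have "?P = ?Q"
  \<comment> \<open>Cases 3 and 4 are the conditions on \<alpha> and \<gamma> for the right-hand
    composite. For the left-hand one, \<open>wR\<close> supplies the side condition of the value at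
    \<gamma>. The other cases evaluate both sides on a generator.\<close>
  proof (rule trilinear_eqI[OF A B C P Q], goal_cases)
    case 3 then show ?case by (rule Q_id(1)[unfolded M_def])
  next
    case 4 then show ?case by (intro Q_id(2)[unfolded M_def])
  qed (simp_all add: wR)
  with P(1) show ?thesis by simp
qed

end
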